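(* Let $\mathbf b>0$ be fixed and let the kernel $\mathcal K$ satisfy, in addition to the kernel assumption of the context, $\int z^j\mathcal K(z)\,dz=0$ for all $j=1,\dots,m_{\mathbf b}$. Then for any $0<\beta\le\mathbf b$, $L>0$, $r\ge1$ and $t\in[-1/2,1/2]^2$ there is a constant $\varkappa_1$, independent of $n$, such that for all $n\ge n_0\vee n_1$ (where $n_0$ is computed with any fixed $\beta_0\in(0,1)$, $M>0$ for which $\mathbb{H}(\beta,L)\subseteq\mathbb{F}(\beta_0,M)$) $$\sup_{F\in\mathbb{F}_2(\beta,L)}\mathcal R^{(n)}_{r,t}\big(\widehat F_{(\hat\theta,\hat h)},F\big)\le\varkappa_1\,\psi_n(\beta,L),\qquad \psi_n(\beta,L)=L^{1/(2\beta+1)}\big[n^{-1}\ln(n)\big]^{\beta/(2\beta+1)} .$$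
   Context: **Model.** One observes $(X_1,Y_1),\dots,(X_n,Y_n)\in\mathbb{R}^2\times\mathbb{R}$ with $Y_i=F(X_i)+\varepsilon_i$, where $F(x)=f(x^\top\theta^* )$ with unknown $f:\mathbb{R}\to\mathbb{R}$ and unknown $\theta^*\in\mathbb{S}^1$ (unit sphere of $\mathbb{R}^2$). The $X_i$ are i.i.d. with known Lebesgue density $g$, the $\varepsilon_i$ are i.i.d. centered, and the sequences $(X_i)$, $(\varepsilon_i)$ are independent. $\mathbb{E}^{(n)}_F$ is expectation under the law of $\{(X_i,Y_i)\}_{i=1}^n$. The pointwise risk is $\mathcal R^{(n)}_{r,t}(\widehat F,F)=\big(\mathbb{E}^{(n)}_F|\widehat F(t)-F(t)|^r\big)^{1/r}$. **Standing assumptions.** (Noise) $\varepsilon_1$ has a symmetric distribution with density $p\in\mathfrak P=\{\ell:\mathbb{R}\to\mathbb{R}_+ : \int_x^\infty \ell(y)\,dy\le\Upsilon e^{-\Omega x^\omega}\ \forall x\ge0\}$, where $\Upsilon>0,\Omega\in(0,1],\omega>0$ are fixed. (Design) There is $\underline g\in(0,1)$ with $\inf_{x\in[-3,3]^2}g(x)\ge\underline g$. (Kernel) $\mathcal K:\mathbb{R}\to\mathbb{R}$ is symmetric, $\mathrm{supp}(\mathcal K)\subseteq[-1/2,1/2]$, $\int\mathcal K=1$, and $|\mathcal K(u)-\mathcal K(v)|\le Q|u-v|$ for all $u,v$, for some $Q>0$. Put $K(u,v)=\mathcal K(u)\mathcal K(v)$; $\|\mathcal K\|_p$ is the $L_p(\mathbb{R})$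 norm. **Function classes.** For $a>0$, $m_a$ is the maximal integer strictly less than $a$. The Hölder class $\mathbb{H}(\beta,L)$ ($\beta,L>0$) is the set of $m_\beta$-times continuously differentiable $\ell:\mathbb{R}\to\mathbb{R}$ with $\|\ell^{(m)}\|_\infty\le L$ for all $m\le m_\beta$ and $|\ell^{(m_\beta)}(u+h)-\ell^{(m_\beta)}(u)|\le Lh^{\beta-m_\beta}$ for all $u\in\mathbb{R},h>0$. $\mathbb{F}_2(\beta,L)=\{F:\mathbb{R}^2\to\mathbb{R}: F(z)=f(z^\top\theta),\ f\in\mathbb{H}(\beta,L),\ \theta\in\mathbb{S}^1\}$. For $\beta_0\in(0,1),M>0$: $\mathbb{F}(\beta_0,M)=\{U:\mathbb{R}\to\mathbb{R}: \|U\|_\infty+\sup_{y_1\neq y_2}|U(y_1)-U(y_2)|/|y_1-y_2|^{\beta_0}\le M\}$. **Sample size.** $h_{\min}=n^{-1}\ln^{1+2/\omega}(n)$, $\mathfrak h=\sqrt{n^{-1}\ln^{1+1/\omega}(n)}$; $n_0=\inf\{m\in\mathbb{N}^*: (M\vee1)\max\{\mathfrak h^{\beta_0},\ln^{1/\omega}(n)h_{\min}^{\beta_0}\}\le1\ \forall n\ge m\}$; $n_1=\inf\{m\in\mathbb{N}^*: (n\mathfrak h^2)^{-1/2}C_3(n)\le1/2\ \forall n\ge m\}$. **Constants.** $\tau=(\Omega^{-1}(4r+1)\ln(n))^{1/\omega}$, $\sigma^2=\sup\int x^2p(x)\,dx$ over symmetric probability densities $p\in\mathfrak P$, $c_1(n)=730\ln(16n^2\underline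 g^{-1/2}[12Q+\sqrt2])+8r\ln(n)+394$, $c_2(n)=730\ln(16n^2\tau\underline g^{-1/2}[12Q+\sqrt2])+8r\ln(n)+394$, $c_3(n)=365\ln(5n^2Q\underline g^{-1/2})+8r\ln(n)+197$, $c_4(n)=365\ln(5n^2\tau Q\underline g^{-1/2})+8r\ln(n)+197$, $C_1(n)=2\sqrt2\,\underline g^{-1/2}\|\mathcal K\|_\infty^2\sqrt{c_1(n)}+\frac83c_1(n)(\ln n)^{-(2+\omega)/(2\omega)}\underline g^{-1}\|\mathcal K\|^2_\infty$, $C_2(n)=2\sqrt2(\sigma\vee1)\underline g^{-1/2}\|\mathcal K\|_\infty^2\sqrt{c_2(n)}+\frac83c_2(n)(\ln n)^{-1/2}\underline g^{-1}\|\mathcal K\|_\infty^2(\Omega^{-1}(4r+1))^{1/\omega}$, $C_3(n)=2\sqrt2\,\underline g^{-1/2}\|\mathcal K\|_\infty^2\sqrt{c_3(n)}+\frac83\underline g^{-1}\|\mathcal K\|_\infty^2c_3(n)(n\mathfrak h^2)^{-1/2}$, $C_4(n)=2\sqrt2(\sigma\vee1)\underline g^{-1/2}\|\mathcal K\|_\infty^2\sqrt{c_4(n)}+\frac83\tau c_4(n)(n\mathfrak h^2)^{-1/2}\underline g^{-1}\|\mathcal K\|_\infty^2$, $C_5(n)=\|\mathcal K\|_1^2+(n\mathfrak h^2)^{-1/2}C_4(n)+1/2$. **Estimator** (here $r$ is the index of the risk; the estimator does not depend on $\beta,L,\beta_0,M$). For a $2\times2$ matrix $E$ put $\widehat F(E,t)=\frac{\det(E)}n\sum_{i=1}^n\frac{K(E(X_i-t))}{g(X_i)}Y_i$.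 For $\theta,\nu\in\mathbb{S}^1$, $h>0$ let $E_{(\theta,h)}=\begin{pmatrix}h^{-1}\theta_1&h^{-1}\theta_2\\-\theta_2&\theta_1\end{pmatrix}$, $\overline E_{(\theta,h)(\nu,h)}=\begin{pmatrix}\frac{\theta_1+\nu_1}{2h(1+|\nu^\top\theta|)}&\frac{\theta_2+\nu_2}{2h(1+|\nu^\top\theta|)}\\-\frac{\theta_2+\nu_2}{2(1+|\nu^\top\theta|)}&\frac{\theta_1+\nu_1}{2(1+|\nu^\top\theta|)}\end{pmatrix}$, and $E_{(\theta,h)(\nu,h)}=\overline E_{(\theta,h)(\nu,h)}$ if $\nu^\top\theta\ge0$, $=\overline E_{(-\theta,h)(\nu,h)}$ if $\nu^\top\theta<0$. Write $\widehat F_{(\theta,h)}(t)=\widehat F(E_{(\theta,h)},t)$ and $\widehat F_{(\theta,h)(\nu,h)}(t)=\widehat F(E_{(\theta,h)(\nu,h)},t)$. Let $K_{\mathfrak h}(u_1,u_2)=\mathfrak h^{-2}\mathcal K(u_1/\mathfrak h)\mathcal K(u_2/\mathfrak h)$ and $\widehat F_\infty=2\sup_{v\in[-5/2,5/2]^2}\big|n^{-1}\sum_{i=1}^ng^{-1}(X_i)K_{\mathfrak h}(X_i-v)Y_i\big|+2C_5(n)$. For $\eta\in(0,1]$ let $\mathrm{TH}(\eta)=2\big[\|\mathcal K\|_\infty^2\sqrt{\ln(n)}+\widehat F_\infty C_1(n)+C_2(n)\big](\eta n)^{-1/2}$. Let $\mathcal H_n=\{2^{-k}:k=0,1,2,\dots\}\cap[2^{-1}h_{\min},1]$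 and, for $\theta\in\mathbb{S}^1,h\in\mathcal H_n$, $R^{(1)}_t(\theta,h)=\sup_{\eta\in\mathcal H_n,\eta\le h}\big[\sup_{\nu\in\mathbb{S}^1}|\widehat F_{(\theta,\eta)(\nu,\eta)}(t)-\widehat F_{(\nu,\eta)}(t)|-\mathrm{TH}(\eta)\big]_+$, $R^{(2)}_t(h)=\sup_{\eta\in\mathcal H_n,\eta\le h}\big[\sup_{\theta\in\mathbb{S}^1}|\widehat F_{(\theta,h)}(t)-\widehat F_{(\theta,\eta)}(t)|-\mathrm{TH}(\eta)\big]_+$. $(\hat\theta,\hat h)$ (depending on $t$) is a measurable minimizer of $R^{(1)}_t(\theta,h)+R^{(2)}_t(h)+\mathrm{TH}(h)$ over $\mathbb{S}^1\times\mathcal H_n$, and the estimator is $t\mapsto\widehat F_{(\hat\theta,\hat h)}(t)$. *)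

theory Defs
  imports "HOL-Probability.Probability"
begin

section \<open>Function classes\<close>

definition strict_floor :: "real \<Rightarrow> nat" where
  "strict_floor a = (GREATEST m. real m < a)"

text \<open>
  Only continuous functions matter below (the kernel and the functions in the classes), and for
  these the supremum is the \<open>L\<^sub>\<infinity>\<close> norm. The value is extended real, so that unbounded functions
  have norm \<open>\<infinity>\<close>.
\<close>

definition sup_norm :: "(real \<Rightarrow> real) \<Rightarrow> ereal" where
  "sup_norm f = (SUP x. ereal \<bar>f x\<bar>)"

definition holder_class :: "real \<Rightarrow> real \<Rightarrow> (real \<Rightarrow> real) set" where
  "holder_class \<beta> L = {f. let k = strict_floor \<beta> in
     (\<forall>m<k. \<forall>x. (deriv ^^ m) f differentiable (at x)) \<and>
     continuous_on UNIV ((deriv ^^ k) f) \<and>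
     (\<forall>m\<le>k. sup_norm ((deriv ^^ m) f) \<le> ereal L) \<and>
     (\<forall>u h. 0 < h \<longrightarrow>
        \<bar>(deriv ^^ k) f (u + h) - (deriv ^^ k) f u\<bar> \<le> L * h powr (\<beta> - real k))}"

definition single_index_class :: "real \<Rightarrow> real \<Rightarrow> (real^2 \<Rightarrow> real) set" where
  "single_index_class \<beta> L = {(\<lambda>z. f (z \<bullet> \<theta>)) | f \<theta>. f \<in> holder_class \<beta> L \<and> \<theta> \<in> sphere 0 1}"

definition holder_ball :: "real \<Rightarrow> real \<Rightarrow> (real \<Rightarrow> real) set" where
  "holder_ball \<beta>0 M = {U.
     sup_norm U +
     (SUP (y1, y2) \<in> {(y1, y2). y1 \<noteq> y2}. ereal (\<bar>U y1 - U y2\<bar> / \<bar>y1 - y2\<bar> powr \<beta>0))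
     \<le> ereal M}"


section \<open>Noise, design and kernel\<close>

definition prob_density :: "('a::euclidean_space \<Rightarrow> real) \<Rightarrow> bool" where
  "prob_density q \<longleftrightarrow> q \<in> borel_measurable borel \<and> (\<forall>x. 0 \<le> q x) \<and>
     (\<integral>\<^sup>+x. ennreal (q x) \<partial>lborel) = 1"

definition symmetric_distribution :: "real measure \<Rightarrow> bool" where
  "symmetric_distribution \<mu> \<longleftrightarrow> distr \<mu> borel uminus = \<mu>"

definition tail_class :: "real \<Rightarrow> real \<Rightarrow> real \<Rightarrow> (real \<Rightarrow> real) set" where
  "tail_class \<Upsilon> \<Omega> \<omega> = {q. q \<in> borel_measurable borel \<and> (\<forall>x. 0 \<le> q x) \<and>
     (\<forall>x\<ge>0. (\<integral>\<^sup>+y\<in>{x..}. ennreal (q y) \<partial>lborel) \<le> ennreal (\<Upsilon> * exp (- \<Omega> * x powr \<omega>)))}"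

definition noise_densities :: "real \<Rightarrow> real \<Rightarrow> real \<Rightarrow> (real \<Rightarrow> real) set" where
  "noise_densities \<Upsilon> \<Omega> \<omega> = {q \<in> tail_class \<Upsilon> \<Omega> \<omega>. prob_density q \<and>
     symmetric_distribution (density lborel (\<lambda>x. ennreal (q x)))}"

definition square :: "real \<Rightarrow> (real^2) set" where
  "square a = {x. \<forall>i. \<bar>x $ i\<bar> \<le> a}"

definition kernel_assumption :: "(real \<Rightarrow> real) \<Rightarrow> real \<Rightarrow> bool" where
  "kernel_assumption \<K> Q \<longleftrightarrow>
     (\<forall>u. \<K> (- u) = \<K> u) \<and>
     closure {u. \<K> u \<noteq> 0} \<subseteq> {-1/2..1/2} \<and>
     (LINT u|lborel. \<K> u) = 1 \<and>
     0 < Q \<and> (\<forall>u v. \<bar>\<K> u - \<K> v\<bar> \<le> Q * \<bar>u - v\<bar>)"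


section \<open>Law of the sample and risk\<close>

text \<open>
  A sample is a function on \<open>{1..n}\<close> with \<open>d i = (X\<^sub>i, Y\<^sub>i)\<close>. Its law is the image of the law of
  the independent pairs \<open>(X\<^sub>i, \<epsilon>\<^sub>i)\<close>.
\<close>

type_synonym sample = "nat \<Rightarrow> (real^2) \<times> real"

definition sample_space :: "nat \<Rightarrow> sample measure" where
  "sample_space n = Pi\<^sub>M {1..n} (\<lambda>_. borel)"

definition sample_law ::
  "(real^2 \<Rightarrow> real) \<Rightarrow> (real \<Rightarrow> real) \<Rightarrow> nat \<Rightarrow> (real^2 \<Rightarrow> real) \<Rightarrow> sample measure" where
  "sample_law g p n F =
     distr (Pi\<^sub>M {1..n} (\<lambda>_. density lborel (\<lambda>x. ennreal (g x)) \<Otimes>\<^sub>M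
                               density lborel (\<lambda>x. ennreal (p x))))
       (sample_space n)
       (\<lambda>w. \<lambda>i\<in>{1..n}. (fst (w i), F (fst (w i)) + snd (w i)))"

definition ennreal_powr :: "ennreal \<Rightarrow> real \<Rightarrow> ennreal" where
  "ennreal_powr x a = (if x = \<infinity> then \<infinity> else ennreal (enn2real x powr a))"

definition pointwise_risk ::
  "real \<Rightarrow> real^2 \<Rightarrow> sample measure \<Rightarrow> (sample \<Rightarrow> real^2 \<Rightarrow> real) \<Rightarrow> (real^2 \<Rightarrow> real) \<Rightarrow> ennreal" where
  "pointwise_risk r t \<P> Fest F =
     ennreal_powr (\<integral>\<^sup>+d. ennreal (\<bar>Fest d t - F t\<bar> powr r) \<partial>\<P>) (1 / r)"

definition rate :: "nat \<Rightarrow> real \<Rightarrow> real \<Rightarrow> real" where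
  "rate n \<beta> L = L powr (1 / (2 * \<beta> + 1)) * (ln (real n) / real n) powr (\<beta> / (2 * \<beta> + 1))"


section \<open>Bandwidths and matrices\<close>

definition h_min :: "real \<Rightarrow> nat \<Rightarrow> real" where
  "h_min \<omega> n = ln (real n) powr (1 + 2 / \<omega>) / real n"

definition h_frak :: "real \<Rightarrow> nat \<Rightarrow> real" where
  "h_frak \<omega> n = sqrt (ln (real n) powr (1 + 1 / \<omega>) / real n)"

text \<open>For positive \<open>\<omega>\<close> and \<open>\<beta>0\<close> the set below is not empty, since both terms of the inner maximum
  tend to \<open>0\<close>.\<close>

definition n0 :: "real \<Rightarrow> real \<Rightarrow> real \<Rightarrow> nat" where
  "n0 \<omega> \<beta>0 M = Inf {m. 1 \<le> m \<and> (\<forall>n\<ge>m.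
     max M 1 * max (h_frak \<omega> n powr \<beta>0) (ln (real n) powr (1 / \<omega>) * h_min \<omega> n powr \<beta>0) \<le> 1)}"

definition bandwidths :: "real \<Rightarrow> nat \<Rightarrow> real set" where
  "bandwidths \<omega> n = {(1 / 2) ^ k | k :: nat. True} \<inter> {h_min \<omega> n / 2..1}"

definition E_mat :: "real^2 \<Rightarrow> real \<Rightarrow> real^2^2" where
  "E_mat \<theta> h = vector [vector [\<theta> $ 1 / h, \<theta> $ 2 / h],
                       vector [- \<theta> $ 2, \<theta> $ 1]]"

definition Ebar_mat :: "real^2 \<Rightarrow> real^2 \<Rightarrow> real \<Rightarrow> real^2^2" where
  "Ebar_mat \<theta> \<nu> h =
     vector [vector [(\<theta> $ 1 + \<nu> $ 1) / (2 * h * (1 + \<bar>\<nu> \<bullet> \<theta>\<bar>)),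
                     (\<theta> $ 2 + \<nu> $ 2) / (2 * h * (1 + \<bar>\<nu> \<bullet> \<theta>\<bar>))],
             vector [- ((\<theta> $ 2 + \<nu> $ 2) / (2 * (1 + \<bar>\<nu> \<bullet> \<theta>\<bar>))),
                     (\<theta> $ 1 + \<nu> $ 1) / (2 * (1 + \<bar>\<nu> \<bullet> \<theta>\<bar>))]]"

definition E_pair_mat :: "real^2 \<Rightarrow> real^2 \<Rightarrow> real \<Rightarrow> real^2^2" where
  "E_pair_mat \<theta> \<nu> h = (if 0 \<le> \<nu> \<bullet> \<theta> then Ebar_mat \<theta> \<nu> h else Ebar_mat (- \<theta>) \<nu> h)"


section \<open>The selection rule\<close>

text \<open>
  The locale only shares the parameters on which the procedure depends: the kernel, the design
  density with its lower bound \<open>gl\<close>, the Lipschitz constant of the kernel, the constants of the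
  noise class and the index of the risk.
\<close>

locale single_index_procedure =
  fixes \<K> :: "real \<Rightarrow> real"
    and g :: "real^2 \<Rightarrow> real"
    and gl Q \<Upsilon> \<Omega> \<omega> r :: real
begin

definition Kinf :: real where
  "Kinf = real_of_ereal (sup_norm \<K>)"

definition K1 :: real where
  "K1 = (LINT u|lborel. \<bar>\<K> u\<bar>)"

definition tau :: "nat \<Rightarrow> real" where
  "tau n = ((4 * r + 1) * ln (real n) / \<Omega>) powr (1 / \<omega>)"

definition sigma :: real where
  "sigma = sqrt (SUP q \<in> noise_densities \<Upsilon> \<Omega> \<omega>. LINT x|lborel. x\<^sup>2 * q x)"

definition c1 :: "nat \<Rightarrow> real" where
  "c1 n = 730 * ln (16 * (real n)\<^sup>2 * gl powr (-1/2) * (12 * Q + sqrt 2))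
          + 8 * r * ln (real n) + 394"

definition c2 :: "nat \<Rightarrow> real" where
  "c2 n = 730 * ln (16 * (real n)\<^sup>2 * tau n * gl powr (-1/2) * (12 * Q + sqrt 2))
          + 8 * r * ln (real n) + 394"

definition c3 :: "nat \<Rightarrow> real" where
  "c3 n = 365 * ln (5 * (real n)\<^sup>2 * Q * gl powr (-1/2)) + 8 * r * ln (real n) + 197"

definition c4 :: "nat \<Rightarrow> real" where
  "c4 n = 365 * ln (5 * (real n)\<^sup>2 * tau n * Q * gl powr (-1/2)) + 8 * r * ln (real n) + 197"

definition C1 :: "nat \<Rightarrow> real" where
  "C1 n = 2 * sqrt 2 * gl powr (-1/2) * Kinf\<^sup>2 * sqrt (c1 n)
          + 8 / 3 * c1 n * ln (real n) powr (- (2 + \<omega>) / (2 * \<omega>)) * (1 / gl) * Kinf\<^sup>2"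

definition C2 :: "nat \<Rightarrow> real" where
  "C2 n = 2 * sqrt 2 * max sigma 1 * gl powr (-1/2) * Kinf\<^sup>2 * sqrt (c2 n)
          + 8 / 3 * c2 n * ln (real n) powr (-1/2) * (1 / gl) * Kinf\<^sup>2
            * ((4 * r + 1) / \<Omega>) powr (1 / \<omega>)"

definition C3 :: "nat \<Rightarrow> real" where
  "C3 n = 2 * sqrt 2 * gl powr (-1/2) * Kinf\<^sup>2 * sqrt (c3 n)
          + 8 / 3 * (1 / gl) * Kinf\<^sup>2 * c3 n * (real n * (h_frak \<omega> n)\<^sup>2) powr (-1/2)"

definition C4 :: "nat \<Rightarrow> real" where
  "C4 n = 2 * sqrt 2 * max sigma 1 * gl powr (-1/2) * Kinf\<^sup>2 * sqrt (c4 n)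
          + 8 / 3 * tau n * c4 n * (real n * (h_frak \<omega> n)\<^sup>2) powr (-1/2) * (1 / gl) * Kinf\<^sup>2"

definition C5 :: "nat \<Rightarrow> real" where
  "C5 n = K1\<^sup>2 + (real n * (h_frak \<omega> n)\<^sup>2) powr (-1/2) * C4 n + 1 / 2"

text \<open>
  For \<open>n = 1\<close> the base of the power is \<open>0\<close>, where \<open>powr\<close> returns \<open>0\<close> instead of \<open>\<infinity>\<close>; this does
  not affect \<open>n1\<close>, because under the kernel and design assumptions the inequality fails for
  \<open>n = 2\<close>. The set is not empty, as the left-hand side tends to \<open>0\<close>.
\<close>

definition n1 :: nat where
  "n1 = Inf {m. 1 \<le> m \<and> (\<forall>n\<ge>m. (real n * (h_frak \<omega> n)\<^sup>2) powr (-1/2) * C3 n \<le> 1 / 2)}"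

definition Kprod :: "real^2 \<Rightarrow> real" where
  "Kprod x = \<K> (x $ 1) * \<K> (x $ 2)"

text \<open>The convention \<open>x / 0 = 0\<close> matters only on the null event \<open>g (X\<^sub>i) = 0\<close> for some \<open>i\<close>.\<close>

definition F_hat :: "nat \<Rightarrow> sample \<Rightarrow> real^2^2 \<Rightarrow> real^2 \<Rightarrow> real" where
  "F_hat n d E t =
     det E / real n * (\<Sum>i=1..n. Kprod (E *v (fst (d i) - t)) / g (fst (d i)) * snd (d i))"

definition K_frak :: "nat \<Rightarrow> real^2 \<Rightarrow> real" where
  "K_frak n u = \<K> (u $ 1 / h_frak \<omega> n) * \<K> (u $ 2 / h_frak \<omega> n) / (h_frak \<omega> n)\<^sup>2"

definition F_hat_inf :: "nat \<Rightarrow> sample \<Rightarrow> real" where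
  "F_hat_inf n d =
     2 * (SUP v \<in> square (5/2).
            \<bar>1 / real n * (\<Sum>i=1..n. 1 / g (fst (d i)) * K_frak n (fst (d i) - v) * snd (d i))\<bar>)
     + 2 * C5 n"

definition TH :: "nat \<Rightarrow> sample \<Rightarrow> real \<Rightarrow> real" where
  "TH n d \<eta> = 2 * (Kinf\<^sup>2 * sqrt (ln (real n)) + F_hat_inf n d * C1 n + C2 n)
              * (\<eta> * real n) powr (-1/2)"

text \<open>
  For \<open>n \<ge> max (n0 \<omega> \<beta>0 M) n1\<close> one has \<open>0 < h_min \<omega> n \<le> 1\<close>, so \<open>bandwidths \<omega> n\<close> is finite and
  nonempty; together with the boundedness of the kernel this makes all real suprema in
  \<open>F_hat_inf\<close>, \<open>R1\<close> and \<open>R2\<close> proper ones.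
\<close>

definition R1 :: "nat \<Rightarrow> sample \<Rightarrow> real^2 \<Rightarrow> real^2 \<Rightarrow> real \<Rightarrow> real" where
  "R1 n d t \<theta> h = (SUP \<eta> \<in> {\<eta> \<in> bandwidths \<omega> n. \<eta> \<le> h}.
     max 0 ((SUP \<nu> \<in> sphere 0 1.
               \<bar>F_hat n d (E_pair_mat \<theta> \<nu> \<eta>) t - F_hat n d (E_mat \<nu> \<eta>) t\<bar>) - TH n d \<eta>))"

definition R2 :: "nat \<Rightarrow> sample \<Rightarrow> real^2 \<Rightarrow> real \<Rightarrow> real" where
  "R2 n d t h = (SUP \<eta> \<in> {\<eta> \<in> bandwidths \<omega> n. \<eta> \<le> h}.
     max 0 ((SUP \<theta> \<in> sphere 0 1.
               \<bar>F_hat n d (E_mat \<theta> h) t - F_hat n d (E_mat \<theta> \<eta>) t\<bar>) - TH n d \<eta>))"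

definition criterion :: "nat \<Rightarrow> sample \<Rightarrow> real^2 \<Rightarrow> (real^2) \<times> real \<Rightarrow> real" where
  "criterion n d t = (\<lambda>(\<theta>, h). R1 n d t \<theta> h + R2 n d t h + TH n d h)"

definition measurable_minimizer :: "nat \<Rightarrow> real^2 \<Rightarrow> (sample \<Rightarrow> (real^2) \<times> real) \<Rightarrow> bool" where
  "measurable_minimizer n t sel \<longleftrightarrow>
     sel \<in> borel_measurable (sample_space n) \<and>
     (\<forall>d \<in> space (sample_space n).
        sel d \<in> sphere 0 1 \<times> bandwidths \<omega> n \<and>
        (\<forall>a \<in> sphere 0 1 \<times> bandwidths \<omega> n. criterion n d t (sel d) \<le> criterion n d t a))"

definition selected_estimator ::
  "nat \<Rightarrow> (real^2 \<Rightarrow> sample \<Rightarrow> (real^2) \<times> real) \<Rightarrow> sample \<Rightarrow> real^2 \<Rightarrow> real" where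
  "selected_estimator n sel d t = F_hat n d (E_mat (fst (sel t d)) (snd (sel t d))) t"

end

end

theory Submission
  imports Defs "HOL-Real_Asymp.Real_Asymp"
begin

text \<open>
  Every matrix \<open>E\<close> at which the procedure evaluates its estimator \<open>F_hat\<close> has the form \<open>E_mat a \<eta>\<close>,
  with \<open>a\<close> in a fixed annulus: the direction itself, or \<open>pair_vec \<theta> \<nu>\<close> for a pair. Two facts about
  this family carry the proof.

  \<^item> Bias (lemma \<open>population_bias\<close>). After division by the design density the mean of the estimator is
  a convolution. Smoothing along \<open>a\<close> costs at most \<open>K1\<^sup>2 * L * \<eta> powr \<beta>\<close>, by a Taylor expansion
  and the vanishing moments of the kernel. What is left depends only on the component \<open>across a \<theta>\<close>.
  For the true direction it is the target, and it is the same for the pair of \<open>\<theta>\<close> and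
  \<open>\<nu>\<close> as for \<open>\<nu>\<close> alone (lemma \<open>pair_vec\<close>).

  \<^item> Noise (lemma \<open>exceptional_event\<close>). Outside an event whose probability is of the order of
  \<open>n\<close> to the power \<open>- 4 * r\<close>, all deviations from the means are below the deterministic counterpart
  of the random threshold \<open>TH\<close>. This is Bernstein's inequality on a net of polynomial size in the
  annulus, applied to the signal and, after truncation at \<open>tau n\<close>, to the noise; the logarithmic
  constants \<open>c1\<close>, ..., \<open>c4\<close> pay for the net. The same argument for the local averages shows that
  \<open>F_hat_inf\<close> exceeds the supremum of the regression function and stays bounded
  (lemma \<open>F_hat_inf_bounds\<close>), so that \<open>TH\<close> itself is large enough and of the right order.

  These two facts imply an oracle inequality, which is purely deterministic. If at the bandwidth
  \<open>hs\<close> the bias is at most the stochastic error, then both comparison terms of the criterion vanish at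
  the true direction and \<open>hs\<close>, and all terms at the minimizer are at most \<open>TH hs\<close>. The selected
  estimator is compared with the oracle along the chain (selected direction and bandwidth), (selected
  direction, smaller bandwidth), (pair of directions, smaller bandwidth), (true direction, smaller
  bandwidth), where the smaller bandwidth is the minimum of the selected one and \<open>hs\<close>. The pair
  matrix is, up to its sign, symmetric in the two directions: as the pair of the true direction with the
  selected one it is close to the selected one by the bias estimate, and as the pair of the selected
  direction with the true one it is close to the true one by the minimality of the criterion. The error
  is at most \<open>6 * TH hs\<close> (lemma \<open>oracle_inequality\<close>), and \<open>hs\<close> of the balancing order
  yields the rate.

  On the exceptional event the error is at most of order \<open>n\<close> times the average of the quantities
  \<open>1 + L + \<bar>\<epsilon>\<^sub>i\<bar>\<close>, which have all moments; the small probability of the event compensates for it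
  (lemma \<open>risk_regular\<close>). All this requires \<open>n\<close> to be large. Each of the remaining sample sizes has a
  finite risk and, since \<open>n1\<close> is at least \<open>2\<close>, a positive rate, so that a larger constant covers them
  (lemma \<open>risk_bound\<close>).
\<close>

section \<open>A uniform Bernstein inequality\<close>

lemma le_abs_iff_disj: "(x::real) \<le> \<bar>y\<bar> \<longleftrightarrow> x \<le> y \<or> x \<le> - y"
  by linarith

lemma exp_le_quadratic:
  fixes x :: real
  assumes "\<bar>x\<bar> \<le> 1"
  shows "exp x \<le> 1 + x + x\<^sup>2"
proof (cases "0 \<le> x")
  case True
  then show ?thesis using assms exp_bound[of x] by auto
next
  case False
  have "1 \<le> (1 + x + x\<^sup>2) * (1 - x)"
  proof -
    have "(1 + x + x\<^sup>2) * (1 - x) = 1 - x ^ 3"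
      by (simp add: algebra_simps power2_eq_square power3_eq_cube)
    moreover have "x ^ 3 \<le> 0" using False by (simp add: power_le_zero_eq)
    ultimately show ?thesis by linarith
  qed
  also have "\<dots> \<le> (1 + x + x\<^sup>2) * exp (- x)"
  proof (intro mult_left_mono)
    show "1 - x \<le> exp (- x)" using exp_ge_add_one_self[of "-x"] by simp
    have "0 \<le> 1 + x" using assms by auto
    then show "0 \<le> 1 + x + x\<^sup>2" by simp
  qed
  finally show ?thesis by (simp add: exp_minus field_simps)
qed

context prob_space
begin

text \<open>
  On the range \<open>\<bar>l * Z\<bar> \<le> 1\<close> the exponential is below a parabola, whose linear term has mean zero.
\<close>

lemma mgf_le_exp:
  fixes Z :: "'a \<Rightarrow> real"
  assumes [measurable]: "Z \<in> borel_measurable M" and bnd: "\<And>z. z \<in> space M \<Longrightarrow> \<bar>Z z\<bar> \<le> b"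
    and mean: "(\<integral>z. Z z \<partial>M) = 0" and var: "(\<integral>z. (Z z)\<^sup>2 \<partial>M) \<le> V"
    and l: "0 \<le> l" "l * b \<le> 1"
  shows "integrable M (\<lambda>z. exp (l * Z z))" "(\<integral>z. exp (l * Z z) \<partial>M) \<le> exp (l\<^sup>2 * V)"
proof -
  have lZ: "\<bar>l * Z z\<bar> \<le> 1" if "z \<in> space M" for z
    using mult_left_mono[OF bnd[OF that] l(1)] l by (simp add: abs_mult)
  have i1: "integrable M Z"
    by (rule integrable_const_bound[where B=b]) (auto intro!: AE_I2 bnd)
  have i2: "integrable M (\<lambda>z. (Z z)\<^sup>2)"
  proof (rule integrable_const_bound[where B="b\<^sup>2"])
    show "AE z in M. norm ((Z z)\<^sup>2) \<le> b\<^sup>2"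
      using power_mono[OF bnd abs_ge_zero, of _ 2] by (intro AE_I2) simp
  qed simp
  show i3: "integrable M (\<lambda>z. exp (l * Z z))"
  proof (rule integrable_const_bound[where B="exp 1"])
    show "AE z in M. norm (exp (l * Z z)) \<le> exp 1"
      using lZ by (auto intro!: AE_I2 simp: abs_le_iff)
  qed simp
  have "(\<integral>z. exp (l * Z z) \<partial>M) \<le> (\<integral>z. 1 + l * Z z + l\<^sup>2 * (Z z)\<^sup>2 \<partial>M)"
  proof (rule integral_mono[OF i3])
    show "integrable M (\<lambda>z. 1 + l * Z z + l\<^sup>2 * (Z z)\<^sup>2)" using i1 i2 by auto
    fix z assume "z \<in> space M"
    then show "exp (l * Z z) \<le> 1 + l * Z z + l\<^sup>2 * (Z z)\<^sup>2"
      using exp_le_quadratic[OF lZ] by (simp add: power_mult_distrib)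
  qed
  also have "\<dots> = 1 + l\<^sup>2 * (\<integral>z. (Z z)\<^sup>2 \<partial>M)"
    using i1 i2 mean by (simp add: prob_space)
  also have "\<dots> \<le> 1 + l\<^sup>2 * V" using var by (simp add: mult_left_mono)
  also have "\<dots> \<le> exp (l\<^sup>2 * V)" by (rule exp_ge_add_one_self)
  finally show "(\<integral>z. exp (l * Z z) \<partial>M) \<le> exp (l\<^sup>2 * V)" .
qed

lemma chernoff_sum:
  fixes Z :: "'a \<Rightarrow> real" and n :: nat and b c V :: real
  assumes [measurable]: "Z \<in> borel_measurable M" and bnd: "\<And>z. z \<in> space M \<Longrightarrow> \<bar>Z z\<bar> \<le> b"
    and mean: "(\<integral>z. Z z \<partial>M) = 0" and var: "(\<integral>z. (Z z)\<^sup>2 \<partial>M) \<le> V"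
    and l: "0 < l" "l * b \<le> 1"
  shows "measure (Pi\<^sub>M {1..n} (\<lambda>_. M))
           {w \<in> space (Pi\<^sub>M {1..n} (\<lambda>_. M)). s \<le> (\<Sum>i=1..n. Z (w i))} \<le> exp (real n * (l\<^sup>2 * V) - l * s)"
proof -
  let ?P = "Pi\<^sub>M {1..n::nat} (\<lambda>_. M)"
  interpret P: prob_space ?P by (intro prob_space_PiM prob_space_axioms)
  interpret S: product_sigma_finite "\<lambda>_::nat. M" ..
  note mgf = mgf_le_exp[OF assms(1) bnd mean var less_imp_le[OF l(1)] l(2), simplified]
  have e: "exp (l * (\<Sum>i=1..n. Z (w i))) = (\<Prod>i=1..n. exp (l * Z (w i)))" for w
    by (simp add: sum_distrib_left exp_sum)
  have int: "integrable ?P (\<lambda>w. exp (l * (\<Sum>i=1..n. Z (w i))))"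
    unfolding e by (intro S.product_integrable_prod mgf) auto
  have "(\<integral>w. exp (l * (\<Sum>i=1..n. Z (w i))) \<partial>?P) = (\<Prod>i=1..n. \<integral>z. exp (l * Z z) \<partial>M)"
    unfolding e by (intro S.product_integral_prod mgf) auto
  also have "\<dots> \<le> (\<Prod>i=1..n. exp (l\<^sup>2 * V))"
    by (intro prod_mono) (auto intro!: mgf integral_nonneg)
  finally have E: "(\<integral>w. exp (l * (\<Sum>i=1..n. Z (w i))) \<partial>?P) \<le> exp (real n * (l\<^sup>2 * V))"
    by (simp add: exp_of_nat_mult)
  have "{w \<in> space ?P. s \<le> (\<Sum>i=1..n. Z (w i))} = {w \<in> space ?P. exp (l * s) \<le> exp (l * (\<Sum>i=1..n. Z (w i)))}"
    using l by auto
  then have "measure ?P {w \<in> space ?P. s \<le> (\<Sum>i=1..n. Z (w i))}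
      \<le> (\<integral>w. exp (l * (\<Sum>i=1..n. Z (w i))) \<partial>?P) / exp (l * s)"
    using integral_Markov_inequality_measure[OF int sets.empty_sets _ , of "exp (l * s)"] by simp
  also have "\<dots> \<le> exp (real n * (l\<^sup>2 * V)) / exp (l * s)"
    using E by (intro divide_right_mono) auto
  finally show ?thesis by (simp add: exp_diff)
qed

text \<open>
  Chernoff's bound with the parameter \<open>min (sqrt (c / (n V))) (1 / b)\<close>: the exponent is governed by
  the variance when the first term is the smaller one, and by the range otherwise.
\<close>

lemma bernstein_centered:
  fixes Z :: "'a \<Rightarrow> real" and n :: nat and b c V :: real
  assumes [measurable]: "Z \<in> borel_measurable M" and bnd: "\<And>z. z \<in> space M \<Longrightarrow> \<bar>Z z\<bar> \<le> b"
    and mean: "(\<integral>z. Z z \<partial>M) = 0" and var: "(\<integral>z. (Z z)\<^sup>2 \<partial>M) \<le> V"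
    and b: "0 < b" and V: "0 \<le> V" and c: "0 < c"
  shows "measure (Pi\<^sub>M {1..n} (\<lambda>_. M))
           {w \<in> space (Pi\<^sub>M {1..n} (\<lambda>_. M)). 2 * sqrt (c * n * V) + 3/4 * c * b \<le> (\<Sum>i=1..n. Z (w i))}
         \<le> exp (- (3/4 * c))"
proof (cases "n * V \<le> c * b\<^sup>2")
  case True
  let ?x = "n * V / b\<^sup>2"
  have x: "0 \<le> ?x" "?x \<le> c" using True V b by (auto simp: field_simps)
  have "?x \<le> sqrt (c * ?x)"
    using mult_right_mono[OF x(2,1)] by (intro real_le_rsqrt) (simp add: power2_eq_square)
  moreover have "sqrt (c * n * V) / b = sqrt (c * ?x)"
    using b by (simp add: real_sqrt_divide mult.assoc)
  ultimately have *: "?x \<le> sqrt (c * n * V) / b" by simp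
  have "0 \<le> sqrt (c * n * V) / b" using b c V by simp
  have "n * ((1/b)\<^sup>2 * V) - (1/b) * (2 * sqrt (c * n * V) + 3/4 * c * b)
      = ?x - 2 * (sqrt (c * n * V) / b) - 3/4 * c"
    using b by (simp add: field_simps power2_eq_square)
  also have "\<dots> \<le> - (3/4 * c)" using * \<open>0 \<le> sqrt (c * n * V) / b\<close> by linarith
  finally show ?thesis
    using chernoff_sum[OF assms(1) bnd mean var, of "1/b" n "2 * sqrt (c * n * V) + 3/4 * c * b"] b
    by (smt (verit, ccfv_SIG) exp_le_cancel_iff nonzero_divide_eq_eq zero_less_divide_1_iff)
next
  case False
  let ?l = "sqrt (c / (n * V))"
  have nV: "0 < n * V" using False c b by (smt (verit) mult_nonneg_nonneg zero_le_power2)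
  have l: "0 < ?l" using nV c by simp
  have l2: "?l\<^sup>2 = c / (n * V)" using nV c by simp
  have "(?l * b)\<^sup>2 = c * b\<^sup>2 / (n * V)" unfolding power_mult_distrib l2 by simp
  also have "\<dots> \<le> 1\<^sup>2" using False nV by simp
  finally have lb: "?l * b \<le> 1" by (rule power2_le_imp_le) simp
  have nz: "n \<noteq> 0" "V \<noteq> 0" using nV by (cases n; auto)+
  have "(c / (n * V)) * (c * n * V) = c\<^sup>2" using nz by (simp add: power2_eq_square)
  moreover have "?l * sqrt (c * n * V) = sqrt ((c / (n * V)) * (c * n * V))"
    by (simp only: real_sqrt_mult)
  ultimately have 2: "?l * sqrt (c * n * V) = c" using c by simp
  have "n * (?l\<^sup>2 * V) = c" unfolding l2 using nz by simp
  moreover have "?l * (2 * sqrt (c * n * V) + 3/4 * c * b) = 2 * (?l * sqrt (c * n * V)) + 3/4 * (c * (?l * b))"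
    by (simp only: distrib_left ac_simps)
  moreover have "0 \<le> c * (?l * b)"
    using c b less_imp_le[OF l] by (intro mult_nonneg_nonneg) auto
  ultimately have "n * (?l\<^sup>2 * V) - ?l * (2 * sqrt (c * n * V) + 3/4 * c * b) \<le> - c"
    using 2 by linarith
  also have "- c \<le> - (3/4 * c)" using c by simp
  finally show ?thesis
    using chernoff_sum[OF assms(1) bnd mean var l lb, of n "2 * sqrt (c * n * V) + 3/4 * c * b"]
    by (smt (verit, ccfv_SIG) exp_le_cancel_iff)
qed

text \<open>
  Centring at most doubles the range and does not increase the second moment; the factor \<open>2\<close> on the
  right comes from the two tails.
\<close>

lemma bernstein:
  fixes \<phi> :: "'a \<Rightarrow> real" and n :: nat and B c V :: real
  assumes [measurable]: "\<phi> \<in> borel_measurable M" and bnd: "\<And>z. z \<in> space M \<Longrightarrow> \<bar>\<phi> z\<bar> \<le> B"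
    and var: "(\<integral>z. (\<phi> z)\<^sup>2 \<partial>M) \<le> V" and B: "0 < B" and c: "0 < c"
  shows "measure (Pi\<^sub>M {1..n} (\<lambda>_. M))
           {w \<in> space (Pi\<^sub>M {1..n} (\<lambda>_. M)). 
              2 * sqrt (c * n * V) + 3/2 * c * B \<le> \<bar>(\<Sum>i=1..n. \<phi> (w i)) - n * (\<integral>z. \<phi> z \<partial>M)\<bar>}
         \<le> 2 * exp (- (3/4 * c))"
proof -
  let ?P = "Pi\<^sub>M {1..n::nat} (\<lambda>_. M)"
  interpret P: prob_space ?P by (intro prob_space_PiM prob_space_axioms)
  define \<mu> where "\<mu> = (\<integral>z. \<phi> z \<partial>M)"
  have i1: "integrable M \<phi>"
    by (rule integrable_const_bound[where B=B]) (auto intro!: AE_I2 bnd)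
  have i2: "integrable M (\<lambda>z. (\<phi> z)\<^sup>2)"
  proof (rule integrable_const_bound[where B="B\<^sup>2"])
    show "AE z in M. norm ((\<phi> z)\<^sup>2) \<le> B\<^sup>2"
      using power_mono[OF bnd abs_ge_zero, of _ 2] by (intro AE_I2) simp
  qed simp
  have \<mu>: "\<bar>\<mu>\<bar> \<le> B"
  proof -
    have "\<bar>\<mu>\<bar> \<le> (\<integral>z. \<bar>\<phi> z\<bar> \<partial>M)" unfolding \<mu>_def by (rule integral_abs_bound)
    also have "\<dots> \<le> (\<integral>z. B \<partial>M)" by (rule integral_mono) (use i1 bnd in auto)
    finally show ?thesis by (simp add: prob_space)
  qed
  have V: "(\<integral>z. (\<phi> z - \<mu>)\<^sup>2 \<partial>M) \<le> V"
  proof -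
    have "(\<integral>z. (\<phi> z - \<mu>)\<^sup>2 \<partial>M) = (\<integral>z. (\<phi> z)\<^sup>2 \<partial>M) - \<mu>\<^sup>2"
      using variance_eq[OF i1 i2] unfolding \<mu>_def by simp
    then show ?thesis using var by (smt (verit) zero_le_power2)
  qed
  have V0: "0 \<le> V" by (rule order_trans[OF _ var]) (auto intro!: integral_nonneg)
  have mean: "(\<integral>z. \<phi> z - \<mu> \<partial>M) = 0" "(\<integral>z. \<mu> - \<phi> z \<partial>M) = 0"
    using i1 by (simp_all add: \<mu>_def prob_space)
  have bb: "\<bar>\<phi> z - \<mu>\<bar> \<le> 2 * B" "\<bar>\<mu> - \<phi> z\<bar> \<le> 2 * B" if "z \<in> space M" for z
    using bnd[OF that] \<mu> by auto
  let ?s = "2 * sqrt (c * n * V) + 3/2 * c * B"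
  have eq: "{w \<in> space ?P. ?s \<le> \<bar>(\<Sum>i=1..n. \<phi> (w i)) - n * (\<integral>z. \<phi> z \<partial>M)\<bar>}
     = {w \<in> space ?P. ?s \<le> (\<Sum>i=1..n. \<phi> (w i) - \<mu>)} \<union> {w \<in> space ?P. ?s \<le> (\<Sum>i=1..n. \<mu> - \<phi> (w i))}"
  proof -
    have "(\<Sum>i=1..n. \<phi> (w i) - \<mu>) = (\<Sum>i=1..n. \<phi> (w i)) - n * (\<integral>z. \<phi> z \<partial>M)"
      "(\<Sum>i=1..n. \<mu> - \<phi> (w i)) = - ((\<Sum>i=1..n. \<phi> (w i)) - n * (\<integral>z. \<phi> z \<partial>M))" for w
      by (simp_all add: sum_subtractf \<mu>_def)
    then show ?thesis by (simp only: le_abs_iff_disj Un_def mem_Collect_eq) blast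
  qed
  have "P.prob ({w \<in> space ?P. ?s \<le> (\<Sum>i=1..n. \<phi> (w i) - \<mu>)} \<union> {w \<in> space ?P. ?s \<le> (\<Sum>i=1..n. \<mu> - \<phi> (w i))})
     \<le> P.prob {w \<in> space ?P. ?s \<le> (\<Sum>i=1..n. \<phi> (w i) - \<mu>)}
       + P.prob {w \<in> space ?P. ?s \<le> (\<Sum>i=1..n. \<mu> - \<phi> (w i))}"
    by (rule measure_Un_le; measurable)
  also have "\<dots> \<le> exp (- (3/4 * c)) + exp (- (3/4 * c))"
  proof (intro add_mono)
    have s: "?s = 2 * sqrt (c * n * V) + 3/4 * c * (2 * B)" by simp
    have V': "(\<integral>z. (\<mu> - \<phi> z)\<^sup>2 \<partial>M) \<le> V" using V by (simp only: power2_commute[of \<mu>])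
    have B2: "0 < 2 * B" using B by simp
    show "P.prob {w \<in> space ?P. ?s \<le> (\<Sum>i=1..n. \<phi> (w i) - \<mu>)} \<le> exp (- (3/4 * c))"
      unfolding s by (rule bernstein_centered[OF _ bb(1) mean(1) V B2 V0 c]) auto
    show "P.prob {w \<in> space ?P. ?s \<le> (\<Sum>i=1..n. \<mu> - \<phi> (w i))} \<le> exp (- (3/4 * c))"
      unfolding s by (rule bernstein_centered[OF _ bb(2) mean(2) V' B2 V0 c]) auto
  qed
  finally show ?thesis unfolding eq by simp
qed

end

text \<open>
  A bounded set in the plane has a finite net of points of its own, polynomial in the mesh: choose
  one representative in every nonempty grid cell.
\<close>

lemma grid_net:
  fixes S :: "(real^2) set"
  assumes S: "S \<subseteq> square (real R)" and m: "0 < m"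
  obtains N where "finite N" "N \<subseteq> S" "card N \<le> (2 * R * m + 1)\<^sup>2"
    "\<And>a. a \<in> S \<Longrightarrow> \<exists>b\<in>N. \<forall>i. \<bar>a $ i - b $ i\<bar> \<le> 1 / real m"
proof -
  define cell where "cell = (\<lambda>a::real^2. (\<lfloor>m * a $ 1\<rfloor>, \<lfloor>m * a $ 2\<rfloor>))"
  define rep where "rep = (\<lambda>k. SOME a. a \<in> S \<and> cell a = k)"
  have rep: "rep (cell a) \<in> S \<and> cell (rep (cell a)) = cell a" if "a \<in> S" for a
    unfolding rep_def by (rule someI[of "\<lambda>b. b \<in> S \<and> cell b = cell a" a]) (use that in auto)
  let ?C = "{- int (R * m)..int (R * m)}"
  have fl: "\<lfloor>m * x\<rfloor> \<in> ?C" if "\<bar>x\<bar> \<le> real R" for x :: real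
  proof -
    have "\<bar>m * x\<bar> \<le> real (R * m)" using that m by (simp add: abs_mult mult.commute mult_left_mono)
    then show ?thesis by (simp add: le_floor_iff floor_le_iff abs_le_iff)
  qed
  have sub: "cell ` S \<subseteq> ?C \<times> ?C"
    using S fl by (auto simp: cell_def square_def)
  have fin: "finite (cell ` S)" by (rule finite_subset[OF sub]) auto
  show ?thesis
  proof
    show "finite (rep ` cell ` S)" using fin by simp
    show "rep ` cell ` S \<subseteq> S" using rep by auto
    have "card (rep ` cell ` S) \<le> card (?C \<times> ?C)"
      using card_image_le[OF fin] card_mono[OF _ sub] by (meson finite_SigmaI finite_atLeastAtMost_int order_trans)
    also have "\<dots> = (2 * R * m + 1)\<^sup>2"
      by (simp add: power2_eq_square card_cartesian_product nat_add_distrib nat_mult_distrib)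
    finally show "card (rep ` cell ` S) \<le> (2 * R * m + 1)\<^sup>2" .
    fix a assume a: "a \<in> S"
    define b where "b = rep (cell a)"
    have eq: "\<lfloor>m * a $ i\<rfloor> = \<lfloor>m * b $ i\<rfloor>" for i
      using rep[OF a] exhaust_2[of i] by (auto simp: b_def cell_def)
    have "\<bar>a $ i - b $ i\<bar> \<le> 1 / real m" for i
    proof -
      have "\<bar>m * a $ i - m * b $ i\<bar> \<le> 1" using eq[of i] by linarith
      then have "m * \<bar>a $ i - b $ i\<bar> \<le> 1" by (simp add: abs_mult flip: right_diff_distrib)
      then show ?thesis using m by (simp add: field_simps)
    qed
    moreover have "b \<in> rep ` cell ` S" using a by (auto simp: b_def)
    ultimately show "\<exists>b\<in>rep ` cell ` S. \<forall>i. \<bar>a $ i - b $ i\<bar> \<le> 1 / real m" by blast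
  qed
qed

text \<open>
  The exceptional set is the union, over a net, of the sets on which Bernstein's inequality fails;
  passing from the net to all of \<open>S\<close> costs the oscillation \<open>\<Lambda>\<close> once for the sum and once for its mean.
\<close>

lemma (in prob_space) uniform_bernstein:
  fixes \<phi> :: "real^2 \<Rightarrow> 'a \<Rightarrow> real" and n R m :: nat and B c V \<Lambda> :: real
  assumes S: "S \<subseteq> square (real R)" and m: "0 < m"
    and meas: "\<And>a. a \<in> S \<Longrightarrow> \<phi> a \<in> borel_measurable M"
    and bnd: "\<And>a z. a \<in> S \<Longrightarrow> z \<in> space M \<Longrightarrow> \<bar>\<phi> a z\<bar> \<le> B"
    and var: "\<And>a. a \<in> S \<Longrightarrow> (\<integral>z. (\<phi> a z)\<^sup>2 \<partial>M) \<le> V"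
    and osc: "\<And>a b z. a \<in> S \<Longrightarrow> b \<in> S \<Longrightarrow> z \<in> space M \<Longrightarrow>
                \<forall>i. \<bar>a $ i - b $ i\<bar> \<le> 1 / real m \<Longrightarrow> \<bar>\<phi> a z - \<phi> b z\<bar> \<le> \<Lambda>"
    and B: "0 < B" and c: "0 < c"
  obtains Bad where "Bad \<in> sets (Pi\<^sub>M {1..n} (\<lambda>_. M))"
    "measure (Pi\<^sub>M {1..n} (\<lambda>_. M)) Bad \<le> real ((2 * R * m + 1)\<^sup>2) * (2 * exp (- (3/4 * c)))"
    "\<And>w a. w \<in> space (Pi\<^sub>M {1..n} (\<lambda>_. M)) \<Longrightarrow> w \<notin> Bad \<Longrightarrow> a \<in> S \<Longrightarrow>
      \<bar>(\<Sum>i=1..n. \<phi> a (w i)) - n * (\<integral>z. \<phi> a z \<partial>M)\<bar> \<le> 2 * sqrt (c * n * V) + 3/2 * c * B + 2 * n * \<Lambda>"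
proof -
  let ?P = "Pi\<^sub>M {1..n::nat} (\<lambda>_. M)"
  interpret P: prob_space ?P by (intro prob_space_PiM prob_space_axioms)
  let ?s = "2 * sqrt (c * n * V) + 3/2 * c * B"
  obtain N where N: "finite N" "N \<subseteq> S" "card N \<le> (2 * R * m + 1)\<^sup>2"
    "\<And>a. a \<in> S \<Longrightarrow> \<exists>b\<in>N. \<forall>i. \<bar>a $ i - b $ i\<bar> \<le> 1 / real m"
    using grid_net[OF S m] by blast
  define A where "A = (\<lambda>a. {w \<in> space ?P. ?s \<le> \<bar>(\<Sum>i=1..n. \<phi> a (w i)) - n * (\<integral>z. \<phi> a z \<partial>M)\<bar>})"
  have A_meas: "A a \<in> sets ?P" if "a \<in> N" for a
  proof -
    have [measurable]: "\<phi> a \<in> borel_measurable M" using meas N that by auto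
    show ?thesis unfolding A_def by measurable
  qed
  have int: "integrable M (\<phi> a)" if a: "a \<in> S" for a
  proof (rule integrable_const_bound[where B=B])
    show "AE z in M. norm (\<phi> a z) \<le> B" using bnd[OF a] by (intro AE_I2) simp
  qed (rule meas[OF a])
  show ?thesis
  proof (rule that[of "\<Union>a\<in>N. A a"])
    show "(\<Union>a\<in>N. A a) \<in> sets ?P" using N A_meas by auto
    have "measure ?P (\<Union>a\<in>N. A a) \<le> (\<Sum>a\<in>N. measure ?P (A a))"
      by (rule P.finite_measure_subadditive_finite) (use N A_meas in auto)
    also have "\<dots> \<le> (\<Sum>a\<in>N. 2 * exp (- (3/4 * c)))"
    proof (rule sum_mono)
      fix a assume "a \<in> N"
      then have "a \<in> S" using N by auto
      then show "measure ?P (A a) \<le> 2 * exp (- (3/4 * c))"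
        unfolding A_def using bernstein[OF meas bnd var B c] by blast
    qed
    also have "\<dots> = real (card N) * (2 * exp (- (3/4 * c)))" by simp
    also have "\<dots> \<le> real ((2 * R * m + 1)\<^sup>2) * (2 * exp (- (3/4 * c)))"
      using N(3) by (intro mult_right_mono of_nat_mono) auto
    finally show "measure ?P (\<Union>a\<in>N. A a) \<le> real ((2 * R * m + 1)\<^sup>2) * (2 * exp (- (3/4 * c)))" .
    fix w a assume w: "w \<in> space ?P" "w \<notin> (\<Union>a\<in>N. A a)" and a: "a \<in> S"
    obtain b where b: "b \<in> N" "\<forall>i. \<bar>a $ i - b $ i\<bar> \<le> 1 / real m" using N(4)[OF a] by auto
    have bS: "b \<in> S" using b N by auto
    have wi: "w i \<in> space M" if "i \<in> {1..n}" for i using w that by (auto simp: space_PiM)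
    have "\<bar>(\<Sum>i=1..n. \<phi> a (w i)) - (\<Sum>i=1..n. \<phi> b (w i))\<bar> \<le> (\<Sum>i=1..n. \<bar>\<phi> a (w i) - \<phi> b (w i)\<bar>)"
      unfolding sum_subtractf[symmetric] by (rule sum_abs)
    also have "\<dots> \<le> (\<Sum>i=1..n. \<Lambda>)" by (intro sum_mono osc a bS b wi)
    finally have 1: "\<bar>(\<Sum>i=1..n. \<phi> a (w i)) - (\<Sum>i=1..n. \<phi> b (w i))\<bar> \<le> n * \<Lambda>" by simp
    have "\<bar>(\<integral>z. \<phi> a z \<partial>M) - (\<integral>z. \<phi> b z \<partial>M)\<bar> = \<bar>\<integral>z. \<phi> a z - \<phi> b z \<partial>M\<bar>"
      using int a bS by simp
    also have "\<dots> \<le> (\<integral>z. \<bar>\<phi> a z - \<phi> b z\<bar> \<partial>M)" by (rule integral_abs_bound)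
    also have "\<dots> \<le> (\<integral>z. \<Lambda> \<partial>M)"
      by (rule integral_mono) (use int a bS osc b in auto)
    finally have "\<bar>(\<integral>z. \<phi> a z \<partial>M) - (\<integral>z. \<phi> b z \<partial>M)\<bar> \<le> \<Lambda>" by (simp add: prob_space)
    then have 2: "\<bar>n * (\<integral>z. \<phi> a z \<partial>M) - n * (\<integral>z. \<phi> b z \<partial>M)\<bar> \<le> n * \<Lambda>"
      by (simp add: abs_mult mult_left_mono flip: right_diff_distrib)
    have "\<not> ?s \<le> \<bar>(\<Sum>i=1..n. \<phi> b (w i)) - n * (\<integral>z. \<phi> b z \<partial>M)\<bar>"
      using w b by (auto simp: A_def)
    then show "\<bar>(\<Sum>i=1..n. \<phi> a (w i)) - n * (\<integral>z. \<phi> a z \<partial>M)\<bar> \<le> ?s + 2 * n * \<Lambda>"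
      using 1 2 mult.assoc[of 2 "real n" \<Lambda>] by linarith
  qed
qed

text \<open>
  The integral of an arbitrary nonnegative function is a supremum over simple functions below it, and
  these are measurable. Hence this half of the transformation rule applies to the selected estimator
  without an analysis of its measurability.
\<close>

lemma nn_integral_distr_le:
  assumes T: "T \<in> measurable M N"
  shows "(\<integral>\<^sup>+x. f x \<partial>distr M N T) \<le> (\<integral>\<^sup>+w. f (T w) \<partial>M)"
  unfolding nn_integral_def[of "distr M N T"]
proof (rule SUP_least)
  fix u assume u: "u \<in> {g. simple_function (distr M N T) g \<and> g \<le> f}"
  then have [measurable]: "u \<in> borel_measurable N" using borel_measurable_simple_function by fastforce
  have "integral\<^sup>S (distr M N T) u = (\<integral>\<^sup>+x. u x \<partial>distr M N T)"
    using u by (simp add: nn_integral_eq_simple_integral)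
  also have "\<dots> = (\<integral>\<^sup>+w. u (T w) \<partial>M)" by (rule nn_integral_distr[OF T]) simp
  also have "\<dots> \<le> (\<integral>\<^sup>+w. f (T w) \<partial>M)"
    using u by (intro nn_integral_mono) (auto simp: le_fun_def)
  finally show "integral\<^sup>S (distr M N T) u \<le> (\<integral>\<^sup>+w. f (T w) \<partial>M)" .
qed

section \<open>Integration in the plane\<close>

lemma prod_Basis_plane: "(\<Prod>b\<in>Basis. (x::real^2) \<bullet> b) = x $ 1 * x $ 2"
proof -
  have B: "(Basis :: (real^2) set) = {axis 1 1, axis 2 1}"
    by (auto simp: Basis_vec_def UNIV_2)
  have "axis 1 1 \<noteq> (axis 2 1 :: real^2)" by (simp add: axis_eq_axis)
  then show ?thesis unfolding B by (simp add: inner_axis)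
qed

lemma vector_2_measurable [measurable]:
  "(\<lambda>z. vector [fst z, snd z] :: real^2) \<in> borel_measurable (lborel \<Otimes>\<^sub>M lborel)"
proof -
  have "(\<lambda>z. (\<Sum>i\<in>UNIV. (vector [fst z, snd z] $ i) *\<^sub>R axis i 1) :: real^2) \<in> borel_measurable (lborel \<Otimes>\<^sub>M lborel)"
    unfolding sum_2 vector_2 by measurable
  moreover have "(\<Sum>i\<in>UNIV. (x $ i) *\<^sub>R axis i 1) = x" for x :: "real^2"
    using basis_expansion[of x] by (simp add: scalar_mult_eq_scaleR)
  ultimately show ?thesis by simp
qed

text \<open>
  The vectors in the plane and the pairs of reals are different types; this identity gives access to
  Fubini's theorem.
\<close>

lemma lborel_plane_eq:
  "(lborel :: (real^2) measure) = distr (lborel \<Otimes>\<^sub>M lborel) borel (\<lambda>z. vector [fst z, snd z])"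
proof (rule lborel_eqI)
  fix l u :: "real^2" assume le: "\<And>b. b \<in> Basis \<Longrightarrow> l \<bullet> b \<le> u \<bullet> b"
  have le': "l $ i \<le> u $ i" for i
    using le[of "axis i 1"] by (simp add: inner_axis)
  have "(\<lambda>z. vector [fst z, snd z] :: real^2) -` box l u \<inter> space (lborel \<Otimes>\<^sub>M lborel) = {l $ 1<..<u $ 1} \<times> {l $ 2<..<u $ 2}"
    by (auto simp: mem_box_cart forall_2 space_pair_measure)
  then show "emeasure (distr (lborel \<Otimes>\<^sub>M lborel) borel (\<lambda>z. vector [fst z, snd z])) (box l u) = (\<Prod>b\<in>Basis. (u - l) \<bullet> b)"
    using le' by (simp add: emeasure_distr prod_Basis_plane lborel.emeasure_pair_measure_Times ennreal_mult)
qed simp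

lemma matrix_vector_mult_measurable [measurable (raw)]:
  fixes E :: "real^2^2"
  assumes [measurable]: "f \<in> borel_measurable M"
  shows "(\<lambda>x. E *v f x) \<in> borel_measurable M"
proof -
  have [measurable]: "(*v) E \<in> borel_measurable borel"
    by (intro borel_measurable_continuous_onI linear_continuous_on matrix_vector_mul_bounded_linear)
  show ?thesis by measurable
qed

lemma lborel_linear_plane:
  fixes E :: "real^2^2"
  assumes E: "det E \<noteq> 0"
  shows "lborel = density (distr lborel borel (\<lambda>x. E *v (x - t))) (\<lambda>_. ennreal \<bar>det E\<bar>)"
proof (rule lborel_eqI)
  fix l u :: "real^2" assume le: "\<And>b. b \<in> Basis \<Longrightarrow> l \<bullet> b \<le> u \<bullet> b"
  obtain E' where E': "E' ** E = mat 1" "E ** E' = mat 1"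
    using E by (metis invertible_det_nz invertible_def)
  have dd: "det E * det E' = 1"
    using E'(2) by (metis det_I det_mul)
  have inv: "E *v (E' *v x) = x" "E' *v (E *v x) = x" for x
    using E' by (simp_all add: matrix_vector_mul_assoc)
  have "x \<in> (\<lambda>x. t + x) ` ((*v) E') ` box l u" if "E *v (x - t) \<in> box l u" for x
  proof -
    have "x = t + E' *v (E *v (x - t))" by (simp add: inv)
    then show ?thesis using that by blast
  qed
  then have pre: "(\<lambda>x. E *v (x - t)) -` box l u = (\<lambda>x. t + x) ` ((*v) E') ` box l u"
    by (auto simp: inv)
  have lm: "((*v) E') ` box l u \<in> lmeasurable"
    by (intro measurable_linear_image) (auto intro: matrix_vector_mul_linear)
  have "measure lebesgue ((\<lambda>x. t + x) ` ((*v) E') ` box l u) = measure lebesgue (((*v) E') ` box l u)"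
    by (rule measure_translation)
  also have "\<dots> = \<bar>det (matrix ((*v) E'))\<bar> * measure lebesgue (box l u)"
    by (intro measure_linear_image) (auto intro: matrix_vector_mul_linear)
  also have "\<dots> = \<bar>det E'\<bar> * (\<Prod>b\<in>Basis. (u - l) \<bullet> b)"
    using le by (simp add: matrix_of_matrix_vector_mul measure_completion)
  finally have m: "measure lebesgue ((\<lambda>x. t + x) ` ((*v) E') ` box l u) = \<bar>det E'\<bar> * (\<Prod>b\<in>Basis. (u - l) \<bullet> b)" .
  have lm': "(\<lambda>x. t + x) ` ((*v) E') ` box l u \<in> lmeasurable"
    using lm by (simp add: measurable_translation)
  have bor: "(\<lambda>x. E *v (x - t)) -` box l u \<in> sets borel"
    using measurable_sets_borel[of "\<lambda>x. E *v (x - t)" borel "box l u"] by simp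
  have "emeasure lborel ((\<lambda>x. E *v (x - t)) -` box l u) = emeasure lebesgue ((\<lambda>x. E *v (x - t)) -` box l u)"
    using bor by (simp add: emeasure_completion)
  also have "\<dots> = ennreal (\<bar>det E'\<bar> * (\<Prod>b\<in>Basis. (u - l) \<bullet> b))"
    unfolding pre m[symmetric] using lm' by (rule emeasure_eq_measure2)
  finally have e: "emeasure lborel ((\<lambda>x. E *v (x - t)) -` box l u) = ennreal (\<bar>det E'\<bar> * (\<Prod>b\<in>Basis. (u - l) \<bullet> b))" .
  have "emeasure (density (distr lborel borel (\<lambda>x. E *v (x - t))) (\<lambda>_. ennreal \<bar>det E\<bar>)) (box l u)
      = ennreal \<bar>det E\<bar> * emeasure lborel ((\<lambda>x. E *v (x - t)) -` box l u)"
    by (simp add: emeasure_density nn_integral_cmult_indicator emeasure_distr)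
  also have "\<dots> = ennreal (\<bar>det E * det E'\<bar> * (\<Prod>b\<in>Basis. (u - l) \<bullet> b))"
    unfolding e by (simp add: ennreal_mult'[symmetric] abs_mult mult.assoc)
  finally show "emeasure (density (distr lborel borel (\<lambda>x. E *v (x - t))) (\<lambda>_. ennreal \<bar>det E\<bar>)) (box l u)
     = (\<Prod>b\<in>Basis. (u - l) \<bullet> b)" unfolding dd by simp
qed simp

lemma integral_linear_plane:
  fixes E :: "real^2^2" and \<phi> :: "real^2 \<Rightarrow> real"
  assumes E: "det E \<noteq> 0" and [measurable]: "\<phi> \<in> borel_measurable borel"
  shows "(LINT x|lborel. \<phi> (E *v (x - t))) = (LINT u|lborel. \<phi> u) / \<bar>det E\<bar>"
proof -
  have "(LINT u|lborel. \<phi> u) = (LINT u|density (distr lborel borel (\<lambda>x. E *v (x - t))) (\<lambda>_. ennreal \<bar>det E\<bar>). \<phi> u)"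
    by (subst lborel_linear_plane[OF E, of t]) (rule refl)
  also have "\<dots> = \<bar>det E\<bar> * (LINT x|lborel. \<phi> (E *v (x - t)))"
    by (simp add: integral_density integral_distr)
  finally show ?thesis using E by simp
qed

lemma integral_plane_iterated:
  fixes \<phi> :: "real^2 \<Rightarrow> real"
  assumes [measurable]: "\<phi> \<in> borel_measurable borel"
    and bnd: "\<And>x. \<bar>\<phi> x\<bar> \<le> B" and supp: "\<And>x. \<phi> x \<noteq> 0 \<Longrightarrow> x \<in> square R"
  shows "(LINT u|lborel. \<phi> u) = (LINT y|lborel. LINT x|lborel. \<phi> (vector [x, y]))"
    and "integrable lborel \<phi>"
proof -
  have [measurable]: "(\<lambda>z. \<phi> (vector [fst z, snd z])) \<in> borel_measurable (lborel \<Otimes>\<^sub>M lborel)"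
    by measurable
  have int: "integrable (lborel \<Otimes>\<^sub>M lborel) (\<lambda>z. \<phi> (vector [fst z, snd z]))"
  proof (rule integrableI_bounded_set[where A="cbox (-R, -R) (R, R)" and B=B])
    show "emeasure (lborel \<Otimes>\<^sub>M lborel) (cbox (-R, -R) (R, R)) < \<infinity>"
      unfolding lborel_prod by (rule emeasure_lborel_cbox_finite)
    show "AE x in lborel \<Otimes>\<^sub>M lborel. x \<notin> cbox (- R, - R) (R, R) \<longrightarrow> \<phi> (vector [fst x, snd x]) = 0"
      using supp by (intro AE_I2) (force simp: square_def forall_2 abs_le_iff)
    show "cbox (-R, -R) (R, R) \<in> sets (lborel \<Otimes>\<^sub>M lborel)"
      unfolding lborel_prod by simp
    show "AE x in lborel \<Otimes>\<^sub>M lborel. x \<in> cbox (- R, - R) (R, R) \<longrightarrow> norm (\<phi> (vector [fst x, snd x])) \<le> B"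
      using bnd by (intro AE_I2) simp
  qed measurable
  show "integrable lborel \<phi>"
    by (subst lborel_plane_eq) (use int in \<open>simp add: integrable_distr_eq\<close>)
  have "(LINT u|lborel. \<phi> u) = (LINT z|(lborel \<Otimes>\<^sub>M lborel). \<phi> (vector [fst z, snd z]))"
    by (subst lborel_plane_eq) (simp add: integral_distr)
  also have "\<dots> = (LINT y|lborel. LINT x|lborel. \<phi> (vector [x, y]))"
    using lborel_pair.integral_snd[of "\<lambda>x y. \<phi> (vector [x, y])"] int by (simp add: case_prod_beta')
  finally show "(LINT u|lborel. \<phi> u) = (LINT y|lborel. LINT x|lborel. \<phi> (vector [x, y]))" .
qed

section \<open>Hoelder classes and kernel smoothing on the line\<close>

lemma strict_floor:
  assumes "0 < a"
  shows "real (strict_floor a) < a" "a \<le> real (strict_floor a) + 1"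
proof -
  have b: "m \<le> nat \<lceil>a\<rceil>" if "real m < a" for m using that by linarith
  show "real (strict_floor a) < a"
    unfolding strict_floor_def by (rule GreatestI_nat[of _ 0 "nat \<lceil>a\<rceil>"]) (use assms b in auto)
  show "a \<le> real (strict_floor a) + 1"
  proof (rule ccontr)
    assume "\<not> ?thesis"
    then have "real (Suc (strict_floor a)) < a" by simp
    then have "Suc (strict_floor a) \<le> strict_floor a"
      unfolding strict_floor_def by (rule Greatest_le_nat[where b="nat \<lceil>a\<rceil>"]) (use b in auto)
    then show False by simp
  qed
qed

lemma strict_floor_mono:
  assumes "0 < a" "a \<le> b" shows "strict_floor a \<le> strict_floor b"
  using strict_floor[of a] strict_floor[of b] assms by linarith

lemma sup_norm_le: "sup_norm f \<le> ereal L \<Longrightarrow> \<bar>f x\<bar> \<le> L"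
  unfolding sup_norm_def by (metis SUP_upper UNIV_I ereal_less_eq(3) order_trans)

context
  fixes \<beta> L :: real and f
  assumes \<beta>: "0 < \<beta>" and f: "f \<in> holder_class \<beta> L"
begin

private abbreviation (input) "k \<equiv> strict_floor \<beta>"

lemma holder_diff: "m < k \<Longrightarrow> ((deriv ^^ m) f has_real_derivative (deriv ^^ Suc m) f x) (at x)"
  using f by (auto simp: holder_class_def Let_def DERIV_deriv_iff_real_differentiable)

lemma holder_top: "\<bar>(deriv ^^ k) f u - (deriv ^^ k) f v\<bar> \<le> L * \<bar>u - v\<bar> powr (\<beta> - k)"
proof -
  have *: "\<bar>(deriv ^^ k) f (v + h) - (deriv ^^ k) f v\<bar> \<le> L * h powr (\<beta> - k)" if "0 < h" for v h
    using f that by (auto simp: holder_class_def Let_def)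
  consider "u = v" | "u < v" | "v < u" by linarith
  then show ?thesis
  proof cases
    case 1 then show ?thesis by simp
  next
    case 2 then show ?thesis using *[of "v - u" u] by (simp add: abs_minus_commute)
  next
    case 3 then show ?thesis using *[of "u - v" v] by simp
  qed
qed

lemma holder_bounded: "m \<le> k \<Longrightarrow> \<bar>(deriv ^^ m) f x\<bar> \<le> L"
  using f by (auto simp: holder_class_def Let_def intro: sup_norm_le)

lemma holder_abs_le: "\<bar>f x\<bar> \<le> L"
  using holder_bounded[of 0 x] by simp

lemma holder_continuous: "continuous_on UNIV f"
proof (cases "k = 0")
  case True
  then show ?thesis using f by (auto simp: holder_class_def Let_def)
next
  case False
  then show ?thesis using holder_diff[of 0]
    by (auto intro!: continuous_at_imp_continuous_on DERIV_isCont)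
qed

lemma holder_measurable: "f \<in> borel_measurable borel"
  using holder_continuous by (rule borel_measurable_continuous_onI)

text \<open>On short distances functions of the class share the Hoelder exponent \<open>min \<beta> 1\<close>.\<close>

lemma holder_modulus:
  assumes "\<bar>x - y\<bar> \<le> 1"
  shows "\<bar>f x - f y\<bar> \<le> L * \<bar>x - y\<bar> powr min \<beta> 1"
proof (cases "k = 0")
  case True
  then show ?thesis using holder_top[of x y] strict_floor(2)[OF \<beta>] by (simp add: min_def)
next
  case False
  then have "1 \<le> real k" by simp
  then have 1: "min \<beta> 1 = 1" using strict_floor(1)[OF \<beta>] by simp
  have "norm (f x - f y) \<le> L * norm (x - y)"
  proof (rule field_differentiable_bound[of UNIV f "(deriv ^^ 1) f"])
    show "(f has_field_derivative (deriv ^^ 1) f z) (at z within UNIV)" for z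
      using holder_diff[of 0 z] False by simp
    show "norm ((deriv ^^ 1) f z) \<le> L" for z using holder_bounded[of 1 z] False by simp
  qed auto
  then show ?thesis unfolding 1 by simp
qed

text \<open>
  Taylor's formula with Lagrange's remainder of order \<open>k\<close>; the polynomial takes the \<open>k\<close>-th derivative
  at \<open>y\<close> instead of the intermediate point, and the Hoelder condition bounds the difference.
\<close>

lemma holder_taylor:
  "\<bar>f x - (\<Sum>j\<le>k. (deriv ^^ j) f y / fact j * (x - y) ^ j)\<bar> \<le> L * \<bar>x - y\<bar> powr \<beta>"
proof (cases "k = 0")
  case True
  then show ?thesis using holder_top[of x y] by simp
next
  case False
  show ?thesis
  proof (cases "x = y")
    case True
    have "(\<Sum>j\<le>k. (deriv ^^ j) f y / fact j * (x - y) ^ j) = (\<Sum>j\<le>k. if j = 0 then f y else 0)"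
      by (rule sum.cong) (auto simp: True)
    then show ?thesis by (simp add: True)
  next
    case xy: False
    obtain s where s: "\<bar>s - y\<bar> \<le> \<bar>x - y\<bar>" and
      eq: "f x = (\<Sum>j<k. (deriv ^^ j) f y / fact j * (x - y) ^ j) + (deriv ^^ k) f s / fact k * (x - y) ^ k"
    proof -
      have "\<exists>s. (if x < y then x < s \<and> s < y else y < s \<and> s < x) \<and>
        f x = (\<Sum>j<k. (deriv ^^ j) f y / fact j * (x - y) ^ j) + (deriv ^^ k) f s / fact k * (x - y) ^ k"
        by (rule Taylor[of k "\<lambda>j. (deriv ^^ j) f" f "min x y" "max x y"]) (use False xy holder_diff in auto)
      then show thesis using that by (smt (verit))
    qed
    have "f x - (\<Sum>j\<le>k. (deriv ^^ j) f y / fact j * (x - y) ^ j)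
        = ((deriv ^^ k) f s - (deriv ^^ k) f y) / fact k * (x - y) ^ k"
      by (simp add: eq lessThan_Suc_atMost[symmetric] algebra_simps diff_divide_distrib)
    also have "\<bar>\<dots>\<bar> \<le> (L * \<bar>x - y\<bar> powr (\<beta> - k)) / 1 * \<bar>x - y\<bar> ^ k"
      unfolding abs_mult abs_divide power_abs
    proof (intro mult_right_mono frac_le)
      have "0 \<le> L" using holder_abs_le[of 0] by linarith
      then show "\<bar>(deriv ^^ k) f s - (deriv ^^ k) f y\<bar> \<le> L * \<bar>x - y\<bar> powr (\<beta> - k)"
        using holder_top[of s y] s strict_floor(1)[OF \<beta>]
        by (meson abs_ge_zero diff_ge_0_iff_ge less_imp_le mult_left_mono order_trans powr_mono2)
      show "0 \<le> L * \<bar>x - y\<bar> powr (\<beta> - k)" using \<open>0 \<le> L\<close> by simp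
    qed auto
    also have "\<dots> = L * \<bar>x - y\<bar> powr \<beta>"
      using xy by (simp add: powr_diff powr_realpow)
    finally show ?thesis .
  qed
qed

end

lemma square_eq_cbox: "square R = (cbox (\<chi> i. - R) (\<chi> i. R) :: (real^2) set)"
  by (auto simp: square_def mem_box_cart abs_le_iff minus_le_iff)

section \<open>The model\<close>

locale single_index_model = single_index_procedure \<K> g gl Q \<Upsilon> \<Omega> \<omega> r
  for \<K> :: "real \<Rightarrow> real" and g :: "real^2 \<Rightarrow> real" and gl Q \<Upsilon> \<Omega> \<omega> r :: real +
  fixes p :: "real \<Rightarrow> real" and \<beta> L :: real
  assumes noise_constants: "0 < \<Upsilon>" "0 < \<Omega>" "\<Omega> \<le> 1" "0 < \<omega>"
    and noise: "p \<in> noise_densities \<Upsilon> \<Omega> \<omega>"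
    and design: "prob_density g" "0 < gl" "gl < 1" "\<And>x. x \<in> square 3 \<Longrightarrow> gl \<le> g x"
    and kernel: "kernel_assumption \<K> Q"
    and moments: "\<And>j. j \<in> {1..strict_floor \<beta>} \<Longrightarrow> (LINT z|lborel. z ^ j * \<K> z) = 0"
    and \<beta>: "0 < \<beta>"
    and L: "0 < L"
    and r: "1 \<le> r"
begin

subsection \<open>The kernel\<close>

lemma K_even: "\<K> (- u) = \<K> u"
  and K_Lipschitz: "\<bar>\<K> u - \<K> v\<bar> \<le> Q * \<bar>u - v\<bar>"
  and K_integral: "(LINT u|lborel. \<K> u) = 1"
  and Q_pos: "0 < Q"
  using kernel unfolding kernel_assumption_def by blast+

lemma K_support: "\<K> u \<noteq> 0 \<Longrightarrow> \<bar>u\<bar> \<le> 1/2"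
proof -
  assume "\<K> u \<noteq> 0"
  then have "u \<in> closure {u. \<K> u \<noteq> 0}" by (intro subsetD[OF closure_subset]) simp
  moreover have "closure {u. \<K> u \<noteq> 0} \<subseteq> {-1/2..1/2}" using kernel by (simp add: kernel_assumption_def)
  ultimately have "u \<in> {-1/2..1/2}" by (rule subsetD[rotated])
  then show ?thesis by auto
qed

lemma K_measurable [measurable]: "\<K> \<in> borel_measurable borel"
proof (intro borel_measurable_continuous_onI)
  have "Q-lipschitz_on UNIV \<K>"
    using K_Lipschitz Q_pos by (intro lipschitz_onI) (auto simp: dist_real_def)
  then show "continuous_on UNIV \<K>" by (rule lipschitz_on_continuous_on)
qed

text \<open>
  The kernel vanishes at \<open>1\<close>, at distance at most \<open>3/2\<close> from every point of its support.
\<close>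

lemma K_le_Q: "\<bar>\<K> u\<bar> \<le> 3/2 * Q"
proof (cases "\<K> u = 0")
  case False
  have "\<K> 1 = 0" using K_support[of 1] by auto
  then have "\<bar>\<K> u\<bar> \<le> Q * \<bar>u - 1\<bar>" using K_Lipschitz[of u 1] by simp
  also have "\<dots> \<le> Q * (3/2)" using K_support[OF False] Q_pos by (intro mult_left_mono) auto
  finally show ?thesis by simp
qed (use Q_pos in auto)

lemma sup_norm_K: "sup_norm \<K> = ereal Kinf"
proof -
  have "sup_norm \<K> \<le> ereal (3/2 * Q)" unfolding sup_norm_def by (rule SUP_least) (use K_le_Q in auto)
  moreover have "0 \<le> sup_norm \<K>" unfolding sup_norm_def by (rule SUP_upper2[of 0]) auto
  ultimately have "\<bar>sup_norm \<K>\<bar> \<noteq> \<infinity>" by auto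
  then show ?thesis unfolding Kinf_def by (simp add: ereal_real')
qed

lemma K_le_Kinf: "\<bar>\<K> u\<bar> \<le> Kinf"
  by (rule sup_norm_le) (simp add: sup_norm_K)

lemma Kinf_le_Q: "Kinf \<le> 3/2 * Q"
proof -
  have "sup_norm \<K> \<le> ereal (3/2 * Q)" unfolding sup_norm_def by (rule SUP_least) (use K_le_Q in auto)
  then show ?thesis by (simp add: sup_norm_K)
qed

lemma kernel_integrable:
  assumes [measurable]: "\<phi> \<in> borel_measurable borel" and bnd: "\<And>u. \<bar>u\<bar> \<le> 1/2 \<Longrightarrow> \<bar>\<phi> u\<bar> \<le> B"
  shows "integrable lborel (\<lambda>u. \<K> u * \<phi> u)"
proof (rule integrableI_bounded_set[where A="{-1/2..1/2}" and B="Kinf * B"])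
  show "AE u in lborel. u \<in> {-1/2..1/2} \<longrightarrow> norm (\<K> u * \<phi> u) \<le> Kinf * B"
    using K_le_Kinf bnd by (intro AE_I2) (auto simp: abs_mult intro!: mult_mono order_trans[OF abs_ge_zero K_le_Kinf])
  show "AE u in lborel. u \<notin> {-1/2..1/2} \<longrightarrow> \<K> u * \<phi> u = 0"
    using K_support by (intro AE_I2) force
qed auto

lemma K_integrable: "integrable lborel \<K>"
  using kernel_integrable[of "\<lambda>_. 1" 1] by simp

lemma K1_ge_1: "1 \<le> K1"
  using integral_abs_bound[of lborel \<K>] K_integral by (simp add: K1_def)

lemma Kinf_ge_1: "1 \<le> Kinf"
proof -
  have "1 = (LINT u|lborel. \<K> u)" by (simp add: K_integral)
  also have "\<dots> \<le> (LINT u|lborel. Kinf * indicator {-1/2..1/2::real} u)"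
  proof (rule integral_mono[OF K_integrable])
    show "\<K> u \<le> Kinf * indicator {-1/2..1/2::real} u" for u
      using K_le_Kinf[of u] K_support[of u] by (cases "\<K> u = 0") (auto simp: indicator_def abs_le_iff)
  qed simp
  also have "\<dots> = Kinf" by simp
  finally show ?thesis .
qed

text \<open>
  The vanishing moments cancel the Taylor polynomial, so that only its remainder is averaged.
\<close>

lemma smoothing_bias:
  assumes f: "f \<in> holder_class \<beta> L"
  shows "\<bar>(LINT u|lborel. \<K> u * f (y + q * u)) - f y\<bar> \<le> K1 * (L * (\<bar>q\<bar> / 2) powr \<beta>)"
proof -
  let ?k = "strict_floor \<beta>"
  note [measurable] = holder_measurable[OF \<beta> f]
  define c where "c = (\<lambda>j. (deriv ^^ j) f y / fact j * q ^ j)"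
  define R where "R = (\<lambda>u. f (y + q * u) - (\<Sum>j\<le>?k. c j * u ^ j))"
  have [measurable]: "R \<in> borel_measurable borel" unfolding R_def by measurable
  have R: "\<bar>R u\<bar> \<le> L * (\<bar>q\<bar> / 2) powr \<beta>" if "\<bar>u\<bar> \<le> 1/2" for u
  proof -
    have "\<bar>R u\<bar> \<le> L * \<bar>q * u\<bar> powr \<beta>"
      using holder_taylor[OF \<beta> f, of "y + q * u" y]
      by (simp add: R_def c_def power_mult_distrib mult.assoc)
    also have "\<dots> \<le> L * (\<bar>q\<bar> / 2) powr \<beta>"
      using L \<beta> mult_left_mono[OF that, of "\<bar>q\<bar>"] by (intro mult_left_mono powr_mono2) (auto simp: abs_mult)
    finally show ?thesis .
  qed
  have pow: "\<bar>u ^ j\<bar> \<le> 1" if "\<bar>u\<bar> \<le> 1/2" for u :: real and j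
    unfolding power_abs using that by (intro power_le_one) auto
  have ip: "integrable lborel (\<lambda>u. \<K> u * u ^ j)" for j by (rule kernel_integrable[OF _ pow]) auto
  have iR: "integrable lborel (\<lambda>u. \<K> u * R u)" by (rule kernel_integrable[OF _ R]) auto
  have mom: "(LINT u|lborel. \<K> u * u ^ j) = (if j = 0 then 1 else 0)" if "j \<le> ?k" for j
    using moments[of j] K_integral that by (auto simp: mult.commute)
  have "(LINT u|lborel. \<K> u * f (y + q * u)) = (LINT u|lborel. (\<Sum>j\<le>?k. c j * (\<K> u * u ^ j)) + \<K> u * R u)"
    by (rule Bochner_Integration.integral_cong) (auto simp: R_def algebra_simps sum_distrib_left)
  also have "\<dots> = (\<Sum>j\<le>?k. c j * (LINT u|lborel. \<K> u * u ^ j)) + (LINT u|lborel. \<K> u * R u)"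
    using ip iR by simp
  also have "(\<Sum>j\<le>?k. c j * (LINT u|lborel. \<K> u * u ^ j)) = (\<Sum>j\<le>?k. if j = 0 then c 0 else 0)"
    by (rule sum.cong) (auto simp: mom)
  also have "\<dots> = f y" by (simp add: c_def)
  finally have "\<bar>(LINT u|lborel. \<K> u * f (y + q * u)) - f y\<bar> = \<bar>LINT u|lborel. \<K> u * R u\<bar>" by simp
  also have "\<dots> \<le> (LINT u|lborel. \<bar>\<K> u * R u\<bar>)" by (rule integral_abs_bound)
  also have "\<dots> \<le> (LINT u|lborel. \<bar>\<K> u\<bar> * (L * (\<bar>q\<bar> / 2) powr \<beta>))"
  proof (rule integral_mono)
    show "\<bar>\<K> u * R u\<bar> \<le> \<bar>\<K> u\<bar> * (L * (\<bar>q\<bar> / 2) powr \<beta>)" for u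
      using R K_support[of u] by (cases "\<K> u = 0") (auto simp: abs_mult intro: mult_left_mono)
  qed (use iR K_integrable in auto)
  also have "\<dots> = K1 * (L * (\<bar>q\<bar> / 2) powr \<beta>)" by (simp add: K1_def)
  finally show ?thesis .
qed

lemma Kprod_measurable [measurable]: "Kprod \<in> borel_measurable borel"
proof -
  have [measurable]: "(\<lambda>x::real^2. x $ i) \<in> borel_measurable borel" for i
    by (intro borel_measurable_continuous_onI continuous_intros)
  show ?thesis unfolding Kprod_def[abs_def] by measurable
qed

lemma Kprod_support: "Kprod x \<noteq> 0 \<Longrightarrow> x \<in> square (1/2)"
  using K_support by (auto simp: Kprod_def square_def forall_2)

lemma Kprod_minus: "Kprod (- x) = Kprod x"
  by (simp add: Kprod_def K_even)

lemma Kprod_le: "\<bar>Kprod x\<bar> \<le> Kinf\<^sup>2"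
  unfolding Kprod_def abs_mult power2_eq_square
  by (intro mult_mono K_le_Kinf) (use Kinf_ge_1 in auto)

lemma Kprod_integral:
  assumes [measurable]: "\<phi> \<in> borel_measurable borel" and bnd: "\<And>u. u \<in> square (1/2) \<Longrightarrow> \<bar>\<phi> u\<bar> \<le> B"
  shows "integrable lborel (\<lambda>u. Kprod u * \<phi> u)"
    "(LINT u|lborel. Kprod u * \<phi> u) = (LINT y|lborel. \<K> y * (LINT x|lborel. \<K> x * \<phi> (vector [x, y])))"
    "\<bar>LINT u|lborel. Kprod u * \<phi> u\<bar> \<le> K1\<^sup>2 * B"
proof -
  have B: "0 \<le> B" using bnd[of 0] by (auto simp: square_def)
  have b: "\<bar>Kprod u * \<phi> u\<bar> \<le> Kinf\<^sup>2 * B" for u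
  proof (cases "Kprod u = 0")
    case False
    then show ?thesis unfolding abs_mult by (intro mult_mono Kprod_le bnd Kprod_support) auto
  qed (use B in auto)
  show int: "integrable lborel (\<lambda>u. Kprod u * \<phi> u)"
    by (rule integral_plane_iterated(2)[where B="Kinf\<^sup>2 * B" and R="1/2"]) (use b Kprod_support in auto)
  have "(LINT u|lborel. Kprod u * \<phi> u) = (LINT y|lborel. LINT x|lborel. Kprod (vector [x, y]) * \<phi> (vector [x, y]))"
    by (rule integral_plane_iterated(1)[where B="Kinf\<^sup>2 * B" and R="1/2"]) (use b Kprod_support in auto)
  also have "\<dots> = (LINT y|lborel. LINT x|lborel. \<K> y * (\<K> x * \<phi> (vector [x, y])))"
    by (intro Bochner_Integration.integral_cong refl) (simp add: Kprod_def)
  also have "\<dots> = (LINT y|lborel. \<K> y * (LINT x|lborel. \<K> x * \<phi> (vector [x, y])))"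
    by simp
  finally show "(LINT u|lborel. Kprod u * \<phi> u) = (LINT y|lborel. \<K> y * (LINT x|lborel. \<K> x * \<phi> (vector [x, y])))" .
  have a: "integrable lborel (\<lambda>u. \<bar>Kprod u\<bar>)"
  proof (rule integral_plane_iterated(2)[where B="Kinf\<^sup>2" and R="1/2"])
  qed (use Kprod_le Kprod_support in auto)
  have "(LINT u|lborel. \<bar>Kprod u\<bar>) = (LINT y|lborel. LINT x|lborel. \<bar>Kprod (vector [x, y])\<bar>)"
    by (rule integral_plane_iterated(1)[where B="Kinf\<^sup>2" and R="1/2"]) (use Kprod_le Kprod_support in auto)
  also have "\<dots> = K1\<^sup>2"
    by (simp add: Kprod_def abs_mult K1_def power2_eq_square)
  finally have K: "(LINT u|lborel. \<bar>Kprod u\<bar>) = K1\<^sup>2" .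
  have "\<bar>LINT u|lborel. Kprod u * \<phi> u\<bar> \<le> (LINT u|lborel. \<bar>Kprod u * \<phi> u\<bar>)" by (rule integral_abs_bound)
  also have "\<dots> \<le> (LINT u|lborel. \<bar>Kprod u\<bar> * B)"
  proof (rule integral_mono)
    show "\<bar>Kprod u * \<phi> u\<bar> \<le> \<bar>Kprod u\<bar> * B" for u
      using bnd Kprod_support[of u] by (cases "Kprod u = 0") (auto simp: abs_mult intro: mult_left_mono)
  qed (use int a in auto)
  finally show "\<bar>LINT u|lborel. Kprod u * \<phi> u\<bar> \<le> K1\<^sup>2 * B" by (simp add: K)
qed

lemma Kprod_integral_1: "(LINT u|lborel. Kprod u) = 1"
  using Kprod_integral(2)[of "\<lambda>_. 1" 1] K_integral by simp

lemma Kprod_square_integral: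
  "integrable lborel (\<lambda>u. (Kprod u)\<^sup>2)" "(LINT u|lborel. (Kprod u)\<^sup>2) \<le> Kinf ^ 4"
proof -
  have b: "\<bar>(Kprod u)\<^sup>2\<bar> \<le> Kinf ^ 4" for u
    using power_mono[OF Kprod_le[of u], of 2] by (simp flip: power_mult)
  show int: "integrable lborel (\<lambda>u. (Kprod u)\<^sup>2)"
    by (rule integral_plane_iterated(2)[where B="Kinf ^ 4" and R="1/2"]) (use b Kprod_support in auto)
  have "(LINT u|lborel. (Kprod u)\<^sup>2) \<le> (LINT u|lborel. Kinf ^ 4 * indicator (square (1/2)) (u::real^2))"
  proof (rule integral_mono[OF int])
    show "(Kprod u)\<^sup>2 \<le> Kinf ^ 4 * indicator (square (1/2)) u" for u
      using b[of u] Kprod_support[of u] by (cases "Kprod u = 0") auto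
  qed (auto simp: square_eq_cbox intro!: integrable_real_indicator emeasure_lborel_cbox_finite)
  also have "\<dots> = Kinf ^ 4 * measure lborel (cbox (\<chi> i. -(1/2)) (\<chi> i. 1/2) :: (real^2) set)"
    by (simp add: square_eq_cbox)
  also have "measure lborel (cbox (\<chi> i. -(1/2)) (\<chi> i. 1/2) :: (real^2) set) = 1"
  proof -
    have "\<forall>b\<in>Basis. ((\<chi> i. -(1/2)) :: real^2) \<bullet> b \<le> (\<chi> i. 1/2) \<bullet> b"
      by (auto simp: Basis_vec_def inner_axis)
    then show ?thesis by (simp add: measure_lborel_cbox_eq prod_Basis_plane)
  qed
  finally show "(LINT u|lborel. (Kprod u)\<^sup>2) \<le> Kinf ^ 4" by simp
qed

end

section \<open>Projection matrices\<close>

lemma matrix_vector_mult_2: "(E *v x) $ i = E $ i $ 1 * x $ 1 + E $ i $ 2 * (x::real^2) $ 2"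
  by (simp add: matrix_vector_mult_def sum_2)

lemma norm_plane_sq: "(norm (a::real^2))\<^sup>2 = (a $ 1)\<^sup>2 + (a $ 2)\<^sup>2"
  by (simp add: norm_vec_def L2_set_def sum_2)

lemma inner_plane: "(a::real^2) \<bullet> b = a $ 1 * b $ 1 + a $ 2 * b $ 2"
  by (simp add: inner_vec_def sum_2)

text \<open>
  The matrices that occur in the selection rule are all of the form \<open>E_mat a \<eta>\<close>, where \<open>a\<close> need not
  be a unit vector but stays in this annulus.
\<close>

definition annulus :: "(real^2) set" where
  "annulus = {a. 1/2 \<le> norm a \<and> norm a \<le> 1}"

definition pair_vec :: "real^2 \<Rightarrow> real^2 \<Rightarrow> real^2" where
  "pair_vec \<theta> \<nu> = (1 / (2 * (1 + \<bar>\<nu> \<bullet> \<theta>\<bar>))) *\<^sub>R (if 0 \<le> \<nu> \<bullet> \<theta> then \<theta> + \<nu> else \<nu> - \<theta>)"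

lemma E_mat_entries:
  "E_mat a h $ 1 $ 1 = a $ 1 / h" "E_mat a h $ 1 $ 2 = a $ 2 / h"
  "E_mat a h $ 2 $ 1 = - a $ 2" "E_mat a h $ 2 $ 2 = a $ 1"
  by (simp_all add: E_mat_def)

lemma E_mat_mult:
  "(E_mat a h *v y) $ 1 = (a $ 1 * y $ 1 + a $ 2 * y $ 2) / h"
  "(E_mat a h *v y) $ 2 = a $ 1 * y $ 2 - a $ 2 * y $ 1"
  by (simp_all add: matrix_vector_mult_2 E_mat_entries add_divide_distrib)

lemma det_E_mat: "det (E_mat a h) = (norm a)\<^sup>2 / h"
  by (simp add: det_2 E_mat_entries norm_plane_sq add_divide_distrib) (simp add: power2_eq_square)

lemma E_mat_minus: "E_mat (- a) h = - E_mat a h"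
  by (simp add: vec_eq_iff forall_2 E_mat_entries)

lemma E_pair_mat_eq: "E_pair_mat \<theta> \<nu> h = E_mat (pair_vec \<theta> \<nu>) h"
  by (simp add: vec_eq_iff forall_2 E_mat_entries E_pair_mat_def Ebar_mat_def pair_vec_def)

lemma pair_vec_commute: "pair_vec \<nu> \<theta> = (if 0 \<le> \<nu> \<bullet> \<theta> then pair_vec \<theta> \<nu> else - pair_vec \<theta> \<nu>)"
  by (simp add: pair_vec_def inner_commute add.commute) (simp add: algebra_simps)

lemma annulus_component: "a \<in> annulus \<Longrightarrow> \<bar>a $ i\<bar> \<le> 1"
  using component_le_norm_cart[of a i] by (auto simp: annulus_def)

lemma annulus_norm_sq:
  assumes "a \<in> annulus" shows "1/4 \<le> (norm a)\<^sup>2" "(norm a)\<^sup>2 \<le> 1"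
  using assms power_mono[of "1/2" "norm a" 2] power_mono[of "norm a" 1 2]
  by (auto simp: annulus_def power2_eq_square)

lemma sphere_annulus: "\<nu> \<in> sphere 0 1 \<Longrightarrow> \<nu> \<in> annulus"
  by (auto simp: annulus_def)

text \<open>
  Coordinates relative to \<open>\<theta>\<close>: the value \<open>x \<bullet> \<theta>\<close> for \<open>x\<close> mapped to \<open>u\<close> by \<open>E_mat a \<eta>\<close> is \<open>\<eta> * along a \<theta> * u\<^sub>1 + across a \<theta> * u\<^sub>2\<close>.
\<close>

definition along :: "real^2 \<Rightarrow> real^2 \<Rightarrow> real" where
  "along a \<theta> = (a \<bullet> \<theta>) / (norm a)\<^sup>2"

definition across :: "real^2 \<Rightarrow> real^2 \<Rightarrow> real" where
  "across a \<theta> = (a $ 1 * \<theta> $ 2 - a $ 2 * \<theta> $ 1) / (norm a)\<^sup>2"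

lemma along_sphere:
  assumes "\<nu> \<in> sphere 0 1" "\<theta> \<in> sphere 0 1" shows "\<bar>along \<nu> \<theta>\<bar> \<le> 2"
  using Cauchy_Schwarz_ineq2[of \<nu> \<theta>] assms by (simp add: along_def)

lemma across_self: "across \<theta> \<theta> = 0"
  by (simp add: across_def)

text \<open>
  The point of the pair matrices: seen from \<open>\<theta>\<close>, the matrix for the pair \<open>\<theta>, \<nu>\<close> has the same
  component across as the matrix for \<open>\<nu>\<close>, and its component along is harmless.
\<close>

lemma pair_vec:
  assumes \<theta>: "\<theta> \<in> sphere 0 1" and \<nu>: "\<nu> \<in> sphere 0 1"
  shows "pair_vec \<theta> \<nu> \<in> annulus" "\<bar>along (pair_vec \<theta> \<nu>) \<theta>\<bar> \<le> 2"
    "across (pair_vec \<theta> \<nu>) \<theta> = across \<nu> \<theta>"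
proof -
  define s :: real where "s = (if 0 \<le> \<nu> \<bullet> \<theta> then 1 else -1)"
  define c where "c = 1 + \<bar>\<nu> \<bullet> \<theta>\<bar>"
  have c: "1 \<le> c" "c \<le> 2"
    using Cauchy_Schwarz_ineq2[of \<nu> \<theta>] \<theta> \<nu> by (simp_all add: c_def)
  have pv: "pair_vec \<theta> \<nu> = (1 / (2 * c)) *\<^sub>R (s *\<^sub>R \<theta> + \<nu>)"
    by (simp add: pair_vec_def c_def s_def)
  have th: "(\<theta> $ 1)\<^sup>2 + (\<theta> $ 2)\<^sup>2 = 1" "(\<nu> $ 1)\<^sup>2 + (\<nu> $ 2)\<^sup>2 = 1"
    using \<theta> \<nu> by (simp_all flip: norm_plane_sq)
  have s2: "s * s = 1" by (simp add: s_def)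
  have sc: "s * (\<nu> \<bullet> \<theta>) = c - 1" by (simp add: s_def c_def)
  have "(norm (s *\<^sub>R \<theta> + \<nu>))\<^sup>2 = (s * s) * (\<theta> \<bullet> \<theta>) + 2 * (s * (\<nu> \<bullet> \<theta>)) + \<nu> \<bullet> \<nu>"
    unfolding power2_norm_eq_inner by (simp add: inner_simps inner_commute algebra_simps)
  also have "\<dots> = 2 * c" using \<theta> \<nu> by (simp add: s2 sc dot_square_norm)
  finally have n1: "(norm (s *\<^sub>R \<theta> + \<nu>))\<^sup>2 = 2 * c" .
  have n2: "(norm (pair_vec \<theta> \<nu>))\<^sup>2 = 1 / (2 * c)"
    unfolding pv norm_scaleR power_mult_distrib n1 using c by (simp add: power2_eq_square field_simps)
  have "(1/2)\<^sup>2 \<le> (norm (pair_vec \<theta> \<nu>))\<^sup>2" "(norm (pair_vec \<theta> \<nu>))\<^sup>2 \<le> 1\<^sup>2"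
    unfolding n2 using c by (simp_all add: power2_eq_square field_simps)
  then show "pair_vec \<theta> \<nu> \<in> annulus"
    unfolding annulus_def using power2_le_imp_le[of "1/2" "norm (pair_vec \<theta> \<nu>)"]
      power2_le_imp_le[of "norm (pair_vec \<theta> \<nu>)" 1] by simp
  have "pair_vec \<theta> \<nu> \<bullet> \<theta> = (1 / (2 * c)) * (s * (\<theta> \<bullet> \<theta>) + \<nu> \<bullet> \<theta>)"
    unfolding pv by (simp add: inner_simps)
  also have "s * (\<theta> \<bullet> \<theta>) + \<nu> \<bullet> \<theta> = s * (s * s * 1 + s * (\<nu> \<bullet> \<theta>))"
    using \<theta> by (simp add: s_def dot_square_norm)
  also have "\<dots> = s * c" by (simp add: s2 sc)
  finally have "along (pair_vec \<theta> \<nu>) \<theta> = s * c" unfolding along_def n2 using c by simp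
  then show "\<bar>along (pair_vec \<theta> \<nu>) \<theta>\<bar> \<le> 2" using c by (simp add: abs_mult s_def)
  have "across (pair_vec \<theta> \<nu>) \<theta> = 2 * c * ((1 / (2 * c)) * (\<nu> $ 1 * \<theta> $ 2 - \<nu> $ 2 * \<theta> $ 1))"
    unfolding across_def n2 unfolding pv by (simp add: algebra_simps)
  also have "\<dots> = across \<nu> \<theta>" using c \<nu> by (simp add: across_def)
  finally show "across (pair_vec \<theta> \<nu>) \<theta> = across \<nu> \<theta>" .
qed

section \<open>Weights of the observations\<close>

context single_index_model
begin

abbreviation "G \<equiv> density lborel (\<lambda>x. ennreal (g x))"

definition weight :: "real^2^2 \<Rightarrow> real^2 \<Rightarrow> real^2 \<Rightarrow> real" where
  "weight E v x = det E * Kprod (E *v (x - v)) / g x"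

lemma F_hat_eq: "F_hat n d E v = (\<Sum>i=1..n. weight E v (fst (d i)) * snd (d i)) / real n"
  by (simp add: F_hat_def weight_def sum_distrib_left sum_divide_distrib ac_simps)

lemma weight_minus: "weight (- E) v x = weight E v x"
proof -
  have "(- E) *v (x - v) = - (E *v (x - v))" by (simp add: vec_eq_iff matrix_vector_mult_2)
  moreover have "det (- E) = det E" by (simp add: det_2)
  ultimately show ?thesis by (simp add: weight_def Kprod_minus)
qed

lemma g_measurable [measurable]: "g \<in> borel_measurable borel"
  and g_nonneg: "0 \<le> g x"
  using design(1) by (auto simp: prob_density_def)

lemma prob_space_G: "prob_space G"
  using design(1) by (intro prob_spaceI) (simp add: emeasure_density prob_density_def)

lemma weight_measurable [measurable]: "weight E v \<in> borel_measurable borel"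
  unfolding weight_def[abs_def] by measurable

text \<open>The matrix \<open>E\<close> at the point \<open>v\<close> looks only at the region where the design density is bounded below.\<close>

definition localized :: "real^2^2 \<Rightarrow> real^2 \<Rightarrow> bool" where
  "localized E v \<longleftrightarrow> 0 < det E \<and> (\<forall>x. E *v (x - v) \<in> square (1/2) \<longrightarrow> x \<in> square 3)"

lemma weight_support:
  assumes "localized E v" "weight E v x \<noteq> 0"
  shows "E *v (x - v) \<in> square (1/2)" "x \<in> square 3"
  using assms Kprod_support[of "E *v (x - v)"] by (auto simp: weight_def localized_def)

lemma weight_le:
  assumes E: "localized E v"
  shows "\<bar>weight E v x\<bar> \<le> det E * Kinf\<^sup>2 / gl"
proof (cases "weight E v x = 0")
  case True
  then show ?thesis using E design by (simp add: localized_def)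
next
  case False
  then have "gl \<le> g x" using weight_support[OF E] design by blast
  then show ?thesis unfolding weight_def abs_divide abs_mult
    using E design Kprod_le by (intro frac_le mult_mono) (auto simp: localized_def)
qed

text \<open>
  Linear in \<open>det E\<close>, whereas the square of the weight is of the order of \<open>(det E)\<^sup>2\<close>: the weight is
  supported on a set of area at most \<open>1 / det E\<close>.
\<close>

lemma weight_sq_integral:
  assumes E: "localized E v"
  shows "(\<integral>x. (weight E v x)\<^sup>2 \<partial>G) \<le> det E * Kinf ^ 4 / gl"
proof -
  have d: "0 < det E" using E by (simp add: localized_def)
  have i: "integrable lborel (\<lambda>x. (Kprod (E *v (x - v)))\<^sup>2)"
  proof -
    have "integrable (density (distr lborel borel (\<lambda>x. E *v (x - v))) (\<lambda>_. ennreal \<bar>det E\<bar>)) (\<lambda>u. (Kprod u)\<^sup>2)"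
      using Kprod_square_integral(1) d by (subst lborel_linear_plane[OF less_imp_neq[THEN not_sym], symmetric]) auto
    then have "integrable lborel (\<lambda>x. \<bar>det E\<bar> * (Kprod (E *v (x - v)))\<^sup>2)"
      by (simp add: integrable_density integrable_distr_eq)
    then show ?thesis using d by simp
  qed
  have le: "g x * (weight E v x)\<^sup>2 \<le> (det E)\<^sup>2 / gl * (Kprod (E *v (x - v)))\<^sup>2" for x
  proof (cases "weight E v x = 0")
    case True
    then show ?thesis using design by simp
  next
    case False
    then have "gl \<le> g x" using weight_support[OF E] design by blast
    moreover have "0 < g x" using calculation design by simp
    ultimately have "(det E)\<^sup>2 * (Kprod (E *v (x - v)))\<^sup>2 / g x \<le> (det E)\<^sup>2 * (Kprod (E *v (x - v)))\<^sup>2 / gl"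
      using design by (intro divide_left_mono) auto
    then show ?thesis using \<open>0 < g x\<close>
      by (simp add: weight_def power_mult_distrib power_divide power2_eq_square ac_simps)
  qed
  have "(\<integral>x. (weight E v x)\<^sup>2 \<partial>G) = (\<integral>x. g x * (weight E v x)\<^sup>2 \<partial>lborel)"
    by (subst integral_density) (auto simp: g_nonneg)
  also have "\<dots> \<le> (\<integral>x. (det E)\<^sup>2 / gl * (Kprod (E *v (x - v)))\<^sup>2 \<partial>lborel)"
  proof (rule integral_mono)
    show "integrable lborel (\<lambda>x. g x * (weight E v x)\<^sup>2)"
    proof (rule Bochner_Integration.integrable_bound)
      show "integrable lborel (\<lambda>x. (det E)\<^sup>2 / gl * (Kprod (E *v (x - v)))\<^sup>2)" using i by simp
      show "AE x in lborel. norm (g x * (weight E v x)\<^sup>2) \<le> norm ((det E)\<^sup>2 / gl * (Kprod (E *v (x - v)))\<^sup>2)"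
        using le g_nonneg design by (intro AE_I2) (simp add: abs_mult)
    qed measurable
  qed (use i le in auto)
  also have "\<dots> = (det E)\<^sup>2 / gl * ((\<integral>u. (Kprod u)\<^sup>2 \<partial>lborel) / \<bar>det E\<bar>)"
    using d by (simp add: integral_linear_plane[of E "\<lambda>u. (Kprod u)\<^sup>2"])
  also have "\<dots> = det E / gl * (\<integral>u. (Kprod u)\<^sup>2 \<partial>lborel)"
    using d by (simp add: power2_eq_square)
  also have "\<dots> \<le> det E / gl * Kinf ^ 4"
    using d design Kprod_square_integral(2) by (intro mult_left_mono) auto
  finally show ?thesis by simp
qed

text \<open>Dividing by the design density makes the mean of a weighted observation a convolution.\<close>

lemma weight_integral:
  assumes E: "localized E v" and e: "\<And>x. e (E *v (x - v)) = x"
    and [measurable]: "e \<in> borel_measurable borel" "\<phi> \<in> borel_measurable borel"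
  shows "(\<integral>x. weight E v x * \<phi> x \<partial>G) = (\<integral>u. Kprod u * \<phi> (e u) \<partial>lborel)"
proof -
  have d: "0 < det E" using E by (simp add: localized_def)
  have "(\<integral>x. weight E v x * \<phi> x \<partial>G) = (\<integral>x. g x * (weight E v x * \<phi> x) \<partial>lborel)"
    by (subst integral_density) (auto simp: g_nonneg)
  also have "\<dots> = (\<integral>x. det E * (Kprod (E *v (x - v)) * \<phi> (e (E *v (x - v)))) \<partial>lborel)"
  proof (intro Bochner_Integration.integral_cong refl)
    fix x
    show "g x * (weight E v x * \<phi> x) = det E * (Kprod (E *v (x - v)) * \<phi> (e (E *v (x - v))))"
    proof (cases "Kprod (E *v (x - v)) = 0")
      case False
      then have "x \<in> square 3" using E Kprod_support by (auto simp: localized_def)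
      then have "gl \<le> g x" by (rule design(4))
      then have "0 < g x" using design(2) by linarith
      then show ?thesis by (simp add: weight_def e)
    qed (simp add: weight_def)
  qed
  also have "\<dots> = det E * ((\<integral>u. Kprod u * \<phi> (e u) \<partial>lborel) / \<bar>det E\<bar>)"
    using d by (simp add: integral_linear_plane[of E "\<lambda>u. Kprod u * \<phi> (e u)"])
  finally show ?thesis using d by simp
qed

lemma Kprod_Lipschitz: "\<bar>Kprod u - Kprod v\<bar> \<le> Kinf * Q * (\<bar>u $ 1 - v $ 1\<bar> + \<bar>u $ 2 - v $ 2\<bar>)"
proof -
  have "Kprod u - Kprod v = \<K> (u $ 1) * (\<K> (u $ 2) - \<K> (v $ 2)) + \<K> (v $ 2) * (\<K> (u $ 1) - \<K> (v $ 1))"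
    by (simp add: Kprod_def algebra_simps)
  also have "\<bar>\<dots>\<bar> \<le> \<bar>\<K> (u $ 1)\<bar> * \<bar>\<K> (u $ 2) - \<K> (v $ 2)\<bar> + \<bar>\<K> (v $ 2)\<bar> * \<bar>\<K> (u $ 1) - \<K> (v $ 1)\<bar>"
    unfolding abs_mult[symmetric] by (rule abs_triangle_ineq)
  also have "\<dots> \<le> Kinf * (Q * \<bar>u $ 2 - v $ 2\<bar>) + Kinf * (Q * \<bar>u $ 1 - v $ 1\<bar>)"
    using Kinf_ge_1 by (intro add_mono mult_mono K_le_Kinf K_Lipschitz) auto
  finally show ?thesis by (simp add: algebra_simps)
qed

subsection \<open>The two families of weights\<close>

text \<open>
  Up to the stretching by \<open>1 / \<eta>\<close> in one coordinate, the matrix is a similarity with ratio \<open>norm a\<close>, at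
  least \<open>1/2\<close>. It cannot map points at distance more than \<open>2\<close> from \<open>v\<close> into \<open>square (1/2)\<close>.
\<close>

lemma E_mat_support:
  assumes a: "a \<in> annulus" and \<eta>: "0 < \<eta>" "\<eta> \<le> 1" and v: "v \<in> square (1/2)"
    and x: "E_mat a \<eta> *v (x - v) \<in> square (1/2)"
  shows "x \<in> square (5/2)"
proof -
  define y where "y = x - v"
  let ?A = "a $ 1 * y $ 1 + a $ 2 * y $ 2" and ?B = "a $ 1 * y $ 2 - a $ 2 * y $ 1"
  have "\<bar>?A / \<eta>\<bar> \<le> 1/2" "\<bar>?B\<bar> \<le> 1/2"
    using x by (simp_all add: square_def forall_2 E_mat_mult flip: y_def)
  then have "\<bar>?A\<bar> \<le> 1/2" "\<bar>?B\<bar> \<le> 1/2" using \<eta> by (auto simp: field_simps)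
  then have "?A\<^sup>2 + ?B\<^sup>2 \<le> (1/2)\<^sup>2 + (1/2)\<^sup>2"
    by (intro add_mono) (metis abs_ge_zero power2_abs power_mono)+
  moreover have "?A\<^sup>2 + ?B\<^sup>2 = (norm a)\<^sup>2 * (norm y)\<^sup>2"
    unfolding norm_plane_sq by (simp add: algebra_simps power2_eq_square)
  moreover have "1/4 * (norm y)\<^sup>2 \<le> (norm a)\<^sup>2 * (norm y)\<^sup>2"
    using annulus_norm_sq[OF a] by (intro mult_right_mono) auto
  ultimately have "(norm y)\<^sup>2 \<le> 2\<^sup>2" by (simp add: power2_eq_square)
  then have "norm y \<le> 2" by (rule power2_le_imp_le) simp
  then have "\<bar>y $ i\<bar> \<le> 2" for i using component_le_norm_cart[of y i] by simp
  moreover have "\<bar>v $ i\<bar> \<le> 1/2" for i using v by (simp add: square_def)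
  ultimately have "\<bar>x $ i\<bar> \<le> 5/2" for i
  proof -
    assume "\<And>i. \<bar>y $ i\<bar> \<le> 2" "\<And>i. \<bar>v $ i\<bar> \<le> 1/2"
    from this[of i] show ?thesis unfolding y_def vector_minus_component by linarith
  qed
  then show ?thesis by (simp add: square_def)
qed

lemma E_mat_localized:
  assumes "a \<in> annulus" "0 < \<eta>" "\<eta> \<le> 1" "v \<in> square (1/2)"
  shows "localized (E_mat a \<eta>) v"
proof -
  have "x \<in> square 3" if "x \<in> square (5/2)" for x :: "real^2"
    unfolding square_def
  proof (clarify)
    fix i show "\<bar>x $ i\<bar> \<le> 3" using that[unfolded square_def mem_Collect_eq, rule_format, of i] by simp
  qed
  moreover have "0 < (norm a)\<^sup>2 / \<eta>" using annulus_norm_sq(1)[OF assms(1)] assms(2) by (intro divide_pos_pos) auto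
  ultimately show ?thesis using E_mat_support[OF assms] by (auto simp: localized_def det_E_mat)
qed

lemma det_E_mat_le: "a \<in> annulus \<Longrightarrow> 0 < \<eta> \<Longrightarrow> det (E_mat a \<eta>) \<le> 1 / \<eta>"
  using annulus_norm_sq[of a] by (simp add: det_E_mat divide_right_mono)

lemma mat_entries: "(mat c :: real^2^2) $ i $ j = (if i = j then c else 0)"
  by (simp add: mat_def)

lemma mat_mult: "(mat c :: real^2^2) *v y = c *\<^sub>R y"
  by (simp add: vec_eq_iff matrix_vector_mult_2 mat_entries forall_2)

lemma det_mat_2: "det (mat c :: real^2^2) = c\<^sup>2"
  by (simp add: det_2 mat_entries power2_eq_square)

lemma K_frak_weight:
  "1 / g x * K_frak n (x - v) = weight (mat (1 / h_frak \<omega> n)) v x"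
  by (simp add: weight_def K_frak_def Kprod_def mat_mult det_mat_2 power_divide)

lemma mat_localized:
  assumes h: "0 < h" "h \<le> 1" and v: "v \<in> square (5/2)"
  shows "localized (mat (1 / h)) v"
  unfolding localized_def
proof (intro conjI allI impI)
  show "0 < det (mat (1 / h) :: real^2^2)" using h by (simp add: det_mat_2)
  fix x :: "real^2" assume x: "mat (1 / h) *v (x - v) \<in> square (1/2)"
  show "x \<in> square 3" unfolding square_def
  proof clarify
    fix i
    have "\<bar>(x $ i - v $ i) / h\<bar> \<le> 1/2"
      using x by (simp add: mat_mult square_def)
    then have "\<bar>x $ i - v $ i\<bar> \<le> 1/2" using h by (auto simp: field_simps)
    moreover have "\<bar>v $ i\<bar> \<le> 5/2" using v by (simp add: square_def)
    ultimately show "\<bar>x $ i\<bar> \<le> 3" by linarith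
  qed
qed

text \<open>
  A Lipschitz constant that serves both families of weights. In \<open>weight_osc_direction\<close> the arguments of
  the kernel change by at most \<open>14 * \<delta> / \<eta>\<close> in total, and the determinant by \<open>4 * \<delta> / \<eta>\<close>.
\<close>

definition osc_const :: real where
  "osc_const = (14 * Kinf * Q + 4 * Kinf\<^sup>2) / gl"

lemma osc_const_nonneg: "0 \<le> osc_const"
  using Kinf_ge_1 Q_pos design by (simp add: osc_const_def)

lemma weight_osc_aux:
  assumes E: "localized E v" "localized E' v'"
    and z: "x \<in> square 3 \<Longrightarrow> \<bar>det E * Kprod (E *v (x - v)) - det E' * Kprod (E' *v (x - v'))\<bar> \<le> D"
    and D: "0 \<le> D"
  shows "\<bar>weight E v x - weight E' v' x\<bar> \<le> D / gl"
proof (cases "x \<in> square 3")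
  case True
  then have "gl \<le> g x" using design by blast
  have "\<bar>weight E v x - weight E' v' x\<bar> = \<bar>det E * Kprod (E *v (x - v)) - det E' * Kprod (E' *v (x - v'))\<bar> / g x"
    using \<open>gl \<le> g x\<close> design by (simp add: weight_def flip: diff_divide_distrib)
  also have "\<dots> \<le> D / gl" using z[OF True] \<open>gl \<le> g x\<close> design D by (intro frac_le) auto
  finally show ?thesis .
next
  case False
  then have "weight E v x = 0" "weight E' v' x = 0" using weight_support(2) E by blast+
  then show ?thesis using D design by simp
qed

text \<open>
  The modulus of continuity deteriorates only polynomially as the bandwidth decreases, so that a net of
  polynomial size suffices for all directions.
\<close>

lemma weight_osc_direction:
  assumes a: "a \<in> annulus" and b: "b \<in> annulus" and \<eta>: "0 < \<eta>" "\<eta> \<le> 1" and v: "v \<in> square (1/2)"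
    and \<delta>: "\<forall>i. \<bar>a $ i - b $ i\<bar> \<le> \<delta>"
  shows "\<bar>weight (E_mat a \<eta>) v x - weight (E_mat b \<eta>) v x\<bar> \<le> osc_const * \<delta> / \<eta>\<^sup>2"
proof -
  have \<delta>0: "0 \<le> \<delta>" using \<delta>[rule_format, of 1] by linarith
  have "\<bar>det (E_mat a \<eta>) * Kprod (E_mat a \<eta> *v (x - v)) - det (E_mat b \<eta>) * Kprod (E_mat b \<eta> *v (x - v))\<bar>
     \<le> (14 * Kinf * Q + 4 * Kinf\<^sup>2) * \<delta> / \<eta>\<^sup>2" if x: "x \<in> square 3"
  proof -
    define y where "y = x - v"
    have y: "\<bar>y $ i\<bar> \<le> 7/2" for i
      using x[unfolded square_def mem_Collect_eq, rule_format, of i] v[unfolded square_def mem_Collect_eq, rule_format, of i]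
      unfolding y_def vector_minus_component by linarith
    have prod: "\<bar>(a $ i - b $ i) * y $ j\<bar> \<le> \<delta> * (7/2)" for i j
      unfolding abs_mult using \<delta> y \<delta>0 by (intro mult_mono) auto
    have d1: "\<bar>(E_mat a \<eta> *v y) $ 1 - (E_mat b \<eta> *v y) $ 1\<bar> \<le> 7 * \<delta> / \<eta>"
    proof -
      have "(E_mat a \<eta> *v y) $ 1 - (E_mat b \<eta> *v y) $ 1 = ((a $ 1 - b $ 1) * y $ 1 + (a $ 2 - b $ 2) * y $ 2) / \<eta>"
        by (simp add: E_mat_mult algebra_simps flip: diff_divide_distrib)
      moreover have "\<bar>(a $ 1 - b $ 1) * y $ 1 + (a $ 2 - b $ 2) * y $ 2\<bar> \<le> 7 * \<delta>"
        using prod[of 1 1] prod[of 2 2] by linarith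
      ultimately show ?thesis using \<eta> by (simp add: abs_divide divide_right_mono)
    qed
    have "(E_mat a \<eta> *v y) $ 2 - (E_mat b \<eta> *v y) $ 2 = (a $ 1 - b $ 1) * y $ 2 - (a $ 2 - b $ 2) * y $ 1"
      by (simp add: E_mat_mult algebra_simps)
    then have "\<bar>(E_mat a \<eta> *v y) $ 2 - (E_mat b \<eta> *v y) $ 2\<bar> \<le> 7 * \<delta>"
      using prod[of 1 2] prod[of 2 1] by linarith
    also have "\<dots> \<le> 7 * \<delta> / \<eta>" using \<eta> \<delta>0 by (simp add: field_simps mult_left_le)
    finally have d2: "\<bar>(E_mat a \<eta> *v y) $ 2 - (E_mat b \<eta> *v y) $ 2\<bar> \<le> 7 * \<delta> / \<eta>" .
    have k: "\<bar>Kprod (E_mat a \<eta> *v y) - Kprod (E_mat b \<eta> *v y)\<bar> \<le> Kinf * Q * (14 * \<delta> / \<eta>)"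
      using d1 d2 Kinf_ge_1 Q_pos by (intro order_trans[OF Kprod_Lipschitz] mult_left_mono) auto
    have sq: "\<bar>(a $ i)\<^sup>2 - (b $ i)\<^sup>2\<bar> \<le> \<delta> * 2" for i
    proof -
      have "\<bar>a $ i + b $ i\<bar> \<le> 2" using annulus_component[OF a, of i] annulus_component[OF b, of i] by linarith
      moreover have "(a $ i)\<^sup>2 - (b $ i)\<^sup>2 = (a $ i - b $ i) * (a $ i + b $ i)"
        by (simp add: power2_eq_square algebra_simps)
      ultimately show ?thesis using \<delta> \<delta>0 by (auto simp: abs_mult intro!: mult_mono)
    qed
    have dd: "\<bar>det (E_mat a \<eta>) - det (E_mat b \<eta>)\<bar> \<le> 4 * \<delta> / \<eta>"
    proof -
      have "\<bar>(norm a)\<^sup>2 - (norm b)\<^sup>2\<bar> \<le> 4 * \<delta>" unfolding norm_plane_sq using sq[of 1] sq[of 2] by linarith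
      then show ?thesis using \<eta> by (simp add: det_E_mat abs_divide divide_right_mono flip: diff_divide_distrib)
    qed
    have da: "\<bar>det (E_mat a \<eta>)\<bar> \<le> 1 / \<eta>" using det_E_mat_le[OF a \<eta>(1)] \<eta> by (simp add: det_E_mat)
    have "det (E_mat a \<eta>) * Kprod (E_mat a \<eta> *v y) - det (E_mat b \<eta>) * Kprod (E_mat b \<eta> *v y)
       = det (E_mat a \<eta>) * (Kprod (E_mat a \<eta> *v y) - Kprod (E_mat b \<eta> *v y))
        + (det (E_mat a \<eta>) - det (E_mat b \<eta>)) * Kprod (E_mat b \<eta> *v y)"
      by (simp add: algebra_simps)
    also have "\<bar>\<dots>\<bar> \<le> \<bar>det (E_mat a \<eta>)\<bar> * \<bar>Kprod (E_mat a \<eta> *v y) - Kprod (E_mat b \<eta> *v y)\<bar>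
        + \<bar>det (E_mat a \<eta>) - det (E_mat b \<eta>)\<bar> * \<bar>Kprod (E_mat b \<eta> *v y)\<bar>"
      unfolding abs_mult[symmetric] by (rule abs_triangle_ineq)
    also have "\<dots> \<le> (1 / \<eta>) * (Kinf * Q * (14 * \<delta> / \<eta>)) + (4 * \<delta> / \<eta>) * Kinf\<^sup>2"
      using \<eta> \<delta>0 by (intro add_mono mult_mono da k dd Kprod_le) auto
    also have "(4 * \<delta> / \<eta>) * Kinf\<^sup>2 \<le> (4 * \<delta> / \<eta>\<^sup>2) * Kinf\<^sup>2"
      using \<eta> \<delta>0 by (intro mult_right_mono divide_left_mono) (auto simp: power2_eq_square mult_left_le)
    finally show ?thesis unfolding y_def by (simp add: power2_eq_square algebra_simps add_divide_distrib)
  qed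
  from weight_osc_aux[OF E_mat_localized[OF a \<eta> v] E_mat_localized[OF b \<eta> v] this]
  have "\<bar>weight (E_mat a \<eta>) v x - weight (E_mat b \<eta>) v x\<bar> \<le> (14 * Kinf * Q + 4 * Kinf\<^sup>2) * \<delta> / \<eta>\<^sup>2 / gl"
    using \<delta>0 Kinf_ge_1 Q_pos by simp
  then show ?thesis by (simp add: osc_const_def mult.commute)
qed

lemma weight_osc_centre:
  assumes v: "v \<in> square (5/2)" and v': "v' \<in> square (5/2)" and h: "0 < h" "h \<le> 1"
    and \<delta>: "\<forall>i. \<bar>v $ i - v' $ i\<bar> \<le> \<delta>"
  shows "\<bar>weight (mat (1/h)) v x - weight (mat (1/h)) v' x\<bar> \<le> osc_const * \<delta> / h ^ 3"
proof -
  have \<delta>0: "0 \<le> \<delta>" using \<delta>[rule_format, of 1] by linarith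
  have "\<bar>det (mat (1/h) :: real^2^2) * Kprod (mat (1/h) *v (x - v)) - det (mat (1/h) :: real^2^2) * Kprod (mat (1/h) *v (x - v'))\<bar>
     \<le> (14 * Kinf * Q + 4 * Kinf\<^sup>2) * \<delta> / h ^ 3"
  proof -
    have c: "\<bar>(mat (1/h) *v (x - v)) $ i - (mat (1/h) *v (x - v')) $ i\<bar> \<le> \<delta> / h" for i
    proof -
      have "(mat (1/h) *v (x - v)) $ i - (mat (1/h) *v (x - v')) $ i = (v' $ i - v $ i) / h"
        by (simp add: mat_mult diff_divide_distrib)
      then show ?thesis using \<delta>[rule_format, of i] h by (simp add: abs_divide divide_right_mono abs_minus_commute)
    qed
    have "\<bar>Kprod (mat (1/h) *v (x - v)) - Kprod (mat (1/h) *v (x - v'))\<bar> \<le> Kinf * Q * (14 * \<delta> / h)"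
      using c[of 1] c[of 2] Kinf_ge_1 Q_pos \<delta>0 h
      by (intro order_trans[OF Kprod_Lipschitz] mult_left_mono) (auto intro: order_trans[OF add_mono] simp: field_simps)
    then have "(1/h)\<^sup>2 * \<bar>Kprod (mat (1/h) *v (x - v)) - Kprod (mat (1/h) *v (x - v'))\<bar> \<le> (1/h)\<^sup>2 * (Kinf * Q * (14 * \<delta> / h))"
      by (intro mult_left_mono) auto
    also have "\<dots> = 14 * Kinf * Q * \<delta> / h ^ 3" by (simp add: power2_eq_square power3_eq_cube)
    also have "\<dots> \<le> (14 * Kinf * Q + 4 * Kinf\<^sup>2) * \<delta> / h ^ 3"
      using h \<delta>0 by (intro divide_right_mono mult_right_mono) auto
    finally show ?thesis by (simp add: det_mat_2 abs_mult flip: right_diff_distrib)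
  qed
  from weight_osc_aux[OF mat_localized[OF h v] mat_localized[OF h v'] this]
  have "\<bar>weight (mat (1/h)) v x - weight (mat (1/h)) v' x\<bar> \<le> (14 * Kinf * Q + 4 * Kinf\<^sup>2) * \<delta> / h ^ 3 / gl"
    using \<delta>0 h Kinf_ge_1 Q_pos by simp
  then show ?thesis by (simp add: osc_const_def mult.commute)
qed

subsection \<open>Bias\<close>

text \<open>
  Up to a bias of order \<open>\<eta> powr \<beta>\<close>, the mean of the estimator depends on \<open>a\<close> and \<open>\<eta>\<close> only through
  \<open>across a \<theta>\<close>. Hence the means of all estimators that the selection rule compares nearly agree.
\<close>

lemma population_bias:
  assumes f: "f \<in> holder_class \<beta> L" and a: "a \<in> annulus" and al: "\<bar>along a \<theta>\<bar> \<le> 2"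
    and \<eta>: "0 < \<eta>" "\<eta> \<le> 1" and v: "v \<in> square (1/2)"
  shows "\<bar>(\<integral>x. weight (E_mat a \<eta>) v x * f (x \<bullet> \<theta>) \<partial>G) - (LINT y|lborel. \<K> y * f (v \<bullet> \<theta> + across a \<theta> * y))\<bar>
    \<le> K1\<^sup>2 * L * \<eta> powr \<beta>"
proof -
  note [measurable] = holder_measurable[OF \<beta> f]
  have [measurable]: "(\<lambda>x::real^2. x $ i) \<in> borel_measurable borel" for i
    by (intro borel_measurable_continuous_onI continuous_intros)
  define e where "e = (\<lambda>u::real^2. v + (1 / (norm a)\<^sup>2) *\<^sub>R ((\<eta> * u $ 1) *\<^sub>R a + (u $ 2) *\<^sub>R vector [- a $ 2, a $ 1]))"
  have na: "0 < (a $ 1)\<^sup>2 + (a $ 2)\<^sup>2" using annulus_norm_sq(1)[OF a] unfolding norm_plane_sq by linarith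
  have e: "e (E_mat a \<eta> *v (x - v)) = x" for x
  proof -
    define y where "y = x - v"
    have e1: "\<eta> * (E_mat a \<eta> *v y) $ 1 = a $ 1 * y $ 1 + a $ 2 * y $ 2"
      using \<eta> by (simp add: E_mat_mult)
    have "(\<eta> * (E_mat a \<eta> *v y) $ 1) * a $ 1 + (E_mat a \<eta> *v y) $ 2 * (- a $ 2) = ((a $ 1)\<^sup>2 + (a $ 2)\<^sup>2) * y $ 1"
      "(\<eta> * (E_mat a \<eta> *v y) $ 1) * a $ 2 + (E_mat a \<eta> *v y) $ 2 * a $ 1 = ((a $ 1)\<^sup>2 + (a $ 2)\<^sup>2) * y $ 2"
      unfolding e1 by (simp_all add: E_mat_mult(2) power2_eq_square algebra_simps)
    then have "(1 / (norm a)\<^sup>2) *\<^sub>R ((\<eta> * (E_mat a \<eta> *v y) $ 1) *\<^sub>R a + ((E_mat a \<eta> *v y) $ 2) *\<^sub>R vector [- a $ 2, a $ 1]) = y"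
      using less_imp_neq[OF na] by (simp add: vec_eq_iff forall_2 norm_plane_sq del: sum_power2_eq_zero_iff)
    then show ?thesis by (simp add: e_def y_def)
  qed
  have [measurable]: "e \<in> borel_measurable borel" unfolding e_def by measurable
  have ip: "e u \<bullet> \<theta> = v \<bullet> \<theta> + across a \<theta> * u $ 2 + \<eta> * along a \<theta> * u $ 1" for u
    by (simp add: e_def inner_plane along_def across_def divide_simps na[unfolded norm_plane_sq[symmetric]])
      (simp add: algebra_simps)
  define J where "J = (\<lambda>y. LINT x|lborel. \<K> x * f (v \<bullet> \<theta> + across a \<theta> * y + \<eta> * along a \<theta> * x))"
  have J: "\<bar>J y - f (v \<bullet> \<theta> + across a \<theta> * y)\<bar> \<le> K1 * (L * \<eta> powr \<beta>)" for y
  proof -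
    have "\<bar>J y - f (v \<bullet> \<theta> + across a \<theta> * y)\<bar> \<le> K1 * (L * (\<bar>\<eta> * along a \<theta>\<bar> / 2) powr \<beta>)"
      unfolding J_def by (rule smoothing_bias[OF f])
    also have "\<dots> \<le> K1 * (L * \<eta> powr \<beta>)"
      using al \<eta> L \<beta> K1_ge_1 by (intro mult_left_mono powr_mono2) (auto simp: abs_mult)
    finally show ?thesis .
  qed
  have meas: "(\<lambda>x. f (x \<bullet> \<theta>)) \<in> borel_measurable borel" by measurable
  have "(\<integral>x. weight (E_mat a \<eta>) v x * f (x \<bullet> \<theta>) \<partial>G) = (\<integral>u. Kprod u * f (e u \<bullet> \<theta>) \<partial>lborel)"
    by (rule weight_integral[OF E_mat_localized[OF a \<eta> v] e _ meas]) simp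
  also have "\<dots> = (LINT y|lborel. \<K> y * (LINT x|lborel. \<K> x * f (e (vector [x, y]) \<bullet> \<theta>)))"
    by (rule Kprod_integral(2)[where B=L]) (auto intro: holder_abs_le[OF \<beta> f])
  also have "\<dots> = (LINT y|lborel. \<K> y * J y)"
    unfolding ip J_def by simp
  finally have 1: "(\<integral>x. weight (E_mat a \<eta>) v x * f (x \<bullet> \<theta>) \<partial>G) = (LINT y|lborel. \<K> y * J y)" .
  have [measurable]: "J \<in> borel_measurable borel" unfolding J_def by measurable
  have Jb: "\<bar>J y\<bar> \<le> K1 * (L * \<eta> powr \<beta>) + L" for y
    using J[of y] holder_abs_le[OF \<beta> f, of "v \<bullet> \<theta> + across a \<theta> * y"] by linarith
  have i1: "integrable lborel (\<lambda>y. \<K> y * J y)" by (rule kernel_integrable[OF _ Jb]) simp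
  have i2: "integrable lborel (\<lambda>y. \<K> y * f (v \<bullet> \<theta> + across a \<theta> * y))"
    by (rule kernel_integrable[OF _ holder_abs_le[OF \<beta> f]]) simp
  have "\<bar>(LINT y|lborel. \<K> y * J y) - (LINT y|lborel. \<K> y * f (v \<bullet> \<theta> + across a \<theta> * y))\<bar>
      = \<bar>LINT y|lborel. \<K> y * (J y - f (v \<bullet> \<theta> + across a \<theta> * y))\<bar>"
    using i1 i2 by (simp add: right_diff_distrib)
  also have "\<dots> \<le> (LINT y|lborel. \<bar>\<K> y * (J y - f (v \<bullet> \<theta> + across a \<theta> * y))\<bar>)" by (rule integral_abs_bound)
  also have "\<dots> \<le> (LINT y|lborel. \<bar>\<K> y\<bar> * (K1 * (L * \<eta> powr \<beta>)))"
  proof (rule integral_mono)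
    show "\<bar>\<K> y * (J y - f (v \<bullet> \<theta> + across a \<theta> * y))\<bar> \<le> \<bar>\<K> y\<bar> * (K1 * (L * \<eta> powr \<beta>))" for y
      unfolding abs_mult by (rule mult_left_mono[OF J]) simp
    show "integrable lborel (\<lambda>y. \<bar>\<K> y * (J y - f (v \<bullet> \<theta> + across a \<theta> * y))\<bar>)"
      using i1 i2 by (simp add: right_diff_distrib)
  qed (use K_integrable in simp)
  also have "\<dots> = K1\<^sup>2 * L * \<eta> powr \<beta>" by (simp add: K1_def power2_eq_square)
  finally show ?thesis unfolding 1 .
qed

text \<open>
  At the local bandwidth \<open>f\<close> varies by at most \<open>1\<close>. The resulting error \<open>K1\<^sup>2\<close> is one of the summands of
  \<open>C5\<close>, with which \<open>F_hat_inf\<close> compensates for it.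
\<close>

lemma local_average_bias:
  assumes f: "f \<in> holder_class \<beta> L" and h: "0 < h" "h \<le> 1" and v: "v \<in> square (5/2)" and \<theta>: "\<theta> \<in> sphere 0 1"
    and mod: "\<And>x y. \<bar>x - y\<bar> \<le> h \<Longrightarrow> \<bar>f x - f y\<bar> \<le> 1"
  shows "\<bar>(\<integral>x. weight (mat (1/h)) v x * f (x \<bullet> \<theta>) \<partial>G) - f (v \<bullet> \<theta>)\<bar> \<le> K1\<^sup>2"
    "\<bar>\<integral>x. weight (mat (1/h)) v x * f (x \<bullet> \<theta>) \<partial>G\<bar> \<le> K1\<^sup>2 * L"
proof -
  note [measurable] = holder_measurable[OF \<beta> f]
  define e where "e = (\<lambda>u::real^2. v + h *\<^sub>R u)"
  have e: "e (mat (1/h) *v (x - v)) = x" for x using h by (simp add: e_def mat_mult)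
  have [measurable]: "e \<in> borel_measurable borel" unfolding e_def by measurable
  have eq: "(\<integral>x. weight (mat (1/h)) v x * f (x \<bullet> \<theta>) \<partial>G) = (\<integral>u. Kprod u * f (e u \<bullet> \<theta>) \<partial>lborel)"
    by (rule weight_integral[OF mat_localized[OF h v] e]) simp_all
  show "\<bar>\<integral>x. weight (mat (1/h)) v x * f (x \<bullet> \<theta>) \<partial>G\<bar> \<le> K1\<^sup>2 * L"
    unfolding eq by (rule Kprod_integral(3)) (auto intro: holder_abs_le[OF \<beta> f])
  have i: "integrable lborel (\<lambda>u. Kprod u * f (e u \<bullet> \<theta>))"
    by (rule Kprod_integral(1)[where B=L]) (auto intro: holder_abs_le[OF \<beta> f])
  have i': "integrable lborel Kprod" using Kprod_integral(1)[of "\<lambda>_. 1" 1] by simp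
  have "(\<integral>u. Kprod u * f (e u \<bullet> \<theta>) \<partial>lborel) - f (v \<bullet> \<theta>) = (\<integral>u. Kprod u * (f (e u \<bullet> \<theta>) - f (v \<bullet> \<theta>)) \<partial>lborel)"
    using i i' by (simp add: right_diff_distrib Kprod_integral_1)
  also have "\<bar>\<dots>\<bar> \<le> K1\<^sup>2 * 1"
  proof (rule Kprod_integral(3))
    fix u :: "real^2" assume u: "u \<in> square (1/2)"
    have "\<bar>u $ i\<bar>\<^sup>2 \<le> (1/2)\<^sup>2" for i
      using u by (intro power_mono) (auto simp: square_def)
    then have "(u $ 1)\<^sup>2 + (u $ 2)\<^sup>2 \<le> (1/2)\<^sup>2 + (1/2)\<^sup>2" by (intro add_mono) auto
    then have "(norm u)\<^sup>2 \<le> 1\<^sup>2" unfolding norm_plane_sq by (simp add: power2_eq_square)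
    then have nu: "norm u \<le> 1" by (rule power2_le_imp_le) simp
    have "\<bar>e u \<bullet> \<theta> - v \<bullet> \<theta>\<bar> = h * \<bar>u \<bullet> \<theta>\<bar>" using h by (simp add: e_def inner_simps abs_mult)
    also have "\<dots> \<le> h * 1"
      using Cauchy_Schwarz_ineq2[of u \<theta>] nu \<theta> h by (intro mult_left_mono) auto
    finally show "\<bar>f (e u \<bullet> \<theta>) - f (v \<bullet> \<theta>)\<bar> \<le> 1" by (intro mod) simp
  qed simp
  finally show "\<bar>(\<integral>x. weight (mat (1/h)) v x * f (x \<bullet> \<theta>) \<partial>G) - f (v \<bullet> \<theta>)\<bar> \<le> K1\<^sup>2"
    unfolding eq by simp
qed

end

section \<open>Moments of the noise\<close>

lemma summable_moment_tail:
  fixes c \<Omega> \<omega> :: real and m :: nat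
  assumes "0 < \<Omega>" "0 < \<omega>" "0 \<le> c"
  shows "summable (\<lambda>k. (c + real k + 1) ^ m * exp (- \<Omega> * real k powr \<omega>))"
proof -
  have "(\<lambda>k. (c + real k + 1) powr real m * exp (- \<Omega> * real k powr \<omega>)) \<in> O(\<lambda>k. 1 / real k ^ 2)"
    using assms by real_asymp
  moreover have "(c + real k + 1) powr real m = (c + real k + 1) ^ m" for k
    using assms by (intro powr_realpow) auto
  ultimately have "(\<lambda>k. (c + real k + 1) ^ m * exp (- \<Omega> * real k powr \<omega>)) \<in> O(\<lambda>k. 1 / real k ^ 2)"
    by simp
  then show ?thesis
    by (rule summable_comparison_test_bigo[rotated]) (use inverse_power_summable[of 2, where 'a=real] in \<open>simp add: inverse_eq_divide\<close>)
qed

context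
  fixes \<Upsilon> \<Omega> \<omega> :: real and q :: "real \<Rightarrow> real"
  assumes pos: "0 < \<Upsilon>" "0 < \<Omega>" "0 < \<omega>" and q: "q \<in> noise_densities \<Upsilon> \<Omega> \<omega>"
begin

lemma noise_density_measurable [measurable]: "q \<in> borel_measurable borel"
  and noise_density_nonneg: "0 \<le> q x"
  using q by (auto simp: noise_densities_def prob_density_def)

lemma noise_symmetric: "distr (density lborel (\<lambda>x. ennreal (q x))) borel uminus = density lborel (\<lambda>x. ennreal (q x))"
  using q by (simp add: noise_densities_def symmetric_distribution_def)

lemma noise_prob_space: "prob_space (density lborel (\<lambda>x. ennreal (q x)))"
  using q by (intro prob_spaceI) (simp add: emeasure_density noise_densities_def prob_density_def)

lemma noise_tail:
  assumes "0 \<le> x"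
  shows "emeasure (density lborel (\<lambda>x. ennreal (q x))) {e. x \<le> \<bar>e\<bar>} \<le> ennreal (2 * \<Upsilon> * exp (- \<Omega> * x powr \<omega>))"
proof -
  let ?N = "density lborel (\<lambda>x. ennreal (q x))"
  have up: "emeasure ?N {x..} \<le> ennreal (\<Upsilon> * exp (- \<Omega> * x powr \<omega>))"
    using q assms by (simp add: emeasure_density noise_densities_def tail_class_def)
  have "emeasure ?N {..-x} = emeasure (distr ?N borel uminus) {..-x}" by (simp add: noise_symmetric)
  also have "\<dots> = emeasure ?N (uminus -` {..-x} \<inter> space ?N)" by (rule emeasure_distr) auto
  also have "uminus -` {..-x} \<inter> space ?N = {x..}" by auto
  finally have lo: "emeasure ?N {..-x} = emeasure ?N {x..}" .
  have "{e. x \<le> \<bar>e\<bar>} = {x..} \<union> {..-x}" using assms by (auto simp: le_abs_iff_disj)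
  then have "emeasure ?N {e. x \<le> \<bar>e\<bar>} \<le> emeasure ?N {x..} + emeasure ?N {..-x}"
    by (simp add: emeasure_subadditive)
  also have "\<dots> \<le> ennreal (\<Upsilon> * exp (- \<Omega> * x powr \<omega>)) + ennreal (\<Upsilon> * exp (- \<Omega> * x powr \<omega>))"
    unfolding lo using up by (intro add_mono)
  also have "\<dots> = ennreal (2 * \<Upsilon> * exp (- \<Omega> * x powr \<omega>))"
    using pos by (simp flip: ennreal_plus)
  finally show ?thesis .
qed

text \<open>
  For the floor \<open>k\<close> of \<open>\<bar>e\<bar>\<close> the integrand is at most \<open>(c + k + 1) ^ m\<close>. The sum of these powers over all \<open>k \<le> \<bar>e\<bar>\<close>
  is larger still, and its integral is a series of tail probabilities.
\<close>

lemma noise_moment: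
  assumes c: "0 \<le> c"
  shows "(\<integral>\<^sup>+e. ennreal ((c + \<bar>e\<bar>) ^ m) \<partial>density lborel (\<lambda>x. ennreal (q x)))
    \<le> ennreal (\<Sum>k. (c + real k + 1) ^ m * (2 * \<Upsilon> * exp (- \<Omega> * real k powr \<omega>)))"
proof -
  let ?N = "density lborel (\<lambda>x. ennreal (q x))"
  have "(\<integral>\<^sup>+e. ennreal ((c + \<bar>e\<bar>) ^ m) \<partial>?N) \<le> (\<integral>\<^sup>+e. (\<Sum>k. ennreal ((c + real k + 1) ^ m) * indicator {e. real k \<le> \<bar>e\<bar>} e) \<partial>?N)"
  proof (rule nn_integral_mono)
    fix e :: real
    define k where "k = nat \<lfloor>\<bar>e\<bar>\<rfloor>"
    have k: "real k \<le> \<bar>e\<bar>" "\<bar>e\<bar> \<le> real k + 1" unfolding k_def by linarith+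
    have "ennreal ((c + \<bar>e\<bar>) ^ m) \<le> ennreal ((c + real k + 1) ^ m) * indicator {e. real k \<le> \<bar>e\<bar>} e"
      using k c by (auto intro!: ennreal_leI power_mono)
    also have "\<dots> = (\<Sum>j\<in>{k}. ennreal ((c + real j + 1) ^ m) * indicator {e. real j \<le> \<bar>e\<bar>} e)"
      by (simp only: sum.insert sum.empty finite.emptyI empty_iff not_False_eq_True add_0_right)
    also have "\<dots> \<le> (\<Sum>j. ennreal ((c + real j + 1) ^ m) * indicator {e. real j \<le> \<bar>e\<bar>} e)"
      by (rule sum_le_suminf) auto
    finally show "ennreal ((c + \<bar>e\<bar>) ^ m) \<le> (\<Sum>j. ennreal ((c + real j + 1) ^ m) * indicator {e. real j \<le> \<bar>e\<bar>} e)" .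
  qed
  also have "\<dots> = (\<Sum>k. \<integral>\<^sup>+e. ennreal ((c + real k + 1) ^ m) * indicator {e. real k \<le> \<bar>e\<bar>} e \<partial>?N)"
    by (rule nn_integral_suminf) measurable
  also have "\<dots> = (\<Sum>k. ennreal ((c + real k + 1) ^ m) * emeasure ?N {e. real k \<le> \<bar>e\<bar>})"
    by (intro suminf_cong nn_integral_cmult_indicator) measurable
  also have "\<dots> \<le> (\<Sum>k. ennreal ((c + real k + 1) ^ m) * ennreal (2 * \<Upsilon> * exp (- \<Omega> * real k powr \<omega>)))"
    by (intro suminf_le mult_left_mono noise_tail) auto
  also have "\<dots> = (\<Sum>k. ennreal ((c + real k + 1) ^ m * (2 * \<Upsilon> * exp (- \<Omega> * real k powr \<omega>))))"
    using c pos by (intro suminf_cong) (simp add: ennreal_mult)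
  also have "\<dots> = ennreal (\<Sum>k. (c + real k + 1) ^ m * (2 * \<Upsilon> * exp (- \<Omega> * real k powr \<omega>)))"
  proof (rule suminf_ennreal2)
    show "summable (\<lambda>k. (c + real k + 1) ^ m * (2 * \<Upsilon> * exp (- \<Omega> * real k powr \<omega>)))"
      using summable_mult[OF summable_moment_tail[OF pos(2,3) c, of m], of "2 * \<Upsilon>"] by (simp add: ac_simps)
  qed (use c pos in auto)
  finally show ?thesis .
qed

lemma noise_second_moment:
  "(LINT x|lborel. x\<^sup>2 * q x) = (\<integral>e. e\<^sup>2 \<partial>density lborel (\<lambda>x. ennreal (q x)))"
  "integrable (density lborel (\<lambda>x. ennreal (q x))) (\<lambda>e. e\<^sup>2)"
  "(LINT x|lborel. x\<^sup>2 * q x) \<le> (\<Sum>k. (0 + real k + 1) ^ 2 * (2 * \<Upsilon> * exp (- \<Omega> * real k powr \<omega>)))"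
proof -
  let ?N = "density lborel (\<lambda>x. ennreal (q x))"
  let ?S = "(\<Sum>k. (0 + real k + 1) ^ 2 * (2 * \<Upsilon> * exp (- \<Omega> * real k powr \<omega>)))"
  have n: "(\<integral>\<^sup>+e. ennreal (e\<^sup>2) \<partial>?N) \<le> ennreal ?S"
    using noise_moment[of 0 2] by simp
  have S: "0 \<le> ?S"
    using summable_mult[OF summable_moment_tail[OF pos(2,3), of 0 2], of "2 * \<Upsilon>"] pos
    by (intro suminf_nonneg) (auto simp: ac_simps)
  show i: "integrable ?N (\<lambda>e. e\<^sup>2)"
    using n by (intro integrableI_nonneg) (auto intro: le_less_trans)
  show eq: "(LINT x|lborel. x\<^sup>2 * q x) = (\<integral>e. e\<^sup>2 \<partial>?N)"
    by (subst integral_density) (auto simp: noise_density_nonneg mult.commute)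
  have "ennreal (\<integral>e. e\<^sup>2 \<partial>?N) = (\<integral>\<^sup>+e. ennreal (e\<^sup>2) \<partial>?N)"
    using i by (intro nn_integral_eq_integral[symmetric]) auto
  then have "ennreal (\<integral>e. e\<^sup>2 \<partial>?N) \<le> ennreal ?S" using n by simp
  then show "(LINT x|lborel. x\<^sup>2 * q x) \<le> ?S" using S unfolding eq by (simp add: ennreal_le_iff)
qed

text \<open>
  An odd function of a symmetric variable.
\<close>

lemma noise_truncated_mean:
  "(\<integral>e. (if \<bar>e\<bar> \<le> s then e else 0) \<partial>density lborel (\<lambda>x. ennreal (q x))) = 0"
proof -
  let ?N = "density lborel (\<lambda>x. ennreal (q x))"
  let ?f = "\<lambda>e::real. if \<bar>e\<bar> \<le> s then e else 0"
  have "(\<integral>e. ?f e \<partial>?N) = (\<integral>e. ?f e \<partial>distr ?N borel uminus)" by (simp add: noise_symmetric)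
  also have "\<dots> = (\<integral>e. ?f (- e) \<partial>?N)" by (rule integral_distr) auto
  also have "(\<lambda>e. ?f (- e)) = (\<lambda>e. - ?f e)" by auto
  finally show ?thesis by simp
qed

end

section \<open>Deviations of weighted sums\<close>

context single_index_model
begin

abbreviation "Noise \<equiv> density lborel (\<lambda>x. ennreal (p x))"
abbreviation "Joint \<equiv> G \<Otimes>\<^sub>M Noise"
abbreviation "Draws n \<equiv> Pi\<^sub>M {1..n::nat} (\<lambda>_. Joint)"

lemmas noise_facts = noise_constants(1,2,4) noise

lemma p_measurable [measurable]: "p \<in> borel_measurable borel"
  by (rule noise_density_measurable[OF noise_facts])

sublocale Noise: prob_space Noise by (rule noise_prob_space[OF noise_facts])
sublocale G: prob_space G by (rule prob_space_G)

lemma pair_prob_space_Joint: "pair_prob_space G Noise" ..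

lemma prob_space_Joint: "prob_space Joint"
  using pair_prob_space_Joint by (intro prob_space_pair G.prob_space_axioms Noise.prob_space_axioms)

lemma integral_Joint_prod:
  fixes f :: "real^2 \<Rightarrow> real" and h :: "real \<Rightarrow> real" and A B :: real
  assumes [measurable]: "f \<in> borel_measurable borel" "h \<in> borel_measurable borel"
    and f: "\<And>x. \<bar>f x\<bar> \<le> A" and h: "\<And>x. \<bar>h x\<bar> \<le> B"
  shows "(\<integral>z. f (fst z) * h (snd z) \<partial>Joint) = (\<integral>x. f x \<partial>G) * (\<integral>e. h e \<partial>Noise)"
proof -
  have A: "0 \<le> A" using f[of 0] by linarith
  have "integrable Joint (\<lambda>z. f (fst z) * h (snd z))"
  proof (rule finite_measure.integrable_const_bound[OF prob_space.finite_measure[OF prob_space_Joint], where B="A * B"])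
    show "AE z in Joint. norm (f (fst z) * h (snd z)) \<le> A * B"
      using f h A by (intro AE_I2) (auto simp: abs_mult intro!: mult_mono)
  qed measurable
  from pair_sigma_finite.integral_fst'[OF _ this] show ?thesis
    using pair_prob_space_Joint by (simp add: pair_prob_space_def)
qed

lemma sigma_bound: "(\<integral>e. e\<^sup>2 \<partial>Noise) \<le> (max sigma 1)\<^sup>2"
proof -
  let ?V = "SUP q \<in> noise_densities \<Upsilon> \<Omega> \<omega>. LINT x|lborel. x\<^sup>2 * q x"
  have "bdd_above ((\<lambda>q. LINT x|lborel. x\<^sup>2 * q x) ` noise_densities \<Upsilon> \<Omega> \<omega>)"
    using noise_second_moment(3)[OF noise_constants(1,2,4)] by (intro bdd_aboveI2) blast
  then have 1: "(LINT x|lborel. x\<^sup>2 * p x) \<le> ?V" using noise by (intro cSUP_upper)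
  moreover have "0 \<le> (LINT x|lborel. x\<^sup>2 * p x)"
    by (intro Bochner_Integration.integral_nonneg) (auto simp: noise_density_nonneg[OF noise_facts])
  ultimately have "sigma\<^sup>2 = ?V" and 0: "0 \<le> sigma" by (auto simp: sigma_def)
  moreover have "sigma\<^sup>2 \<le> (max sigma 1)\<^sup>2" using 0 by (intro power_mono) auto
  ultimately show ?thesis using 1 noise_second_moment(1)[OF noise_facts] by simp
qed

abbreviation "deviation_bound c s D \<rho> n \<equiv>
  2 * sqrt c * s * Kinf\<^sup>2 * gl powr (-1/2) * (\<rho> * real n) powr (-1/2) + 13/8 * c * D * Kinf\<^sup>2 * (1 / gl) / (\<rho> * real n)"

text \<open>
  Bernstein's inequality for the products of a weight and a factor \<open>\<psi>\<close> bounded by \<open>D\<close> on the support of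
  the weight. By \<open>\<Lambda>\<close> the passage from the net to all of \<open>S\<close> costs at most \<open>2 * D / n\<close>; as \<open>c\<close> is at
  least \<open>16\<close>, the term with the range absorbs this when its factor \<open>3/2\<close> is raised to \<open>13/8\<close>.
\<close>

lemma uniform_deviation:
  fixes E :: "real^2 \<Rightarrow> real^2^2" and v :: "real^2 \<Rightarrow> real^2" and \<psi> :: "(real^2) \<times> real \<Rightarrow> real"
    and n R m :: nat and c \<rho> D s \<Lambda> :: real
  assumes S: "S \<subseteq> square (real R)" and m: "0 < m" and n: "0 < n"
    and loc: "\<And>a. a \<in> S \<Longrightarrow> localized (E a) (v a)"
    and det: "\<And>a. a \<in> S \<Longrightarrow> det (E a) \<le> 1 / \<rho>" and \<rho>: "0 < \<rho>" "\<rho> \<le> 1"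
    and osc: "\<And>a b x. a \<in> S \<Longrightarrow> b \<in> S \<Longrightarrow> \<forall>i. \<bar>a $ i - b $ i\<bar> \<le> 1 / real m \<Longrightarrow>
       \<bar>weight (E a) (v a) x - weight (E b) (v b) x\<bar> \<le> \<Lambda>" and \<Lambda>: "real n * \<Lambda> \<le> 1"
    and [measurable]: "\<psi> \<in> borel_measurable (borel \<Otimes>\<^sub>M borel)"
    and \<psi>: "\<And>a x e. a \<in> S \<Longrightarrow> weight (E a) (v a) x \<noteq> 0 \<Longrightarrow> \<bar>\<psi> (x, e)\<bar> \<le> D" and D: "0 < D"
    and var: "\<And>a. a \<in> S \<Longrightarrow> (\<integral>z. (weight (E a) (v a) (fst z) * \<psi> z)\<^sup>2 \<partial>Joint) \<le> s\<^sup>2 * (Kinf ^ 4 / (gl * \<rho>))"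
    and s: "0 \<le> s" and c: "16 \<le> c"
  shows "\<exists>Bad\<in>sets (Draws n).
    measure (Draws n) Bad \<le> real ((2 * R * m + 1)\<^sup>2) * (2 * exp (- (3/4 * c))) \<and>
    (\<forall>w\<in>space (Draws n) - Bad. \<forall>a\<in>S.
      \<bar>(\<Sum>i=1..n. weight (E a) (v a) (fst (w i)) * \<psi> (w i)) / real n - (\<integral>z. weight (E a) (v a) (fst z) * \<psi> z \<partial>Joint)\<bar>
      \<le> deviation_bound c s D \<rho> n)"
proof -
  let ?B = "D * Kinf\<^sup>2 / (gl * \<rho>)" and ?V = "s\<^sup>2 * (Kinf ^ 4 / (gl * \<rho>))"
  have glr: "0 < gl * \<rho>" "gl * \<rho> \<le> 1" using design \<rho> by (auto simp: mult_le_one)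
  have B: "0 < ?B" "D \<le> ?B"
  proof -
    show "0 < ?B" using D Kinf_ge_1 glr by simp
    have "D * 1 / 1 \<le> ?B"
      using D Kinf_ge_1 glr by (intro frac_le mult_left_mono) (auto simp: one_le_power)
    then show "D \<le> ?B" by simp
  qed
  have w: "\<bar>weight (E a) (v a) x\<bar> \<le> Kinf\<^sup>2 / (gl * \<rho>)" if "a \<in> S" for a x
  proof -
    have "\<bar>weight (E a) (v a) x\<bar> \<le> det (E a) * Kinf\<^sup>2 / gl" by (rule weight_le[OF loc[OF that]])
    also have "\<dots> \<le> (1 / \<rho>) * Kinf\<^sup>2 / gl"
      using det[OF that] design by (intro divide_right_mono mult_right_mono) auto
    finally show ?thesis by (simp add: mult.commute)
  qed
  have bnd: "\<bar>weight (E a) (v a) (fst z) * \<psi> z\<bar> \<le> ?B" if "a \<in> S" for a z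
  proof (cases "weight (E a) (v a) (fst z) = 0")
    case False
    then have "\<bar>\<psi> z\<bar> \<le> D" using \<psi>[OF that, of "fst z" "snd z"] by simp
    then have "\<bar>weight (E a) (v a) (fst z) * \<psi> z\<bar> \<le> (Kinf\<^sup>2 / (gl * \<rho>)) * D"
      unfolding abs_mult using w[OF that] by (intro mult_mono) (use glr in auto)
    then show ?thesis by (simp add: mult.commute)
  qed (use B in simp)
  have osc': "\<bar>weight (E a) (v a) (fst z) * \<psi> z - weight (E b) (v b) (fst z) * \<psi> z\<bar> \<le> \<Lambda> * D"
    if "a \<in> S" "b \<in> S" "\<forall>i. \<bar>a $ i - b $ i\<bar> \<le> 1 / real m" for a b z
  proof (cases "weight (E a) (v a) (fst z) = 0 \<and> weight (E b) (v b) (fst z) = 0")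
    case True
    have "0 \<le> \<Lambda>" using osc[OF that, of 0] by linarith
    then show ?thesis using True D by simp
  next
    case False
    then have "\<bar>\<psi> z\<bar> \<le> D" using \<psi>[OF that(1), of "fst z" "snd z"] \<psi>[OF that(2), of "fst z" "snd z"] by auto
    then show ?thesis using osc[OF that, of "fst z"] D
      unfolding left_diff_distrib[symmetric] abs_mult by (intro mult_mono) auto
  qed
  have meas: "(\<lambda>z. weight (E a) (v a) (fst z) * \<psi> z) \<in> borel_measurable Joint" for a by measurable
  have c0: "0 < c" using c by simp
  obtain Bad where Bad: "Bad \<in> sets (Draws n)"
    "measure (Draws n) Bad \<le> real ((2 * R * m + 1)\<^sup>2) * (2 * exp (- (3/4 * c)))"
    "\<And>w a. w \<in> space (Draws n) \<Longrightarrow> w \<notin> Bad \<Longrightarrow> a \<in> S \<Longrightarrow>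
      \<bar>(\<Sum>i=1..n. weight (E a) (v a) (fst (w i)) * \<psi> (w i)) - n * (\<integral>z. weight (E a) (v a) (fst z) * \<psi> z \<partial>Joint)\<bar>
        \<le> 2 * sqrt (c * n * ?V) + 3/2 * c * ?B + 2 * n * (\<Lambda> * D)"
  proof (rule prob_space.uniform_bernstein[OF prob_space_Joint S m,
        where \<phi>="\<lambda>a z. weight (E a) (v a) (fst z) * \<psi> z" and n=n and c=c and B="?B" and V="?V" and \<Lambda>="\<Lambda> * D"],
      goal_cases)
    case 1 show ?case by (rule meas)
  next
    case 2 show ?case by (rule bnd[OF 2(2)])
  next
    case 3 show ?case by (rule var[OF 3(2)])
  next
    case 4 show ?case by (rule osc'[OF 4(2,3,5)])
  next
    case 5 show ?case by (rule B(1))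
  next
    case 6 show ?case by (rule c0)
  next
    case (7 Bad)
    show ?case by (rule that[OF 7(2-4)])
  qed
  show ?thesis
  proof (intro bexI[OF _ Bad(1)] conjI Bad(2) ballI)
    fix w a assume "w \<in> space (Draws n) - Bad" and a: "a \<in> S"
    then have w: "w \<in> space (Draws n)" "w \<notin> Bad" by auto
    let ?d = "(\<Sum>i=1..n. weight (E a) (v a) (fst (w i)) * \<psi> (w i))" and ?e = "\<integral>z. weight (E a) (v a) (fst z) * \<psi> z \<partial>Joint"
    have "2 * n * (\<Lambda> * D) \<le> 2 * D" using mult_right_mono[OF \<Lambda>, of D] D by simp
    also have "\<dots> \<le> 1/8 * c * ?B" using c B D by (intro mult_mono) auto
    finally have u: "2 * n * (\<Lambda> * D) \<le> 1/8 * c * ?B" .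
    have "x \<le> y + 3/2 * c * X + u \<Longrightarrow> u \<le> 1/8 * c * X \<Longrightarrow> x \<le> y + 13/8 * c * X" for x y u X :: real
      by linarith
    from this[OF Bad(3)[OF w a] u] have "\<bar>?d - n * ?e\<bar> \<le> 2 * sqrt (c * n * ?V) + 13/8 * c * ?B" .
    then have "\<bar>?d - n * ?e\<bar> / n \<le> (2 * sqrt (c * n * ?V) + 13/8 * c * ?B) / n"
      by (rule divide_right_mono) simp
    moreover have "\<bar>?d - n * ?e\<bar> / n = \<bar>?d / n - ?e\<bar>"
    proof -
      have "\<bar>?d - n * ?e\<bar> / n = \<bar>(?d - n * ?e) / n\<bar>" by (simp add: abs_divide)
      also have "(?d - n * ?e) / n = ?d / n - ?e" using n by (simp add: diff_divide_distrib)
      finally show ?thesis .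
    qed
    moreover have "2 * sqrt (c * n * ?V) / n = 2 * sqrt c * s * Kinf\<^sup>2 * gl powr (-1/2) * (\<rho> * n) powr (-1/2)"
    proof -
      have h: "x powr (-1/2) = 1 / sqrt x" if "0 < x" for x :: real
        using that by (simp add: powr_minus powr_half_sqrt inverse_eq_divide flip: powr_minus_divide)
      have k4: "sqrt (Kinf ^ 4) = Kinf\<^sup>2"
        by (rule real_sqrt_unique) (simp_all flip: power_mult)
      have "sqrt (c * n * ?V) = sqrt c * sqrt n * (s * (Kinf\<^sup>2 / (sqrt gl * sqrt \<rho>)))"
        using s by (simp add: real_sqrt_mult real_sqrt_divide k4)
      then have "2 * sqrt (c * n * ?V) / n = 2 * sqrt c * s * Kinf\<^sup>2 * (1 / sqrt gl) * (1 / sqrt \<rho>) * (sqrt n / n)"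
        by simp
      also have "sqrt n / n = 1 / sqrt n" using n by (simp add: field_simps)
      finally show ?thesis using \<rho> n design by (simp only: h real_sqrt_mult mult_pos_pos of_nat_0_less_iff) simp
    qed
    moreover have "13/8 * c * ?B / n = 13/8 * c * D * Kinf\<^sup>2 * (1 / gl) / (\<rho> * n)" by simp
    ultimately show "\<bar>?d / real n - ?e\<bar> \<le> deviation_bound c s D \<rho> n"
      by (simp only: add_divide_distrib)
  qed
qed

end

section \<open>The constants of the procedure\<close>

context single_index_model
begin

lemma powr_minus_half:
  assumes "0 < (x::real)"
  shows "x powr (-1/2) = 1 / sqrt x" "x powr - (1/2) = 1 / sqrt x"
  using assms by (simp_all add: powr_minus powr_half_sqrt inverse_eq_divide flip: powr_minus_divide)

lemma gl_powr_ge_1: "1 \<le> gl powr (-1/2)"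
proof -
  have "sqrt gl \<le> sqrt 1" using design by (intro real_sqrt_le_mono) auto
  then show ?thesis using design by (simp add: powr_minus_half)
qed

lemma Q_ge: "2/3 \<le> Q"
  using Kinf_ge_1 Kinf_le_Q by linarith

lemma tau_eq: "1 \<le> ln (real n) \<Longrightarrow> tau n = ((4 * r + 1) / \<Omega>) powr (1 / \<omega>) * ln (real n) powr (1 / \<omega>)"
  unfolding tau_def using r noise_constants by (subst powr_mult[symmetric]) auto

lemma tau_base_ge_1: "1 \<le> ln (real n) \<Longrightarrow> 1 \<le> (4 * r + 1) * ln (real n) / \<Omega>"
proof -
  assume n: "1 \<le> ln (real n)"
  have "1 * 1 / 1 \<le> (4 * r + 1) * ln (real n) / \<Omega>"
    using n r noise_constants by (intro frac_le mult_mono) auto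
  then show ?thesis by simp
qed

lemma tau_ge_1: "1 \<le> ln (real n) \<Longrightarrow> 1 \<le> tau n"
  unfolding tau_def using tau_base_ge_1 noise_constants by (intro ge_one_powr_ge_zero) auto

lemma ln_tau_le: "1 \<le> ln (real n) \<Longrightarrow> ln (tau n) \<le> (4 * r + 1) / (\<omega> * \<Omega>) * ln (real n)"
proof -
  assume n: "1 \<le> ln (real n)"
  have p: "0 < (4 * r + 1) * ln (real n) / \<Omega>" using tau_base_ge_1[OF n] by linarith
  have "ln (tau n) = (1 / \<omega>) * ln ((4 * r + 1) * ln (real n) / \<Omega>)"
    unfolding tau_def by (rule ln_powr)
  also have "\<dots> \<le> (1 / \<omega>) * ((4 * r + 1) * ln (real n) / \<Omega>)"
    using p noise_constants ln_bound[OF p] by (intro mult_left_mono) auto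
  finally show ?thesis by simp
qed

lemma ln_sq_mult: "1 \<le> ln (real n) \<Longrightarrow> 0 < A \<Longrightarrow> ln ((real n)\<^sup>2 * A) = 2 * ln (real n) + ln A"
proof -
  assume n: "1 \<le> ln (real n)" and A: "0 < A"
  have "0 < n" using n by (cases n) auto
  then show ?thesis using A by (simp add: ln_mult ln_realpow)
qed

text \<open>
  \<open>A12\<close> and \<open>A34\<close> are the factors inside the logarithms of \<open>c1\<close>, \<open>c2\<close> and of \<open>c3\<close>, \<open>c4\<close> that do not depend
  on \<open>n\<close>. They are at least \<open>1\<close> because the kernel has integral \<open>1\<close>, which bounds \<open>Q\<close> from below.
\<close>

definition A12 :: real where "A12 = 16 * gl powr (-1/2) * (12 * Q + sqrt 2)"
definition A34 :: real where "A34 = 5 * Q * gl powr (-1/2)"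

lemma A_ge_1: "1 \<le> A12" "1 \<le> A34"
proof -
  have "16 * 1 * (12 * (2/3) + 0) \<le> A12"
    unfolding A12_def using gl_powr_ge_1 Q_ge by (intro mult_mono add_mono) auto
  then show "1 \<le> A12" by simp
  have "5 * (2/3) * 1 \<le> A34"
    unfolding A34_def using gl_powr_ge_1 Q_ge by (intro mult_mono) auto
  then show "1 \<le> A34" by simp
qed

lemma c_eqs:
  assumes n: "1 \<le> ln (real n)"
  shows "c1 n = 730 * (2 * ln (real n) + ln A12) + 8 * r * ln (real n) + 394"
    "c2 n = 730 * (2 * ln (real n) + (ln (tau n) + ln A12)) + 8 * r * ln (real n) + 394"
    "c3 n = 365 * (2 * ln (real n) + ln A34) + 8 * r * ln (real n) + 197"
    "c4 n = 365 * (2 * ln (real n) + (ln (tau n) + ln A34)) + 8 * r * ln (real n) + 197"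
proof -
  have t: "0 < tau n" using tau_ge_1[OF n] by linarith
  have A: "0 < A12" "0 < A34" using A_ge_1 by linarith+
  show "c1 n = 730 * (2 * ln (real n) + ln A12) + 8 * r * ln (real n) + 394"
    using ln_sq_mult[OF n A(1)] by (simp add: c1_def A12_def ac_simps)
  show "c3 n = 365 * (2 * ln (real n) + ln A34) + 8 * r * ln (real n) + 197"
    using ln_sq_mult[OF n A(2)] by (simp add: c3_def A34_def ac_simps)
  have "ln ((real n)\<^sup>2 * (tau n * A12)) = 2 * ln (real n) + (ln (tau n) + ln A12)"
    using ln_sq_mult[OF n, of "tau n * A12"] t A by (simp add: ln_mult)
  then show "c2 n = 730 * (2 * ln (real n) + (ln (tau n) + ln A12)) + 8 * r * ln (real n) + 394"
    by (simp add: c2_def A12_def ac_simps)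
  have "ln ((real n)\<^sup>2 * (tau n * A34)) = 2 * ln (real n) + (ln (tau n) + ln A34)"
    using ln_sq_mult[OF n, of "tau n * A34"] t A by (simp add: ln_mult)
  then show "c4 n = 365 * (2 * ln (real n) + (ln (tau n) + ln A34)) + 8 * r * ln (real n) + 197"
    by (simp add: c4_def A34_def ac_simps)
qed

text \<open>
  The multiple of \<open>ln n\<close> decides which power of \<open>n\<close> is left for the size of the nets, and the term with
  \<open>r\<close> decides the final power of the probability.
\<close>

lemma c_ge:
  assumes n: "1 \<le> ln (real n)"
  shows "700 * ln (real n) + 8 * r * ln (real n) \<le> c1 n" "700 * ln (real n) + 8 * r * ln (real n) \<le> c2 n"
    "700 * ln (real n) + 8 * r * ln (real n) \<le> c3 n" "700 * ln (real n) + 8 * r * ln (real n) \<le> c4 n"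
proof -
  have l: "0 \<le> ln A12" "0 \<le> ln A34" "0 \<le> ln (tau n)"
    using A_ge_1 tau_ge_1[OF n] by (auto simp: ln_ge_zero)
  have aux: "700 * l + x \<le> 730 * (2 * l + a) + x + 394" "700 * l + x \<le> 365 * (2 * l + a) + x + 197"
    if "0 \<le> a" "1 \<le> l" for l x a :: real
    using that by (simp_all add: distrib_left)
  have l': "0 \<le> ln (tau n) + ln A12" "0 \<le> ln (tau n) + ln A34" using l by auto
  show "700 * ln (real n) + 8 * r * ln (real n) \<le> c1 n" unfolding c_eqs[OF n] by (rule aux(1)[OF l(1) n])
  show "700 * ln (real n) + 8 * r * ln (real n) \<le> c2 n" unfolding c_eqs[OF n] by (rule aux(1)[OF l'(1) n])
  show "700 * ln (real n) + 8 * r * ln (real n) \<le> c3 n" unfolding c_eqs[OF n] by (rule aux(2)[OF l(2) n])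
  show "700 * ln (real n) + 8 * r * ln (real n) \<le> c4 n" unfolding c_eqs[OF n] by (rule aux(2)[OF l'(2) n])
qed

lemma c_ge_16:
  assumes n: "1 \<le> ln (real n)"
  shows "16 \<le> c1 n" "16 \<le> c2 n" "16 \<le> c3 n" "16 \<le> c4 n"
proof -
  have "0 \<le> 8 * r * ln (real n)" using n r by simp
  then have "16 \<le> 700 * ln (real n) + 8 * r * ln (real n)" using n by linarith
  then show "16 \<le> c1 n" "16 \<le> c2 n" "16 \<le> c3 n" "16 \<le> c4 n" using c_ge[OF n] by (meson order_trans)+
qed

definition c_coef :: real where
  "c_coef = 730 * (2 + (4 * r + 1) / (\<omega> * \<Omega>) + ln A12 + ln A34) + 8 * r + 394"

lemma c_coef_ge_0: "0 \<le> c_coef"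
  unfolding c_coef_def using A_ge_1 r noise_constants by (intro add_nonneg_nonneg mult_nonneg_nonneg) auto

lemma c_le:
  assumes n: "1 \<le> ln (real n)"
  shows "c1 n \<le> c_coef * ln (real n)" "c2 n \<le> c_coef * ln (real n)"
    "c3 n \<le> c_coef * ln (real n)" "c4 n \<le> c_coef * ln (real n)"
proof -
  let ?l = "ln (real n)"
  define T where "T = (4 * r + 1) / (\<omega> * \<Omega>)"
  have T: "0 \<le> T" using r noise_constants by (simp add: T_def)
  have t: "ln (tau n) \<le> T * ?l" "0 \<le> ln (tau n)"
    using ln_tau_le[OF n] tau_ge_1[OF n] by (auto simp: T_def)
  have Tl: "0 \<le> T * ?l" using T n by simp
  have A: "ln A12 \<le> ln A12 * ?l" "ln A34 \<le> ln A34 * ?l" "0 \<le> ln A12" "0 \<le> ln A34"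
    using A_ge_1 n mult_left_mono[OF n, of "ln A12"] mult_left_mono[OF n, of "ln A34"] by auto
  have e: "c_coef * ?l = 1460 * ?l + 730 * (T * ?l) + 730 * (ln A12 * ?l) + 730 * (ln A34 * ?l) + 8 * r * ?l + 394 * ?l"
    by (simp add: c_coef_def T_def algebra_simps)
  have aux: "730 * (2 * l + a) + x + 394 \<le> 1460 * l + 730 * t' + 730 * a' + 730 * b' + x + 394 * l"
    "730 * (2 * l + (t + a)) + x + 394 \<le> 1460 * l + 730 * t' + 730 * a' + 730 * b' + x + 394 * l"
    "365 * (2 * l + b) + x + 197 \<le> 1460 * l + 730 * t' + 730 * a' + 730 * b' + x + 394 * l"
    "365 * (2 * l + (t + b)) + x + 197 \<le> 1460 * l + 730 * t' + 730 * a' + 730 * b' + x + 394 * l"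
    if "1 \<le> l" "t \<le> t'" "0 \<le> t" "a \<le> a'" "b \<le> b'" "0 \<le> a" "0 \<le> b" for l t t' a a' b b' x :: real
    using that by (simp_all add: distrib_left)
  note aux = aux[OF n t A]
  show "c1 n \<le> c_coef * ln (real n)" unfolding c_eqs[OF n] e by (rule aux(1))
  show "c2 n \<le> c_coef * ln (real n)" unfolding c_eqs[OF n] e by (rule aux(2))
  show "c3 n \<le> c_coef * ln (real n)" unfolding c_eqs[OF n] e by (rule aux(3))
  show "c4 n \<le> c_coef * ln (real n)" unfolding c_eqs[OF n] e by (rule aux(4))
qed

lemma sqrt_c_le:
  assumes n: "1 \<le> ln (real n)"
  shows "sqrt (c1 n) \<le> sqrt c_coef * sqrt (ln (real n))" "sqrt (c2 n) \<le> sqrt c_coef * sqrt (ln (real n))"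
    "sqrt (c3 n) \<le> sqrt c_coef * sqrt (ln (real n))" "sqrt (c4 n) \<le> sqrt c_coef * sqrt (ln (real n))"
  using c_le[OF n] by (simp_all flip: real_sqrt_mult)

lemma h_frak_sq: "1 \<le> ln (real n) \<Longrightarrow> (h_frak \<omega> n)\<^sup>2 = ln (real n) powr (1 + 1 / \<omega>) / real n"
  by (simp add: h_frak_def)

lemma n_h_frak_sq:
  assumes n: "1 \<le> ln (real n)"
  shows "real n * (h_frak \<omega> n)\<^sup>2 = ln (real n) powr (1 + 1 / \<omega>)"
proof -
  have "0 < n" using n by (cases n) auto
  then show ?thesis using h_frak_sq[OF n] by simp
qed

lemma n_h_frak_powr:
  assumes n: "1 \<le> ln (real n)"
  shows "(real n * (h_frak \<omega> n)\<^sup>2) powr (-1/2) = ln (real n) powr (-1/2 - 1/(2*\<omega>))"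
proof -
  have "(1 + 1/\<omega>) * (-1/2) = -1/2 - 1/(2*\<omega>)" using noise_constants by (simp add: field_simps)
  then show ?thesis unfolding n_h_frak_sq[OF n] by (simp only: powr_powr)
qed

text \<open>
  Powers of the logarithm are counted. Both terms of \<open>C1\<close> and of \<open>C2\<close> have order at most \<open>1/2\<close>. After
  multiplication by \<open>(n * h_frak\<^sup>2) powr (-1/2)\<close> the terms of \<open>C3\<close> and \<open>C4\<close> with the square root have order
  \<open>- 1/(2*\<omega>)\<close>; the others have order \<open>- 1/\<omega>\<close> and, because \<open>tau n\<close> has order \<open>1/\<omega>\<close>, order \<open>0\<close>.
\<close>

lemma C_le:
  obtains C where "0 < C"
    "\<And>n. 1 \<le> ln (real n) \<Longrightarrow> C1 n \<le> C * sqrt (ln (real n))"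
    "\<And>n. 1 \<le> ln (real n) \<Longrightarrow> C2 n \<le> C * sqrt (ln (real n))"
    "\<And>n. 1 \<le> ln (real n) \<Longrightarrow> (real n * (h_frak \<omega> n)\<^sup>2) powr (-1/2) * C3 n \<le> C * ln (real n) powr (- (1/(2*\<omega>)))"
    "\<And>n. 1 \<le> ln (real n) \<Longrightarrow> (real n * (h_frak \<omega> n)\<^sup>2) powr (-1/2) * C4 n \<le> C"
proof -
  define P where "P = 2 * sqrt 2 * max sigma 1 * gl powr (-1/2) * Kinf\<^sup>2 * sqrt c_coef"
  define P' where "P' = 2 * sqrt 2 * gl powr (-1/2) * Kinf\<^sup>2 * sqrt c_coef"
  define T where "T = ((4 * r + 1) / \<Omega>) powr (1 / \<omega>)"
  define W where "W = 8 / 3 * c_coef * (1 / gl) * Kinf\<^sup>2"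
  have nn: "0 \<le> P" "0 \<le> P'" "0 \<le> T" "0 \<le> W"
    using c_coef_ge_0 design by (auto simp: P_def P'_def T_def W_def)
  have g0: "0 \<le> gl powr (-1/2)" by simp
  define C where "C = P + P' + W + W * T + 1"
  have WT: "0 \<le> W * T" using nn by simp
  have C: "0 < C" "P' + W \<le> C" "P + W * T \<le> C" unfolding C_def using nn WT by (smt (verit))+
  show ?thesis
  proof (rule that[OF C(1)])
    fix n :: nat assume n: "1 \<le> ln (real n)"
    let ?l = "ln (real n)"
    have l0: "0 < ?l" using n by linarith
    have sq: "?l * ?l powr (-1/2) = sqrt ?l" using l0 by (simp add: powr_minus_half real_div_sqrt)
    have p1: "2 * sqrt 2 * gl powr (-1/2) * Kinf\<^sup>2 * sqrt (c1 n) \<le> P' * sqrt ?l"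
      "2 * sqrt 2 * gl powr (-1/2) * Kinf\<^sup>2 * sqrt (c3 n) \<le> P' * sqrt ?l"
      using mult_left_mono[OF sqrt_c_le(1)[OF n], of "2 * sqrt 2 * gl powr (-1/2) * Kinf\<^sup>2"]
        mult_left_mono[OF sqrt_c_le(3)[OF n], of "2 * sqrt 2 * gl powr (-1/2) * Kinf\<^sup>2"]
      by (simp_all add: P'_def mult.assoc)
    have p2: "2 * sqrt 2 * max sigma 1 * gl powr (-1/2) * Kinf\<^sup>2 * sqrt (c2 n) \<le> P * sqrt ?l"
      "2 * sqrt 2 * max sigma 1 * gl powr (-1/2) * Kinf\<^sup>2 * sqrt (c4 n) \<le> P * sqrt ?l"
      using mult_left_mono[OF sqrt_c_le(2)[OF n], of "2 * sqrt 2 * max sigma 1 * gl powr (-1/2) * Kinf\<^sup>2"]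
        mult_left_mono[OF sqrt_c_le(4)[OF n], of "2 * sqrt 2 * max sigma 1 * gl powr (-1/2) * Kinf\<^sup>2"]
      by (simp_all add: P_def mult.assoc)
    have W1: "8 / 3 * c * (1 / gl) * Kinf\<^sup>2 \<le> W * ?l" if "c \<le> c_coef * ?l" for c
    proof -
      have "8/3 * (1/gl) * Kinf\<^sup>2 * c \<le> 8/3 * (1/gl) * Kinf\<^sup>2 * (c_coef * ?l)"
        using that design by (intro mult_left_mono) auto
      then show ?thesis by (simp add: W_def ac_simps)
    qed
    have "8 / 3 * c1 n * ?l powr (- (2 + \<omega>) / (2 * \<omega>)) * (1 / gl) * Kinf\<^sup>2
        = (8 / 3 * c1 n * (1 / gl) * Kinf\<^sup>2) * ?l powr (- (2 + \<omega>) / (2 * \<omega>))" by simp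
    also have "\<dots> \<le> (W * ?l) * ?l powr (-1/2)"
    proof (rule mult_mono[OF W1[OF c_le(1)[OF n]] powr_mono[OF _ n]])
      show "- (2 + \<omega>) / (2 * \<omega>) \<le> -1/2" using noise_constants by (simp add: field_simps)
    qed (use nn l0 in auto)
    also have "\<dots> = W * sqrt ?l" using sq by simp
    finally have "C1 n \<le> (P' + W) * sqrt ?l" unfolding C1_def using p1(1) by (simp add: distrib_right)
    also have "\<dots> \<le> C * sqrt ?l" using C l0 by (intro mult_right_mono) auto
    finally show "C1 n \<le> C * sqrt ?l" .
    have "8 / 3 * c2 n * ?l powr (-1/2) * (1 / gl) * Kinf\<^sup>2 * ((4 * r + 1) / \<Omega>) powr (1 / \<omega>)
       = (8 / 3 * c2 n * (1 / gl) * Kinf\<^sup>2) * (?l powr (-1/2) * T)" by (simp add: T_def)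
    also have "\<dots> \<le> (W * ?l) * (?l powr (-1/2) * T)"
      using nn by (intro mult_right_mono W1 c_le n) auto
    also have "\<dots> = W * T * sqrt ?l" using sq by simp
    finally have "C2 n \<le> (P + W * T) * sqrt ?l" unfolding C2_def using p2(1) by (simp add: distrib_right)
    also have "\<dots> \<le> C * sqrt ?l" using C l0 by (intro mult_right_mono) auto
    finally show "C2 n \<le> C * sqrt ?l" .
    let ?s = "(real n * (h_frak \<omega> n)\<^sup>2) powr (-1/2)"
    have s: "?s = ?l powr (-1/2 - 1/(2*\<omega>))" by (rule n_h_frak_powr[OF n])
    have s1: "?s * sqrt ?l = ?l powr (- (1/(2*\<omega>)))"
    proof -
      have "sqrt ?l = ?l powr (1/2)" using l0 by (simp add: powr_half_sqrt)
      then show ?thesis unfolding s by (simp flip: powr_add)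
    qed
    have s2: "?s * (?l * ?s) = ?l powr (- (1/\<omega>))"
    proof -
      have "?s * (?l * ?s) = ?l powr 1 * (?l powr (-1/2 - 1/(2*\<omega>)) * ?l powr (-1/2 - 1/(2*\<omega>)))"
        unfolding s using l0 by simp
      also have "\<dots> = ?l powr (1 + ((-1/2 - 1/(2*\<omega>)) + (-1/2 - 1/(2*\<omega>))))" by (simp only: powr_add)
      also have "1 + ((-1/2 - 1/(2*\<omega>)) + (-1/2 - 1/(2*\<omega>))) = - (1/\<omega>)" by (simp add: field_simps)
      finally show ?thesis .
    qed
    have s2': "?l powr (- (1/\<omega>)) \<le> ?l powr (- (1/(2*\<omega>)))"
      using n noise_constants by (intro powr_mono) (auto simp: field_simps)
    have s1': "?l powr (- (1/(2*\<omega>))) \<le> 1"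
      using n noise_constants powr_mono[of "- (1/(2*\<omega>))" 0 ?l] by auto
    have "?s * C3 n = ?s * (2 * sqrt 2 * gl powr (-1/2) * Kinf\<^sup>2 * sqrt (c3 n)) + (8/3 * c3 n * (1/gl) * Kinf\<^sup>2) * (?s * ?s)"
      unfolding C3_def by (simp add: algebra_simps)
    also have "\<dots> \<le> ?s * (P' * sqrt ?l) + (W * ?l) * (?s * ?s)"
      by (intro add_mono mult_left_mono mult_right_mono W1 c_le n p1) auto
    also have "\<dots> = P' * (?s * sqrt ?l) + W * (?s * (?l * ?s))" by (simp add: ac_simps)
    also have "\<dots> \<le> P' * ?l powr (- (1/(2*\<omega>))) + W * ?l powr (- (1/(2*\<omega>)))"
      unfolding s1 s2 using s2' nn by (intro add_mono mult_left_mono) auto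
    also have "\<dots> \<le> C * ?l powr (- (1/(2*\<omega>)))"
      unfolding distrib_right[symmetric] using C by (intro mult_right_mono) auto
    finally show "?s * C3 n \<le> C * ?l powr (- (1/(2*\<omega>)))" .
    have t: "tau n * ?l powr (- (1/\<omega>)) = T"
      using tau_eq[OF n] l0 by (simp add: T_def powr_minus field_simps)
    have "?s * C4 n = ?s * (2 * sqrt 2 * max sigma 1 * gl powr (-1/2) * Kinf\<^sup>2 * sqrt (c4 n)) + (8/3 * c4 n * (1/gl) * Kinf\<^sup>2) * (tau n * (?s * ?s))"
      unfolding C4_def by (simp add: algebra_simps)
    also have "\<dots> \<le> ?s * (P * sqrt ?l) + (W * ?l) * (tau n * (?s * ?s))"
      using tau_ge_1[OF n] by (intro add_mono mult_left_mono mult_right_mono W1 c_le n p2) auto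
    also have "\<dots> = P * (?s * sqrt ?l) + W * (tau n * (?s * (?l * ?s)))" by (simp add: ac_simps)
    also have "\<dots> = P * ?l powr (- (1/(2*\<omega>))) + W * T" unfolding s1 s2 t by simp
    also have "\<dots> \<le> P * 1 + W * T" using s1' nn by (intro add_mono mult_left_mono) auto
    also have "\<dots> \<le> C" using C by simp
    finally show "?s * C4 n \<le> C" .
  qed
qed

lemma C3_small:
  assumes "0 < \<epsilon>"
  shows "\<forall>\<^sub>F n in sequentially. (real n * (h_frak \<omega> n)\<^sup>2) powr (-1/2) * C3 n \<le> \<epsilon>"
proof -
  obtain C where C: "0 < C"
    "\<And>n. 1 \<le> ln (real n) \<Longrightarrow> (real n * (h_frak \<omega> n)\<^sup>2) powr (-1/2) * C3 n \<le> C * ln (real n) powr (- (1/(2*\<omega>)))"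
    using C_le by metis
  have "((\<lambda>n. C * ln (real n) powr (- (1/(2*\<omega>)))) \<longlongrightarrow> 0) sequentially"
    using noise_constants by real_asymp
  then have "\<forall>\<^sub>F n in sequentially. C * ln (real n) powr (- (1/(2*\<omega>))) < \<epsilon>"
    using assms by (rule order_tendstoD)
  moreover have "\<forall>\<^sub>F n in sequentially. 1 \<le> ln (real n)" by real_asymp
  ultimately show ?thesis
    by eventually_elim (use C(2) in \<open>force intro: less_imp_le order_trans\<close>)
qed

text \<open>
  At \<open>n = 1\<close> the rate vanishes, so this sample size has to be excluded. The condition in \<open>n1\<close> does so:
  it fails for two observations. The set in \<open>n1\<close> is not empty, since \<open>C3_small\<close> holds eventually.
\<close>

lemma n1_ge_2: "2 \<le> n1"
proof -
  let ?P = "\<lambda>m. 1 \<le> m \<and> (\<forall>n\<ge>m. (real n * (h_frak \<omega> n)\<^sup>2) powr (-1/2) * C3 n \<le> 1 / 2)"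
  obtain m where "\<forall>n\<ge>m. (real n * (h_frak \<omega> n)\<^sup>2) powr (-1/2) * C3 n \<le> 1 / 2"
    using C3_small[of "1/2"] by (auto simp: eventually_sequentially)
  then have "?P (max 1 m)" by auto
  then have "{m. ?P m} \<noteq> {}" by blast
  from Inf_nat_def1[OF this] have n1: "?P n1" unfolding n1_def by blast
  have "\<not> ?P 1"
  proof
    assume "?P 1"
    then have "\<forall>n\<ge>1. (real n * (h_frak \<omega> n)\<^sup>2) powr (-1/2) * C3 n \<le> 1 / 2" by blast
    from this[rule_format, of 2] have le: "(real 2 * (h_frak \<omega> 2)\<^sup>2) powr (-1/2) * C3 2 \<le> 1 / 2" by simp
    let ?s = "(real 2 * (h_frak \<omega> 2)\<^sup>2) powr (-1/2)"
    have l2: "0 < ln (2::real)" "ln (2::real) \<le> 1" using ln_2_less_1 by auto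
    have x: "0 < real 2 * (h_frak \<omega> 2)\<^sup>2" "real 2 * (h_frak \<omega> 2)\<^sup>2 \<le> 1"
      using l2 noise_constants by (auto simp: h_frak_def powr_le1)
    then have s: "1 \<le> ?s"
      by (simp add: powr_minus_half)
    have c3: "197 \<le> c3 2"
    proof -
      have "2\<^sup>2 * 1 \<le> (real 2)\<^sup>2 * A34" using A_ge_1 by (intro mult_mono) auto
      then have "0 \<le> ln ((real 2)\<^sup>2 * A34)" by simp
      then have "0 \<le> ln (5 * (real 2)\<^sup>2 * Q * gl powr (-1/2))" by (simp add: A34_def ac_simps)
      moreover have "0 \<le> 8 * r * ln (real 2)" using r l2 by simp
      ultimately show ?thesis unfolding c3_def by linarith
    qed
    have "1 * 1 * 1 * 1 \<le> 2 * sqrt 2 * gl powr (-1/2) * Kinf\<^sup>2 * sqrt (c3 2)"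
    proof (intro mult_mono)
      show "1 \<le> 2 * sqrt 2" using real_sqrt_ge_one[of 2] by linarith
      show "1 \<le> Kinf\<^sup>2" using Kinf_ge_1 by (simp add: one_le_power)
      show "1 \<le> sqrt (c3 2)" using c3 by simp
    qed (use gl_powr_ge_1 in auto)
    moreover have "0 \<le> 8 / 3 * (1 / gl) * Kinf\<^sup>2 * c3 2 * ?s" using c3 design by simp
    ultimately have "1 \<le> C3 2" unfolding C3_def by simp
    then have "1 * 1 \<le> ?s * C3 2" using s by (intro mult_mono) auto
    then show False using le by simp
  qed
  then show ?thesis using n1 by (metis One_nat_def Suc_1 le_antisym not_less_eq_eq)
qed

subsection \<open>The thresholds dominate the deviations\<close>

lemma h_min_pos: "1 \<le> ln (real n) \<Longrightarrow> 0 < h_min \<omega> n"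
proof -
  assume n: "1 \<le> ln (real n)"
  then have "0 < n" by (cases n) auto
  moreover have "ln (real n) \<noteq> 0" using n by linarith
  ultimately show ?thesis by (simp add: h_min_def)
qed

lemma bandwidth_powr_le:
  assumes n: "1 \<le> ln (real n)" and \<eta>: "h_min \<omega> n / 2 \<le> \<eta>"
  shows "(\<eta> * real n) powr (-1/2) \<le> 3/2 * ln (real n) powr (- (2 + \<omega>) / (2 * \<omega>))"
proof -
  let ?l = "ln (real n)"
  have n0: "0 < real n" using n by (cases n) auto
  have l0: "0 < ?l" using n by linarith
  have "h_min \<omega> n / 2 * real n = ?l powr (1 + 2/\<omega>) / 2" using n0 by (simp add: h_min_def)
  then have 1: "?l powr (1 + 2/\<omega>) / 2 \<le> \<eta> * real n" using mult_right_mono[OF \<eta>, of "real n"] by simp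
  have pos: "0 < ?l powr (1 + 2/\<omega>) / 2" using l0 by simp
  have "(\<eta> * real n) powr (-1/2) \<le> (?l powr (1 + 2/\<omega>) / 2) powr (-1/2)"
    by (rule powr_mono2') (use 1 pos in auto)
  also have "\<dots> = (?l powr (1 + 2/\<omega>)) powr (-1/2) * sqrt 2"
    using pos by (simp add: powr_minus_half real_sqrt_divide)
  also have "(?l powr (1 + 2/\<omega>)) powr (-1/2) = ?l powr (- (2 + \<omega>) / (2 * \<omega>))"
  proof -
    have "(1 + 2/\<omega>) * (-1/2) = - (2 + \<omega>) / (2 * \<omega>)" using noise_constants by (simp add: field_simps)
    then show ?thesis by (simp only: powr_powr)
  qed
  also have "\<dots> * sqrt 2 \<le> \<dots> * (3/2)"
    by (intro mult_left_mono real_le_lsqrt) (auto simp: power2_eq_square)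
  finally show ?thesis by (simp add: mult.commute)
qed

lemma powr_half_sq: "0 < x \<Longrightarrow> (x::real) powr (-1/2) * x powr (-1/2) = 1 / x"
  by (simp add: powr_minus_half)

lemma two_le_2sqrt2: "2 \<le> 2 * sqrt 2"
  using real_sqrt_ge_one[of 2] by linarith

lemma le_of_sums: "x \<le> y \<Longrightarrow> u \<le> v \<Longrightarrow> A = x + u \<Longrightarrow> B = y + v \<Longrightarrow> A \<le> (B::real)"
  by linarith

text \<open>
  In these four lemmas the left-hand side is the bound of \<open>uniform_deviation\<close>. The leading terms compare by
  \<open>2 \<le> 2 * sqrt 2\<close>. In the other term of \<open>C1\<close> and \<open>C2\<close> one factor \<open>(\<eta> * n) powr (-1/2)\<close> is
  bounded by its value at the smallest bandwidth, which costs a factor \<open>3/2\<close>, and \<open>13/8 * 3/2 \<le> 8/3\<close>. For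
  \<open>C2\<close> this factor is multiplied by \<open>tau n\<close>, which leaves the power \<open>-1/2\<close> of the logarithm.
\<close>

lemma threshold_C1:
  assumes n: "1 \<le> ln (real n)" and \<eta>: "h_min \<omega> n / 2 \<le> \<eta>" and D: "0 \<le> D"
  shows "deviation_bound (c1 n) D D \<eta> n
    \<le> D * C1 n * (\<eta> * n) powr (-1/2)"
proof -
  let ?e = "(\<eta> * real n) powr (-1/2)" and ?l = "ln (real n) powr (- (2 + \<omega>) / (2 * \<omega>))"
  have n0: "0 < real n" using n by (cases n) auto
  have "0 < \<eta> * real n" using \<eta> h_min_pos[OF n] n0 by simp
  then have e2: "?e * ?e = 1 / (\<eta> * real n)" by (rule powr_half_sq)
  have c: "0 \<le> c1 n" using c_ge_16[OF n] by linarith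
  have "13/8 * ?e \<le> 8/3 * ?l" using bandwidth_powr_le[OF n \<eta>] powr_ge_zero[of "ln (real n)" "- (2 + \<omega>) / (2 * \<omega>)"] by linarith
  then have u: "(13/8 * ?e) * (c1 n * D * Kinf\<^sup>2 * (1/gl) * ?e) \<le> (8/3 * ?l) * (c1 n * D * Kinf\<^sup>2 * (1/gl) * ?e)"
    using c D design by (intro mult_right_mono) auto
  have x: "2 * (sqrt (c1 n) * D * Kinf\<^sup>2 * gl powr (-1/2) * ?e) \<le> (2 * sqrt 2) * (sqrt (c1 n) * D * Kinf\<^sup>2 * gl powr (-1/2) * ?e)"
    using c D two_le_2sqrt2 by (intro mult_right_mono) auto
  have "13/8 * c1 n * D * Kinf\<^sup>2 * (1/gl) / (\<eta> * n) = 13/8 * c1 n * D * Kinf\<^sup>2 * (1/gl) * (?e * ?e)"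
    unfolding e2 by simp
  then have A: "2 * sqrt (c1 n) * D * Kinf\<^sup>2 * gl powr (-1/2) * ?e + 13/8 * c1 n * D * Kinf\<^sup>2 * (1 / gl) / (\<eta> * n)
    = 2 * (sqrt (c1 n) * D * Kinf\<^sup>2 * gl powr (-1/2) * ?e) + (13/8 * ?e) * (c1 n * D * Kinf\<^sup>2 * (1/gl) * ?e)"
    by (simp only: ac_simps)
  have B: "D * C1 n * ?e = (2 * sqrt 2) * (sqrt (c1 n) * D * Kinf\<^sup>2 * gl powr (-1/2) * ?e) + (8/3 * ?l) * (c1 n * D * Kinf\<^sup>2 * (1/gl) * ?e)"
    by (simp add: C1_def algebra_simps)
  show ?thesis by (rule le_of_sums[OF x u A B])
qed

lemma threshold_C2:
  assumes n: "1 \<le> ln (real n)" and \<eta>: "h_min \<omega> n / 2 \<le> \<eta>"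
  shows "deviation_bound (c2 n) (max sigma 1) (tau n) \<eta> n
    \<le> C2 n * (\<eta> * n) powr (-1/2)"
proof -
  let ?e = "(\<eta> * real n) powr (-1/2)" and ?T = "((4 * r + 1) / \<Omega>) powr (1 / \<omega>)"
  have n0: "0 < real n" using n by (cases n) auto
  have l0: "0 < ln (real n)" using n by linarith
  have "0 < \<eta> * real n" using \<eta> h_min_pos[OF n] n0 by simp
  then have e2: "?e * ?e = 1 / (\<eta> * real n)" by (rule powr_half_sq)
  have c: "0 \<le> c2 n" using c_ge_16[OF n] by linarith
  have "tau n * ?e \<le> tau n * (3/2 * ln (real n) powr (- (2 + \<omega>) / (2 * \<omega>)))"
    using bandwidth_powr_le[OF n \<eta>] tau_ge_1[OF n] by (intro mult_left_mono) auto
  also have "\<dots> = 3/2 * (?T * (ln (real n) powr (1/\<omega>) * ln (real n) powr (- (2 + \<omega>) / (2 * \<omega>))))"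
    unfolding tau_eq[OF n] by simp
  also have "ln (real n) powr (1/\<omega>) * ln (real n) powr (- (2 + \<omega>) / (2 * \<omega>)) = ln (real n) powr (-1/2)"
  proof -
    have "1/\<omega> + - (2 + \<omega>) / (2 * \<omega>) = -1/2" using noise_constants by (simp add: field_simps)
    then show ?thesis by (simp only: powr_add[symmetric])
  qed
  finally have "13/8 * (tau n * ?e) \<le> 8/3 * (?T * ln (real n) powr (-1/2))"
    using mult_nonneg_nonneg[OF powr_ge_zero[of "(4 * r + 1) / \<Omega>" "1/\<omega>"] powr_ge_zero[of "ln (real n)" "-1/2"]] by linarith
  then have u: "(13/8 * (tau n * ?e)) * (c2 n * Kinf\<^sup>2 * (1/gl) * ?e) \<le> (8/3 * (?T * ln (real n) powr (-1/2))) * (c2 n * Kinf\<^sup>2 * (1/gl) * ?e)"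
    using c design by (intro mult_right_mono) auto
  have x: "2 * (sqrt (c2 n) * max sigma 1 * Kinf\<^sup>2 * gl powr (-1/2) * ?e) \<le> (2 * sqrt 2) * (sqrt (c2 n) * max sigma 1 * Kinf\<^sup>2 * gl powr (-1/2) * ?e)"
    using c two_le_2sqrt2 by (intro mult_right_mono) auto
  have "13/8 * c2 n * tau n * Kinf\<^sup>2 * (1/gl) / (\<eta> * n) = 13/8 * c2 n * tau n * Kinf\<^sup>2 * (1/gl) * (?e * ?e)"
    unfolding e2 by simp
  then have A: "2 * sqrt (c2 n) * max sigma 1 * Kinf\<^sup>2 * gl powr (-1/2) * ?e + 13/8 * c2 n * tau n * Kinf\<^sup>2 * (1 / gl) / (\<eta> * n)
    = 2 * (sqrt (c2 n) * max sigma 1 * Kinf\<^sup>2 * gl powr (-1/2) * ?e) + (13/8 * (tau n * ?e)) * (c2 n * Kinf\<^sup>2 * (1/gl) * ?e)"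
    by (simp only: ac_simps)
  have B: "C2 n * ?e = (2 * sqrt 2) * (sqrt (c2 n) * max sigma 1 * Kinf\<^sup>2 * gl powr (-1/2) * ?e) + (8/3 * (?T * ln (real n) powr (-1/2))) * (c2 n * Kinf\<^sup>2 * (1/gl) * ?e)"
    by (simp add: C2_def algebra_simps)
  show ?thesis by (rule le_of_sums[OF x u A B])
qed

lemma threshold_C3:
  assumes n: "1 \<le> ln (real n)" and D: "0 \<le> D"
  shows "deviation_bound (c3 n) D D ((h_frak \<omega> n)\<^sup>2) n
      \<le> D * ((real n * (h_frak \<omega> n)\<^sup>2) powr (-1/2) * C3 n)" (is "?A3 \<le> ?B3")
proof -
  let ?e = "(real n * (h_frak \<omega> n)\<^sup>2) powr (-1/2)"
  have "0 < real n * (h_frak \<omega> n)\<^sup>2" unfolding n_h_frak_sq[OF n] using n by simp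
  then have e2: "?e * ?e = 1 / (real n * (h_frak \<omega> n)\<^sup>2)" by (rule powr_half_sq)
  have c: "0 \<le> c3 n" using c_ge_16[OF n] by linarith
  have u: "13/8 * (c3 n * D * Kinf\<^sup>2 * (1/gl) * (?e * ?e)) \<le> 8/3 * (c3 n * D * Kinf\<^sup>2 * (1/gl) * (?e * ?e))"
    using c D design by (intro mult_right_mono) auto
  have x: "2 * (sqrt (c3 n) * D * Kinf\<^sup>2 * gl powr (-1/2) * ?e) \<le> (2 * sqrt 2) * (sqrt (c3 n) * D * Kinf\<^sup>2 * gl powr (-1/2) * ?e)"
    using c D two_le_2sqrt2 by (intro mult_right_mono) auto
  have A: "?A3 = 2 * (sqrt (c3 n) * D * Kinf\<^sup>2 * gl powr (-1/2) * ?e) + 13/8 * (c3 n * D * Kinf\<^sup>2 * (1/gl) * (?e * ?e))"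
    unfolding e2 by (simp add: ac_simps)
  have B: "?B3 = (2 * sqrt 2) * (sqrt (c3 n) * D * Kinf\<^sup>2 * gl powr (-1/2) * ?e) + 8/3 * (c3 n * D * Kinf\<^sup>2 * (1/gl) * (?e * ?e))"
    by (simp add: C3_def algebra_simps)
  show ?thesis by (rule le_of_sums[OF x u A B])
qed

lemma threshold_C4:
  assumes n: "1 \<le> ln (real n)"
  shows "deviation_bound (c4 n) (max sigma 1) (tau n) ((h_frak \<omega> n)\<^sup>2) n
      \<le> (real n * (h_frak \<omega> n)\<^sup>2) powr (-1/2) * C4 n" (is "?A4 \<le> ?B4")
proof -
  let ?e = "(real n * (h_frak \<omega> n)\<^sup>2) powr (-1/2)"
  have "0 < real n * (h_frak \<omega> n)\<^sup>2" unfolding n_h_frak_sq[OF n] using n by simp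
  then have e2: "?e * ?e = 1 / (real n * (h_frak \<omega> n)\<^sup>2)" by (rule powr_half_sq)
  have c: "0 \<le> c4 n" using c_ge_16[OF n] by linarith
  have t: "0 \<le> tau n" using tau_ge_1[OF n] by linarith
  have u: "13/8 * (c4 n * tau n * Kinf\<^sup>2 * (1/gl) * (?e * ?e)) \<le> 8/3 * (c4 n * tau n * Kinf\<^sup>2 * (1/gl) * (?e * ?e))"
    using c t design by (intro mult_right_mono) auto
  have x: "2 * (sqrt (c4 n) * max sigma 1 * Kinf\<^sup>2 * gl powr (-1/2) * ?e) \<le> (2 * sqrt 2) * (sqrt (c4 n) * max sigma 1 * Kinf\<^sup>2 * gl powr (-1/2) * ?e)"
    using c two_le_2sqrt2 by (intro mult_right_mono) auto
  have A: "?A4 = 2 * (sqrt (c4 n) * max sigma 1 * Kinf\<^sup>2 * gl powr (-1/2) * ?e) + 13/8 * (c4 n * tau n * Kinf\<^sup>2 * (1/gl) * (?e * ?e))"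
    unfolding e2 by (simp add: ac_simps)
  have B: "?B4 = (2 * sqrt 2) * (sqrt (c4 n) * max sigma 1 * Kinf\<^sup>2 * gl powr (-1/2) * ?e) + 8/3 * (c4 n * tau n * Kinf\<^sup>2 * (1/gl) * (?e * ?e))"
    by (simp add: C4_def algebra_simps)
  show ?thesis by (rule le_of_sums[OF x u A B])
qed

end

section \<open>The exceptional event\<close>

context single_index_model
begin

lemma bandwidth:
  assumes n: "1 \<le> ln (real n)" and \<eta>: "\<eta> \<in> bandwidths \<omega> n"
  shows "0 < \<eta>" "\<eta> \<le> 1" "h_min \<omega> n / 2 \<le> \<eta>" "1 / (2 * real n) \<le> \<eta>"
proof -
  have n0: "0 < real n" using n by (cases n) auto
  show 1: "\<eta> \<le> 1" "h_min \<omega> n / 2 \<le> \<eta>" using \<eta> by (auto simp: bandwidths_def)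
  show "0 < \<eta>" using 1 h_min_pos[OF n] by linarith
  have "1 \<le> ln (real n) powr (1 + 2/\<omega>)" using n noise_constants by (intro ge_one_powr_ge_zero) auto
  then have "1 / real n \<le> h_min \<omega> n" using n0 by (simp add: h_min_def divide_right_mono)
  then show "1 / (2 * real n) \<le> \<eta>" using 1(2) by simp
qed

lemma finite_bandwidths:
  assumes n: "1 \<le> ln (real n)"
  shows "finite (bandwidths \<omega> n)" "card (bandwidths \<omega> n) \<le> 2 * n + 1"
proof -
  have n0: "0 < real n" using n by (cases n) auto
  have sub: "bandwidths \<omega> n \<subseteq> (\<lambda>k. (1/2) ^ k) ` {..2 * n}"
  proof
    fix \<eta> assume \<eta>: "\<eta> \<in> bandwidths \<omega> n"
    then obtain k where k: "\<eta> = (1/2) ^ k" by (auto simp: bandwidths_def)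
    have "1 / (2 * real n) \<le> 1 / 2 ^ k" using bandwidth(4)[OF n \<eta>] by (simp add: k power_one_over)
    then have "2 ^ k \<le> 2 * real n" using n0 by (simp add: field_simps)
    then have "2 ^ k \<le> 2 * n" using of_nat_le_iff[of "2 ^ k" "2 * n", where 'a=real] by simp
    moreover have "k < 2 ^ k" by (rule less_exp)
    ultimately have "k \<le> 2 * n" by linarith
    then show "\<eta> \<in> (\<lambda>k. (1/2) ^ k) ` {..2 * n}" unfolding k by (intro imageI) simp
  qed
  then show "finite (bandwidths \<omega> n)" by (rule finite_subset) simp
  have "card (bandwidths \<omega> n) \<le> card ((\<lambda>k. (1/2) ^ k :: real) ` {..2 * n})"
    by (rule card_mono[OF _ sub]) simp
  also have "\<dots> \<le> card {..2 * n}" by (rule card_image_le) simp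
  finally show "card (bandwidths \<omega> n) \<le> 2 * n + 1" by simp
qed

definition truncate :: "nat \<Rightarrow> real \<Rightarrow> real" where
  "truncate n e = (if \<bar>e\<bar> \<le> tau n then e else 0)"

lemma truncate_measurable [measurable]: "truncate n \<in> borel_measurable borel"
  unfolding truncate_def[abs_def] by measurable

lemma weight_second_moments:
  assumes E: "localized E v" and det: "det E \<le> 1 / \<rho>" and \<rho>: "0 < \<rho>"
    and [measurable]: "\<phi> \<in> borel_measurable borel"
    and \<phi>: "\<And>x. weight E v x \<noteq> 0 \<Longrightarrow> \<bar>\<phi> x\<bar> \<le> D" and D: "0 \<le> D" and n: "1 \<le> ln (real n)"
  shows "(\<integral>z. (weight E v (fst z) * \<phi> (fst z))\<^sup>2 \<partial>Joint) \<le> D\<^sup>2 * (Kinf ^ 4 / (gl * \<rho>))"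
    "(\<integral>z. (weight E v (fst z) * truncate n (snd z))\<^sup>2 \<partial>Joint) \<le> (max sigma 1)\<^sup>2 * (Kinf ^ 4 / (gl * \<rho>))"
    "(\<integral>z. weight E v (fst z) * \<phi> (fst z) \<partial>Joint) = (\<integral>x. weight E v x * \<phi> x \<partial>G)"
    "(\<integral>z. weight E v (fst z) * truncate n (snd z) \<partial>Joint) = 0"
proof -
  have fst_int: "(\<integral>z. \<psi> (fst z) \<partial>Joint) = (\<integral>x. \<psi> x \<partial>G)"
    if "\<psi> \<in> borel_measurable borel" "\<And>x. \<bar>\<psi> x\<bar> \<le> A" for \<psi> :: "real^2 \<Rightarrow> real" and A :: real
    using integral_Joint_prod[where f=\<psi> and h="\<lambda>_. 1" and A=A and B=1] that Noise.prob_space by simp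
  define B where "B = det E * Kinf\<^sup>2 / gl"
  have w: "\<bar>weight E v x\<bar> \<le> B" for x unfolding B_def by (rule weight_le[OF E])
  have B: "0 \<le> B" using w[of 0] by linarith
  have w2: "\<bar>(weight E v x)\<^sup>2\<bar> \<le> B\<^sup>2" for x using power_mono[OF w[of x], of 2] by simp
  have wp: "\<bar>weight E v x * \<phi> x\<bar> \<le> B * D" for x
    using w[of x] \<phi>[of x] B D by (cases "weight E v x = 0") (auto simp: abs_mult intro!: mult_mono)
  have wp2: "\<bar>(weight E v x * \<phi> x)\<^sup>2\<bar> \<le> (B * D)\<^sup>2" for x using power_mono[OF wp[of x], of 2] by simp
  have t: "\<bar>truncate n e\<bar> \<le> tau n" for e using tau_ge_1[OF n] by (simp add: truncate_def)
  have t2: "\<bar>(truncate n e)\<^sup>2\<bar> \<le> (tau n)\<^sup>2" for e using power_mono[OF t[of e], of 2] by simp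
  have wi: "(\<integral>x. (weight E v x)\<^sup>2 \<partial>G) \<le> Kinf ^ 4 / (gl * \<rho>)"
  proof -
    have "(\<integral>x. (weight E v x)\<^sup>2 \<partial>G) \<le> det E * Kinf ^ 4 / gl" by (rule weight_sq_integral[OF E])
    also have "\<dots> \<le> (1 / \<rho>) * Kinf ^ 4 / gl"
      using det design by (intro divide_right_mono mult_right_mono) auto
    finally show ?thesis by (simp add: mult.commute)
  qed
  have k0: "0 \<le> Kinf ^ 4 / (gl * \<rho>)" using \<rho> design by simp
  have "(\<integral>z. (weight E v (fst z) * \<phi> (fst z))\<^sup>2 \<partial>Joint) = (\<integral>x. (weight E v x * \<phi> x)\<^sup>2 \<partial>G)"
    by (rule fst_int[OF _ wp2]) simp
  also have "\<dots> \<le> (\<integral>x. D\<^sup>2 * (weight E v x)\<^sup>2 \<partial>G)"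
  proof (rule integral_mono)
    show "integrable G (\<lambda>x. (weight E v x * \<phi> x)\<^sup>2)"
      by (rule G.integrable_const_bound[where B="(B * D)\<^sup>2"]) (use wp2 in auto)
    show "integrable G (\<lambda>x. D\<^sup>2 * (weight E v x)\<^sup>2)"
      by (rule integrable_mult_right, rule G.integrable_const_bound[where B="B\<^sup>2"]) (use w2 in auto)
    show "(weight E v x * \<phi> x)\<^sup>2 \<le> D\<^sup>2 * (weight E v x)\<^sup>2" for x
    proof (cases "weight E v x = 0")
      case False
      have "(\<phi> x)\<^sup>2 \<le> D\<^sup>2" using power_mono[OF \<phi>[OF False] abs_ge_zero, of 2] by simp
      then show ?thesis unfolding power_mult_distrib
        by (subst mult.commute) (rule mult_right_mono, simp_all)
    qed simp
  qed
  also have "\<dots> = D\<^sup>2 * (\<integral>x. (weight E v x)\<^sup>2 \<partial>G)" by simp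
  also have "\<dots> \<le> D\<^sup>2 * (Kinf ^ 4 / (gl * \<rho>))" by (intro mult_left_mono wi) simp
  finally show "(\<integral>z. (weight E v (fst z) * \<phi> (fst z))\<^sup>2 \<partial>Joint) \<le> D\<^sup>2 * (Kinf ^ 4 / (gl * \<rho>))" .
  have "(\<integral>e. (truncate n e)\<^sup>2 \<partial>Noise) \<le> (\<integral>e. e\<^sup>2 \<partial>Noise)"
  proof (rule integral_mono)
    show "integrable Noise (\<lambda>e. (truncate n e)\<^sup>2)"
      by (rule Noise.integrable_const_bound[where B="(tau n)\<^sup>2"]) (use t2 in auto)
    show "integrable Noise (\<lambda>e. e\<^sup>2)" by (rule noise_second_moment(2)[OF noise_facts])
    show "(truncate n e)\<^sup>2 \<le> e\<^sup>2" for e by (simp add: truncate_def)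
  qed
  also have "\<dots> \<le> (max sigma 1)\<^sup>2" by (rule sigma_bound)
  finally have ts: "(\<integral>e. (truncate n e)\<^sup>2 \<partial>Noise) \<le> (max sigma 1)\<^sup>2" .
  have "(\<integral>z. (weight E v (fst z) * truncate n (snd z))\<^sup>2 \<partial>Joint)
      = (\<integral>x. (weight E v x)\<^sup>2 \<partial>G) * (\<integral>e. (truncate n e)\<^sup>2 \<partial>Noise)"
    unfolding power_mult_distrib by (rule integral_Joint_prod[OF _ _ w2 t2]) auto
  also have "\<dots> \<le> (Kinf ^ 4 / (gl * \<rho>)) * (max sigma 1)\<^sup>2"
    by (intro mult_mono wi ts k0) (auto intro: Bochner_Integration.integral_nonneg)
  finally show "(\<integral>z. (weight E v (fst z) * truncate n (snd z))\<^sup>2 \<partial>Joint) \<le> (max sigma 1)\<^sup>2 * (Kinf ^ 4 / (gl * \<rho>))"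
    by (simp add: mult.commute)
  show "(\<integral>z. weight E v (fst z) * \<phi> (fst z) \<partial>Joint) = (\<integral>x. weight E v x * \<phi> x \<partial>G)"
    by (rule fst_int[OF _ wp]) simp
  have "(\<integral>e. truncate n e \<partial>Noise) = 0"
    unfolding truncate_def by (rule noise_truncated_mean[OF noise_facts])
  then show "(\<integral>z. weight E v (fst z) * truncate n (snd z) \<partial>Joint) = 0"
    using integral_Joint_prod[where f="weight E v" and h="truncate n" and A=B and B="tau n"] w t by simp
qed

text \<open>
  Signal and noise are treated separately: the former is bounded by \<open>D\<close>, the latter is truncated at
  \<open>tau n\<close>, which does not affect its mean because it is symmetric.
\<close>

lemma family_deviation:
  fixes E :: "real^2 \<Rightarrow> real^2^2" and v :: "real^2 \<Rightarrow> real^2" and \<phi> :: "real^2 \<Rightarrow> real"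
    and n R m :: nat and c c' \<rho> D \<Lambda> :: real
  assumes S: "S \<subseteq> square (real R)" and m: "0 < m" and n: "1 \<le> ln (real n)"
    and loc: "\<And>a. a \<in> S \<Longrightarrow> localized (E a) (v a)"
    and det: "\<And>a. a \<in> S \<Longrightarrow> det (E a) \<le> 1 / \<rho>" and \<rho>: "0 < \<rho>" "\<rho> \<le> 1"
    and osc: "\<And>a b x. a \<in> S \<Longrightarrow> b \<in> S \<Longrightarrow> \<forall>i. \<bar>a $ i - b $ i\<bar> \<le> 1 / real m \<Longrightarrow>
       \<bar>weight (E a) (v a) x - weight (E b) (v b) x\<bar> \<le> \<Lambda>" and \<Lambda>: "real n * \<Lambda> \<le> 1"
    and \<phi>_meas [measurable]: "\<phi> \<in> borel_measurable borel"
    and \<phi>: "\<And>a x. a \<in> S \<Longrightarrow> weight (E a) (v a) x \<noteq> 0 \<Longrightarrow> \<bar>\<phi> x\<bar> \<le> D" and D: "0 < D"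
    and c: "16 \<le> c" "16 \<le> c'"
  shows "\<exists>Bad\<in>sets (Draws n).
    measure (Draws n) Bad \<le> real ((2 * R * m + 1)\<^sup>2) * (2 * exp (- (3/4 * c)) + 2 * exp (- (3/4 * c'))) \<and>
    (\<forall>w\<in>space (Draws n) - Bad. (\<forall>i\<in>{1..n}. \<bar>snd (w i)\<bar> \<le> tau n) \<longrightarrow> (\<forall>a\<in>S.
      \<bar>(\<Sum>i=1..n. weight (E a) (v a) (fst (w i)) * (\<phi> (fst (w i)) + snd (w i))) / real n - (\<integral>x. weight (E a) (v a) x * \<phi> x \<partial>G)\<bar>
      \<le> deviation_bound c D D \<rho> n + deviation_bound c' (max sigma 1) (tau n) \<rho> n))"
proof -
  have n0: "0 < n" using n by (cases n) auto
  have t: "0 < tau n" using tau_ge_1[OF n] by linarith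
  note mom = weight_second_moments[OF loc det \<rho>(1) \<phi>_meas \<phi> less_imp_le[OF D] n]
  have [measurable]: "(\<lambda>z. \<phi> (fst z)) \<in> borel_measurable (borel \<Otimes>\<^sub>M borel)" "(\<lambda>z. truncate n (snd z)) \<in> borel_measurable (borel \<Otimes>\<^sub>M borel)"
    by measurable
  have "\<exists>Bad\<in>sets (Draws n).
    measure (Draws n) Bad \<le> real ((2 * R * m + 1)\<^sup>2) * (2 * exp (- (3/4 * c))) \<and>
    (\<forall>w\<in>space (Draws n) - Bad. \<forall>a\<in>S.
      \<bar>(\<Sum>i=1..n. weight (E a) (v a) (fst (w i)) * \<phi> (fst (w i))) / real n - (\<integral>z. weight (E a) (v a) (fst z) * \<phi> (fst z) \<partial>Joint)\<bar>
      \<le> deviation_bound c D D \<rho> n)"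
    by (rule uniform_deviation[where E=E and v=v and \<psi>="\<lambda>z. \<phi> (fst z)" and S=S and R=R and m=m and n=n and c=c and \<rho>=\<rho> and D=D and s=D and \<Lambda>=\<Lambda>,
          OF S m n0 loc det \<rho> osc \<Lambda> _ _ D mom(1) less_imp_le[OF D] c(1)]) (use \<phi> in auto)
  then obtain Bad1 where Bad1: "Bad1 \<in> sets (Draws n)"
    "measure (Draws n) Bad1 \<le> real ((2 * R * m + 1)\<^sup>2) * (2 * exp (- (3/4 * c)))"
    "\<And>w a. w \<in> space (Draws n) \<Longrightarrow> w \<notin> Bad1 \<Longrightarrow> a \<in> S \<Longrightarrow>
      \<bar>(\<Sum>i=1..n. weight (E a) (v a) (fst (w i)) * \<phi> (fst (w i))) / real n - (\<integral>z. weight (E a) (v a) (fst z) * \<phi> (fst z) \<partial>Joint)\<bar>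
      \<le> deviation_bound c D D \<rho> n"
    by blast
  have "\<exists>Bad\<in>sets (Draws n).
    measure (Draws n) Bad \<le> real ((2 * R * m + 1)\<^sup>2) * (2 * exp (- (3/4 * c'))) \<and>
    (\<forall>w\<in>space (Draws n) - Bad. \<forall>a\<in>S.
      \<bar>(\<Sum>i=1..n. weight (E a) (v a) (fst (w i)) * truncate n (snd (w i))) / real n - (\<integral>z. weight (E a) (v a) (fst z) * truncate n (snd z) \<partial>Joint)\<bar>
      \<le> deviation_bound c' (max sigma 1) (tau n) \<rho> n)"
    by (rule uniform_deviation[where E=E and v=v and \<psi>="\<lambda>z. truncate n (snd z)" and S=S and R=R and m=m and n=n and c=c' and \<rho>=\<rho> and D="tau n" and s="max sigma 1" and \<Lambda>=\<Lambda>,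
          OF S m n0 loc det \<rho> osc \<Lambda> _ _ t mom(2) _ c(2)]) (use t in \<open>auto simp: truncate_def\<close>)
  then obtain Bad2 where Bad2: "Bad2 \<in> sets (Draws n)"
    "measure (Draws n) Bad2 \<le> real ((2 * R * m + 1)\<^sup>2) * (2 * exp (- (3/4 * c')))"
    "\<And>w a. w \<in> space (Draws n) \<Longrightarrow> w \<notin> Bad2 \<Longrightarrow> a \<in> S \<Longrightarrow>
      \<bar>(\<Sum>i=1..n. weight (E a) (v a) (fst (w i)) * truncate n (snd (w i))) / real n - (\<integral>z. weight (E a) (v a) (fst z) * truncate n (snd z) \<partial>Joint)\<bar>
      \<le> deviation_bound c' (max sigma 1) (tau n) \<rho> n"
    by blast
  show ?thesis
  proof (intro bexI[of _ "Bad1 \<union> Bad2"] conjI ballI impI)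
    show "Bad1 \<union> Bad2 \<in> sets (Draws n)" using Bad1(1) Bad2(1) by (rule sets.Un)
    have "measure (Draws n) (Bad1 \<union> Bad2) \<le> measure (Draws n) Bad1 + measure (Draws n) Bad2"
      by (rule measure_Un_le[OF Bad1(1) Bad2(1)])
    also have "\<dots> \<le> real ((2 * R * m + 1)\<^sup>2) * (2 * exp (- (3/4 * c))) + real ((2 * R * m + 1)\<^sup>2) * (2 * exp (- (3/4 * c')))"
      by (rule add_mono[OF Bad1(2) Bad2(2)])
    finally show "measure (Draws n) (Bad1 \<union> Bad2) \<le> real ((2 * R * m + 1)\<^sup>2) * (2 * exp (- (3/4 * c)) + 2 * exp (- (3/4 * c')))"
      by (simp only: distrib_left)
    fix w a assume "w \<in> space (Draws n) - (Bad1 \<union> Bad2)" and tr: "\<forall>i\<in>{1..n}. \<bar>snd (w i)\<bar> \<le> tau n" and a: "a \<in> S"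
    then have w: "w \<in> space (Draws n)" "w \<notin> Bad1" "w \<notin> Bad2" by auto
    have "(\<Sum>i=1..n. weight (E a) (v a) (fst (w i)) * (\<phi> (fst (w i)) + snd (w i)))
        = (\<Sum>i=1..n. weight (E a) (v a) (fst (w i)) * \<phi> (fst (w i))) + (\<Sum>i=1..n. weight (E a) (v a) (fst (w i)) * truncate n (snd (w i)))"
      unfolding sum.distrib[symmetric] by (rule sum.cong) (use tr in \<open>auto simp: truncate_def distrib_left\<close>)
    then have eq: "(\<Sum>i=1..n. weight (E a) (v a) (fst (w i)) * (\<phi> (fst (w i)) + snd (w i))) / real n
        = (\<Sum>i=1..n. weight (E a) (v a) (fst (w i)) * \<phi> (fst (w i))) / real n + (\<Sum>i=1..n. weight (E a) (v a) (fst (w i)) * truncate n (snd (w i))) / real n"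
      by (simp add: add_divide_distrib)
    have tri: "\<bar>x - i\<bar> \<le> A \<Longrightarrow> \<bar>y - 0\<bar> \<le> B \<Longrightarrow> \<bar>(x + y) - i\<bar> \<le> A + B" for x y i A B :: real by linarith
    have 1: "\<bar>(\<Sum>i=1..n. weight (E a) (v a) (fst (w i)) * \<phi> (fst (w i))) / real n - (\<integral>x. weight (E a) (v a) x * \<phi> x \<partial>G)\<bar>
      \<le> deviation_bound c D D \<rho> n"
      using Bad1(3)[OF w(1,2) a] mom(3)[OF a a] a by simp
    have 2: "\<bar>(\<Sum>i=1..n. weight (E a) (v a) (fst (w i)) * truncate n (snd (w i))) / real n - 0\<bar>
      \<le> deviation_bound c' (max sigma 1) (tau n) \<rho> n"
      using Bad2(3)[OF w(1,3) a] mom(4)[OF a a] a by simp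
    show "\<bar>(\<Sum>i=1..n. weight (E a) (v a) (fst (w i)) * (\<phi> (fst (w i)) + snd (w i))) / real n - (\<integral>x. weight (E a) (v a) x * \<phi> x \<partial>G)\<bar>
      \<le> deviation_bound c D D \<rho> n + deviation_bound c' (max sigma 1) (tau n) \<rho> n"
      unfolding eq by (rule tri[OF 1 2])
  qed
qed

definition data :: "(real^2 \<Rightarrow> real) \<Rightarrow> nat \<Rightarrow> sample \<Rightarrow> sample" where
  "data F n w = (\<lambda>i\<in>{1..n}. (fst (w i), F (fst (w i)) + snd (w i)))"

lemma F_hat_data:
  "F_hat n (data F n w) E v = (\<Sum>i=1..n. weight E v (fst (w i)) * (F (fst (w i)) + snd (w i))) / real n"
  unfolding F_hat_eq by (simp add: data_def)

lemma prob_space_Draws: "prob_space (Draws n)"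
  by (intro prob_space_PiM prob_space_Joint)

text \<open>
  By the choice of \<open>tau n\<close>, a single noise variable exceeds it with probability of the order of \<open>n\<close> to the
  power \<open>- (4 * r + 1)\<close>.
\<close>

lemma measure_tail:
  assumes n: "1 \<le> ln (real n)"
  shows "{w \<in> space (Draws n). \<exists>i\<in>{1..n}. tau n < \<bar>snd (w i)\<bar>} \<in> sets (Draws n)"
    "measure (Draws n) {w \<in> space (Draws n). \<exists>i\<in>{1..n}. tau n < \<bar>snd (w i)\<bar>} \<le> 2 * \<Upsilon> * real n powr (- (4 * r))"
proof -
  interpret D: prob_space "Draws n" by (rule prob_space_Draws)
  have n0: "0 < real n" using n by (cases n) auto
  have t: "0 \<le> tau n" using tau_ge_1[OF n] by linarith
  define A where "A = (\<lambda>i. {w \<in> space (Draws n). tau n < \<bar>snd (w i)\<bar>})"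
  have eq: "{w \<in> space (Draws n). \<exists>i\<in>{1..n}. tau n < \<bar>snd (w i)\<bar>} = (\<Union>i\<in>{1..n}. A i)"
    by (auto simp: A_def)
  have meas: "A i \<in> sets (Draws n)" if i: "i \<in> {1..n}" for i
  proof -
    have ci: "(\<lambda>w. w i) \<in> measurable (Draws n) Joint" using i by (rule measurable_component_singleton)
    have e: "A i = (\<lambda>w. w i) -` {z \<in> space Joint. tau n < \<bar>snd z\<bar>} \<inter> space (Draws n)"
      using measurable_space[OF ci] by (auto simp: A_def)
    have m: "{z \<in> space Joint. tau n < \<bar>snd z\<bar>} \<in> sets Joint" by measurable
    show ?thesis unfolding e by (rule measurable_sets[OF ci m])
  qed
  then show "{w \<in> space (Draws n). \<exists>i\<in>{1..n}. tau n < \<bar>snd (w i)\<bar>} \<in> sets (Draws n)" unfolding eq by auto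
  have one: "D.prob (A i) \<le> 2 * \<Upsilon> * real n powr (- (4 * r + 1))" if i: "i \<in> {1..n}" for i
  proof -
    have ci: "(\<lambda>w. w i) \<in> measurable (Draws n) Joint" using i by (rule measurable_component_singleton)
    have "emeasure (Draws n) (A i) = emeasure (distr (Draws n) Joint (\<lambda>w. w i)) {z \<in> space Joint. tau n < \<bar>snd z\<bar>}"
    proof -
      have "(\<lambda>w. w i) -` {z \<in> space Joint. tau n < \<bar>snd z\<bar>} \<inter> space (Draws n) = A i"
        using measurable_space[OF ci] by (auto simp: A_def)
      moreover have "{z \<in> space Joint. tau n < \<bar>snd z\<bar>} \<in> sets Joint" by measurable
      ultimately show ?thesis by (simp only: emeasure_distr[OF ci])
    qed
    also have "distr (Draws n) Joint (\<lambda>w. w i) = Joint"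
      using distr_PiM_component[where M="\<lambda>_. Joint" and I="{1..n}" and i=i] prob_space_Joint i by blast
    also have "{z \<in> space Joint. tau n < \<bar>snd z\<bar>} = space G \<times> {e \<in> space Noise. tau n < \<bar>e\<bar>}"
      by (auto simp: space_pair_measure)
    also have "emeasure Joint \<dots> = emeasure G (space G) * emeasure Noise {e \<in> space Noise. tau n < \<bar>e\<bar>}"
      by (rule Noise.emeasure_pair_measure_Times) auto
    also have "\<dots> = emeasure Noise {e. tau n < \<bar>e\<bar>}" using G.emeasure_space_1 by simp
    also have "\<dots> \<le> emeasure Noise {e. tau n \<le> \<bar>e\<bar>}" by (rule emeasure_mono) auto
    also have "\<dots> \<le> ennreal (2 * \<Upsilon> * exp (- \<Omega> * tau n powr \<omega>))" by (rule noise_tail[OF noise_facts t])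
    also have "tau n powr \<omega> = (4 * r + 1) * ln (real n) / \<Omega>"
      using noise_constants tau_base_ge_1[OF n] by (simp add: tau_def powr_powr)
    also have "- \<Omega> * ((4 * r + 1) * ln (real n) / \<Omega>) = - (4 * r + 1) * ln (real n)"
      using noise_constants by simp (simp add: algebra_simps)
    also have "exp (- (4 * r + 1) * ln (real n)) = real n powr (- (4 * r + 1))" using n0 by (simp add: powr_def)
    finally have "ennreal (D.prob (A i)) \<le> ennreal (2 * \<Upsilon> * real n powr (- (4 * r + 1)))"
      by (simp only: D.emeasure_eq_measure)
    then show ?thesis by (rule ennreal_le_iff[THEN iffD1, rotated]) (use noise_constants in simp)
  qed
  have "D.prob (\<Union>i\<in>{1..n}. A i) \<le> (\<Sum>i\<in>{1..n}. D.prob (A i))"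
    by (rule D.finite_measure_subadditive_finite) (use meas in auto)
  also have "\<dots> \<le> (\<Sum>i\<in>{1..n}. 2 * \<Upsilon> * real n powr (- (4 * r + 1)))" by (rule sum_mono[OF one])
  also have "\<dots> = 2 * \<Upsilon> * (real n powr 1 * real n powr (- (4 * r + 1)))" using n0 by simp
  also have "real n powr 1 * real n powr (- (4 * r + 1)) = real n powr (1 + - (4 * r + 1))"
    by (simp only: powr_add)
  also have "1 + - (4 * r + 1) = - (4 * r)" by simp
  finally show "measure (Draws n) {w \<in> space (Draws n). \<exists>i\<in>{1..n}. tau n < \<bar>snd (w i)\<bar>} \<le> 2 * \<Upsilon> * real n powr (- (4 * r))"
    unfolding eq .
qed

text \<open>
  The factor \<open>real n ^ 20\<close> is spare room for the number of bandwidths and of points in the nets.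
\<close>

lemma exp_c_le:
  assumes n: "1 \<le> ln (real n)" and c: "700 * ln (real n) + 8 * r * ln (real n) \<le> c"
  shows "exp (- (3/4 * c)) \<le> real n powr (- (4 * r)) / real n ^ 20"
proof -
  have n0: "0 < real n" using n by (cases n) auto
  have "0 \<le> r * ln (real n)" using n r by simp
  moreover have "3/4 * (700 * ln (real n) + 8 * r * ln (real n)) \<le> 3/4 * c" using c by (rule mult_left_mono) simp
  ultimately have "4 * (r * ln (real n)) + 20 * ln (real n) \<le> 3/4 * c" using n by (simp add: distrib_left)
  then have "exp (- (3/4 * c)) \<le> exp (- (4 * (r * ln (real n)) + 20 * ln (real n)))" by simp
  also have "\<dots> = exp (- (4 * r) * ln (real n)) / exp (real 20 * ln (real n))"
    by (simp flip: exp_diff)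
  also have "exp (real 20 * ln (real n)) = real n ^ 20" using n0 by (simp only: exp_of_nat_mult exp_ln)
  also have "exp (- (4 * r) * ln (real n)) = real n powr (- (4 * r))" using n0 by (simp add: powr_def)
  finally show ?thesis .
qed

lemma n_ge_3: "1 \<le> ln (real n) \<Longrightarrow> 3 \<le> n"
proof -
  assume n: "1 \<le> ln (real n)"
  have n0: "0 < real n" using n by (cases n) auto
  have "exp 1 \<le> real n" using n n0 by (simp add: ln_ge_iff)
  moreover have "(2::real) < exp 1" using exp_lower_Taylor_quadratic[of "1::real"] by simp
  ultimately show ?thesis by linarith
qed

text \<open>
  Only these values of the regression function enter: by \<open>E_mat_support\<close> the weights of the matrices
  \<open>E_mat a \<eta>\<close> at a point of \<open>square (1/2)\<close> vanish outside \<open>square (5/2)\<close>, and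
  \<open>F_hat_inf\<close> is a supremum over the same square.
\<close>

definition supF :: "(real \<Rightarrow> real) \<Rightarrow> real^2 \<Rightarrow> real" where
  "supF f \<theta> = (SUP x\<in>square (5/2). \<bar>f (x \<bullet> \<theta>)\<bar>)"

lemma supF:
  assumes f: "f \<in> holder_class \<beta> L"
  shows "x \<in> square (5/2) \<Longrightarrow> \<bar>f (x \<bullet> \<theta>)\<bar> \<le> supF f \<theta>" "0 \<le> supF f \<theta>" "supF f \<theta> \<le> L"
proof -
  have bdd: "bdd_above ((\<lambda>x. \<bar>f (x \<bullet> \<theta>)\<bar>) ` square (5/2))"
    by (rule bdd_aboveI2[where M=L]) (rule holder_abs_le[OF \<beta> f])
  show 1: "\<bar>f (x \<bullet> \<theta>)\<bar> \<le> supF f \<theta>" if "x \<in> square (5/2)" for x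
    unfolding supF_def by (rule cSUP_upper[OF that bdd])
  have z: "0 \<in> square (5/2)" by (simp add: square_def)
  show "0 \<le> supF f \<theta>" using 1[OF z] by linarith
  show "supF f \<theta> \<le> L" unfolding supF_def by (rule cSUP_least) (use z holder_abs_le[OF \<beta> f] in auto)
qed

lemma annulus_square: "annulus \<subseteq> square (real 1)"
  using annulus_component by (auto simp: square_def)

lemma square_mono: "a \<le> b \<Longrightarrow> square a \<subseteq> square b"
  unfolding square_def by (rule Collect_mono) (meson order_trans)

lemma square_5_2_3: "square (5/2) \<subseteq> square (real 3)"
  by (rule square_mono) simp

lemma h_frak_bounds:
  assumes n: "1 \<le> ln (real n)"
  shows "0 < h_frak \<omega> n" "1 / real n \<le> (h_frak \<omega> n)\<^sup>2" "1 / real n ^ 2 \<le> (h_frak \<omega> n) ^ 3"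
proof -
  have n0: "0 < real n" "1 \<le> real n" using n_ge_3[OF n] by auto
  have "1 \<le> ln (real n) powr (1 + 1/\<omega>)" using n noise_constants by (intro ge_one_powr_ge_zero) auto
  then show 1: "1 / real n \<le> (h_frak \<omega> n)\<^sup>2" unfolding h_frak_sq[OF n] using n0 by (intro divide_right_mono) auto
  have nn: "0 \<le> h_frak \<omega> n" by (simp add: h_frak_def)
  have "(1 / real n)\<^sup>2 \<le> 1 / real n" using n0 by (simp add: power2_eq_square field_simps)
  then have "(1 / real n)\<^sup>2 \<le> (h_frak \<omega> n)\<^sup>2" using 1 by linarith
  then have 2: "1 / real n \<le> h_frak \<omega> n" using nn by (rule power2_le_imp_le)
  then show "0 < h_frak \<omega> n" using n0 by (smt (verit) divide_pos_pos)
  have "1 / real n * (1 / real n) \<le> (h_frak \<omega> n)\<^sup>2 * h_frak \<omega> n"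
    using 1 2 n0 by (intro mult_mono) auto
  then show "1 / real n ^ 2 \<le> (h_frak \<omega> n) ^ 3" by (simp add: power2_eq_square power3_eq_cube)
qed

abbreviation "estimators_concentrate n t f \<theta> d \<equiv>
  \<forall>\<eta>\<in>bandwidths \<omega> n. \<forall>a\<in>annulus.
        \<bar>F_hat n d (E_mat a \<eta>) t - (\<integral>x. weight (E_mat a \<eta>) t x * f (x \<bullet> \<theta>) \<partial>G)\<bar>
        \<le> ((supF f \<theta> + 1/2) * C1 n + C2 n) * (\<eta> * real n) powr (-1/2)"

abbreviation "averages_concentrate n f \<theta> d \<equiv>
  \<forall>v\<in>square (5/2).
        \<bar>F_hat n d (mat (1 / h_frak \<omega> n)) v - (\<integral>x. weight (mat (1 / h_frak \<omega> n)) v x * f (x \<bullet> \<theta>) \<partial>G)\<bar>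
        \<le> L * ((real n * (h_frak \<omega> n)\<^sup>2) powr (-1/2) * C3 n) + (real n * (h_frak \<omega> n)\<^sup>2) powr (-1/2) * C4 n"

text \<open>
  The event is the union of the event that some noise variable exceeds \<open>tau n\<close>, of one exceptional event
  per bandwidth, for all directions at once, and of one for the local averages. The signal is bounded
  by \<open>supF f \<theta> + 1/2\<close> rather than by \<open>L\<close>, because this is what \<open>F_hat_inf\<close> can estimate; the summand
  \<open>1/2\<close> only makes the bound positive.
\<close>

lemma exceptional_event:
  assumes n: "1 \<le> ln (real n)" and h1: "h_frak \<omega> n \<le> 1" and osc_n: "4 * osc_const \<le> real n"
    and t: "t \<in> square (1/2)" and f: "f \<in> holder_class \<beta> L"
  shows "\<exists>Bad\<in>sets (Draws n). measure (Draws n) Bad \<le> (1 + 2 * \<Upsilon>) * real n powr (- (4 * r)) \<and>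
    (\<forall>w\<in>space (Draws n) - Bad.
      estimators_concentrate n t f \<theta> (data (\<lambda>x. f (x \<bullet> \<theta>)) n w) \<and> averages_concentrate n f \<theta> (data (\<lambda>x. f (x \<bullet> \<theta>)) n w))"
proof -
  interpret D: prob_space "Draws n" by (rule prob_space_Draws)
  note [measurable] = holder_measurable[OF \<beta> f]
  \<comment> \<open>The mesh \<open>1 / n ^ 4\<close> beats the Lipschitz constants of the weights, which are of order \<open>n\<^sup>2\<close>, also after multiplication by \<open>n\<close>.\<close>
  let ?h = "h_frak \<omega> n" and ?F = "\<lambda>x. f (x \<bullet> \<theta>)" and ?Fm = "supF f \<theta> + 1/2" and ?m = "n ^ 4"
  note h = h_frak_bounds[OF n]
  have n3: "3 \<le> n" by (rule n_ge_3[OF n])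
  have n0: "0 < real n" "0 < ?m" using n3 by auto
  have Fm: "0 < ?Fm" using supF(2)[OF f, of \<theta>] by linarith
  have Fmeas: "?F \<in> borel_measurable borel" by measurable
  have osc0: "0 \<le> osc_const" by (rule osc_const_nonneg)
  have oscn: "real n * (osc_const * (1 / real ?m) * (4 * real n ^ 2)) \<le> 1"
  proof -
    have "real n * (osc_const * (1 / real ?m) * (4 * real n ^ 2)) = 4 * osc_const / real n"
      using n0 by (simp add: power2_eq_square power4_eq_xxxx)
    then show ?thesis using osc_n n0 by simp
  qed
  define T where "T = {w \<in> space (Draws n). \<exists>i\<in>{1..n}. tau n < \<bar>snd (w i)\<bar>}"
  note T = measure_tail[OF n, folded T_def]
  let ?p = "real ((7 * n ^ 4)\<^sup>2) * (4 * (real n powr (- (4 * r)) / real n ^ 20))"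
  have expc: "2 * exp (- (3/4 * c)) + 2 * exp (- (3/4 * c')) \<le> 4 * (real n powr (- (4 * r)) / real n ^ 20)"
    if "700 * ln (real n) + 8 * r * ln (real n) \<le> c" "700 * ln (real n) + 8 * r * ln (real n) \<le> c'" for c c'
    using exp_c_le[OF n that(1)] exp_c_le[OF n that(2)] by linarith
  define P where "P = (\<lambda>\<eta> Bad. Bad \<in> sets (Draws n) \<and> D.prob Bad \<le> ?p \<and>
      (\<forall>w\<in>space (Draws n). w \<notin> Bad \<longrightarrow> (\<forall>i\<in>{1..n}. \<bar>snd (w i)\<bar> \<le> tau n) \<longrightarrow> (\<forall>a\<in>annulus.
      \<bar>F_hat n (data ?F n w) (E_mat a \<eta>) t - (\<integral>x. weight (E_mat a \<eta>) t x * ?F x \<partial>G)\<bar>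
      \<le> (?Fm * C1 n + C2 n) * (\<eta> * real n) powr (-1/2))))"
  have "\<exists>Bad. P \<eta> Bad" if \<eta>: "\<eta> \<in> bandwidths \<omega> n" for \<eta>
  proof -
    note b = bandwidth[OF n \<eta>]
    let ?\<Lambda> = "osc_const * (1 / real ?m) / \<eta>\<^sup>2"
    have "1 / \<eta>\<^sup>2 \<le> 4 * real n ^ 2"
    proof -
      have "(1 / (2 * real n))\<^sup>2 \<le> \<eta>\<^sup>2" using b(4) n0 by (intro power_mono) auto
      then show ?thesis using b(1) n0 by (simp add: field_simps power2_eq_square)
    qed
    then have "real n * (osc_const * (1 / real ?m) * (1 / \<eta>\<^sup>2)) \<le> real n * (osc_const * (1 / real ?m) * (4 * real n ^ 2))"
      using osc0 by (intro mult_left_mono) auto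
    then have \<Lambda>: "real n * ?\<Lambda> \<le> 1" using oscn by simp
    have bd: "\<bar>?F x\<bar> \<le> ?Fm" if a: "a \<in> annulus" and nz: "weight (E_mat a \<eta>) t x \<noteq> 0" for a x
    proof -
      have "x \<in> square (5/2)"
        by (rule E_mat_support[OF a b(1,2) t weight_support(1)[OF E_mat_localized[OF a b(1,2) t] nz]])
      from supF(1)[OF f this, of \<theta>] show ?thesis by linarith
    qed
    have "\<exists>Bad\<in>sets (Draws n).
      D.prob Bad \<le> real ((2 * 1 * ?m + 1)\<^sup>2) * (2 * exp (- (3/4 * c1 n)) + 2 * exp (- (3/4 * c2 n))) \<and>
      (\<forall>w\<in>space (Draws n) - Bad. (\<forall>i\<in>{1..n}. \<bar>snd (w i)\<bar> \<le> tau n) \<longrightarrow> (\<forall>a\<in>annulus.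
        \<bar>(\<Sum>i=1..n. weight (E_mat a \<eta>) t (fst (w i)) * (?F (fst (w i)) + snd (w i))) / real n - (\<integral>x. weight (E_mat a \<eta>) t x * ?F x \<partial>G)\<bar>
        \<le> deviation_bound (c1 n) ?Fm ?Fm \<eta> n + deviation_bound (c2 n) (max sigma 1) (tau n) \<eta> n))"
      by (rule family_deviation[where S=annulus and R=1 and m="?m" and n=n and E="\<lambda>a. E_mat a \<eta>" and v="\<lambda>_. t" and \<phi>="?F"
            and \<rho>=\<eta> and D="?Fm" and c="c1 n" and c'="c2 n" and \<Lambda>="?\<Lambda>",
            OF annulus_square n0(2) n E_mat_localized[OF _ b(1,2) t] det_E_mat_le[OF _ b(1)] b(1,2)
              weight_osc_direction[OF _ _ b(1,2) t] \<Lambda> Fmeas bd Fm c_ge_16(1,2)[OF n]])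
    then obtain Bad where Bad: "Bad \<in> sets (Draws n)"
      "D.prob Bad \<le> real ((2 * 1 * ?m + 1)\<^sup>2) * (2 * exp (- (3/4 * c1 n)) + 2 * exp (- (3/4 * c2 n)))"
      "\<And>w a. w \<in> space (Draws n) \<Longrightarrow> w \<notin> Bad \<Longrightarrow> \<forall>i\<in>{1..n}. \<bar>snd (w i)\<bar> \<le> tau n \<Longrightarrow> a \<in> annulus \<Longrightarrow>
        \<bar>(\<Sum>i=1..n. weight (E_mat a \<eta>) t (fst (w i)) * (?F (fst (w i)) + snd (w i))) / real n - (\<integral>x. weight (E_mat a \<eta>) t x * ?F x \<partial>G)\<bar>
        \<le> deviation_bound (c1 n) ?Fm ?Fm \<eta> n + deviation_bound (c2 n) (max sigma 1) (tau n) \<eta> n"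
      by blast
    have p: "D.prob Bad \<le> ?p"
    proof -
      have "2 * 1 * ?m + 1 \<le> 7 * n ^ 4" using n0 by simp
      then have "real ((2 * 1 * ?m + 1)\<^sup>2) \<le> real ((7 * n ^ 4)\<^sup>2)" by (intro of_nat_mono power_mono) auto
      then have "real ((2 * 1 * ?m + 1)\<^sup>2) * (2 * exp (- (3/4 * c1 n)) + 2 * exp (- (3/4 * c2 n))) \<le> ?p"
        by (intro mult_mono expc c_ge n) auto
      then show ?thesis using Bad(2) by linarith
    qed
    have th: "deviation_bound (c1 n) ?Fm ?Fm \<eta> n + deviation_bound (c2 n) (max sigma 1) (tau n) \<eta> n
       \<le> (?Fm * C1 n + C2 n) * (\<eta> * real n) powr (-1/2)"
      unfolding distrib_right[of "?Fm * C1 n"]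
      by (intro add_mono threshold_C1 threshold_C2 n b(3) less_imp_le[OF Fm])
    show ?thesis
      unfolding P_def F_hat_data
    proof (intro exI[of _ Bad] conjI ballI impI)
      fix w a assume "w \<in> space (Draws n)" "w \<notin> Bad" "\<forall>i\<in>{1..n}. \<bar>snd (w i)\<bar> \<le> tau n" "a \<in> annulus"
      from Bad(3)[OF this]
      show "\<bar>(\<Sum>i=1..n. weight (E_mat a \<eta>) t (fst (w i)) * (?F (fst (w i)) + snd (w i))) / real n - (\<integral>x. weight (E_mat a \<eta>) t x * ?F x \<partial>G)\<bar>
        \<le> (?Fm * C1 n + C2 n) * (\<eta> * real n) powr (-1/2)" using th by (rule order_trans)
    qed (rule Bad(1), rule p)
  qed
  then obtain Bd where "\<And>\<eta>. \<eta> \<in> bandwidths \<omega> n \<Longrightarrow> P \<eta> (Bd \<eta>)" by metis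
  then have Bd: "\<And>\<eta>. \<eta> \<in> bandwidths \<omega> n \<Longrightarrow> Bd \<eta> \<in> sets (Draws n)"
    "\<And>\<eta>. \<eta> \<in> bandwidths \<omega> n \<Longrightarrow> D.prob (Bd \<eta>) \<le> ?p"
    "\<And>\<eta> w a. \<eta> \<in> bandwidths \<omega> n \<Longrightarrow> w \<in> space (Draws n) \<Longrightarrow> w \<notin> Bd \<eta> \<Longrightarrow> \<forall>i\<in>{1..n}. \<bar>snd (w i)\<bar> \<le> tau n \<Longrightarrow> a \<in> annulus \<Longrightarrow>
      \<bar>F_hat n (data ?F n w) (E_mat a \<eta>) t - (\<integral>x. weight (E_mat a \<eta>) t x * ?F x \<partial>G)\<bar>
      \<le> (?Fm * C1 n + C2 n) * (\<eta> * real n) powr (-1/2)"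
    unfolding P_def by blast+
  have "real n * (osc_const * (1 / real ?m) * (1 / ?h ^ 3)) \<le> real n * (osc_const * (1 / real ?m) * (4 * real n ^ 2))"
  proof (intro mult_left_mono)
    have "1 / ?h ^ 3 \<le> real n ^ 2" using h(1,3) n0 by (simp add: field_simps)
    then show "1 / ?h ^ 3 \<le> 4 * real n ^ 2" by (smt (verit) zero_le_power2)
  qed (use osc0 in auto)
  then have \<Lambda>: "real n * (osc_const * (1 / real ?m) / ?h ^ 3) \<le> 1" using oscn by simp
  have hsq: "0 < ?h\<^sup>2" "?h\<^sup>2 \<le> 1" using h(1) h1 by (auto simp: power_le_one)
  have "\<exists>Bad\<in>sets (Draws n).
    D.prob Bad \<le> real ((2 * 3 * ?m + 1)\<^sup>2) * (2 * exp (- (3/4 * c3 n)) + 2 * exp (- (3/4 * c4 n))) \<and>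
    (\<forall>w\<in>space (Draws n) - Bad. (\<forall>i\<in>{1..n}. \<bar>snd (w i)\<bar> \<le> tau n) \<longrightarrow> (\<forall>v\<in>square (5/2).
      \<bar>(\<Sum>i=1..n. weight (mat (1 / ?h)) v (fst (w i)) * (?F (fst (w i)) + snd (w i))) / real n - (\<integral>x. weight (mat (1 / ?h)) v x * ?F x \<partial>G)\<bar>
      \<le> deviation_bound (c3 n) L L (?h\<^sup>2) n + deviation_bound (c4 n) (max sigma 1) (tau n) (?h\<^sup>2) n))"
    by (rule family_deviation[where S="square (5/2)" and R=3 and m="?m" and n=n and E="\<lambda>_. mat (1 / ?h)" and v="\<lambda>v. v" and \<phi>="?F"
            and \<rho>="?h\<^sup>2" and D=L and c="c3 n" and c'="c4 n" and \<Lambda>="osc_const * (1 / real ?m) / ?h ^ 3",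
            OF square_5_2_3 n0(2) n mat_localized[OF h(1) h1] _ hsq
              weight_osc_centre[OF _ _ h(1) h1] \<Lambda> Fmeas holder_abs_le[OF \<beta> f] L c_ge_16(3,4)[OF n]])
      (simp_all add: det_mat_2 power_one_over)
  then obtain Bc where Bc: "Bc \<in> sets (Draws n)"
    "D.prob Bc \<le> real ((2 * 3 * ?m + 1)\<^sup>2) * (2 * exp (- (3/4 * c3 n)) + 2 * exp (- (3/4 * c4 n)))"
    "\<And>w v. w \<in> space (Draws n) \<Longrightarrow> w \<notin> Bc \<Longrightarrow> \<forall>i\<in>{1..n}. \<bar>snd (w i)\<bar> \<le> tau n \<Longrightarrow> v \<in> square (5/2) \<Longrightarrow>
      \<bar>(\<Sum>i=1..n. weight (mat (1 / ?h)) v (fst (w i)) * (?F (fst (w i)) + snd (w i))) / real n - (\<integral>x. weight (mat (1 / ?h)) v x * ?F x \<partial>G)\<bar>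
      \<le> deviation_bound (c3 n) L L (?h\<^sup>2) n + deviation_bound (c4 n) (max sigma 1) (tau n) (?h\<^sup>2) n"
    by blast
  have pc: "D.prob Bc \<le> ?p"
  proof -
    have "2 * 3 * ?m + 1 \<le> 7 * n ^ 4" using n0 by simp
    then have "real ((2 * 3 * ?m + 1)\<^sup>2) \<le> real ((7 * n ^ 4)\<^sup>2)" by (intro of_nat_mono power_mono) auto
    then have "real ((2 * 3 * ?m + 1)\<^sup>2) * (2 * exp (- (3/4 * c3 n)) + 2 * exp (- (3/4 * c4 n))) \<le> ?p"
      by (intro mult_mono expc c_ge n) auto
    then show ?thesis using Bc(2) by linarith
  qed
  define Bad where "Bad = T \<union> ((\<Union>\<eta>\<in>bandwidths \<omega> n. Bd \<eta>) \<union> Bc)"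
  note fin = finite_bandwidths[OF n]
  have UB: "(\<Union>\<eta>\<in>bandwidths \<omega> n. Bd \<eta>) \<in> sets (Draws n)" using fin Bd(1) by auto
  show ?thesis
  proof (intro bexI[of _ Bad] conjI ballI)
    show "Bad \<in> sets (Draws n)" unfolding Bad_def using T(1) UB Bc(1) by auto
    have p0: "0 \<le> ?p" by simp
    have "D.prob (\<Union>\<eta>\<in>bandwidths \<omega> n. Bd \<eta>) \<le> (\<Sum>\<eta>\<in>bandwidths \<omega> n. D.prob (Bd \<eta>))"
      by (rule D.finite_measure_subadditive_finite) (use fin Bd in auto)
    also have "\<dots> \<le> (\<Sum>\<eta>\<in>bandwidths \<omega> n. ?p)" by (rule sum_mono[OF Bd(2)])
    also have "\<dots> = real (card (bandwidths \<omega> n)) * ?p" by simp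
    also have "\<dots> \<le> real (2 * n + 1) * ?p" using fin(2) by (intro mult_right_mono p0 of_nat_mono)
    finally have "D.prob (\<Union>\<eta>\<in>bandwidths \<omega> n. Bd \<eta>) + D.prob Bc \<le> real (2 * n + 1) * ?p + ?p" using pc by linarith
    also have "\<dots> = real (2 * n + 2) * ?p"
    proof -
      have "real (2 * n + 1) * x + x = real (2 * n + 2) * x" for x :: real by (simp add: algebra_simps)
      then show ?thesis .
    qed
    also have "\<dots> \<le> real (4 * n) * ?p" using n3 by (intro mult_right_mono p0 of_nat_mono) simp
    also have "\<dots> = (784 / real n ^ 11) * real n powr (- (4 * r))"
    proof -
      have "real (4 * n) * real ((7 * n ^ 4)\<^sup>2) * 4 * real n ^ 11 = 784 * real n ^ 20"
        by (simp add: power_mult_distrib flip: power_mult power_add power_Suc)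
      then have H: "real (4 * n) * real ((7 * n ^ 4)\<^sup>2) * 4 / real n ^ 20 = 784 / real n ^ 11"
        using n0(1) by (simp add: frac_eq_eq)
      have G: "a * (y * (4 * (x / z))) = (a * y * 4 / z) * x" for a y x z :: real by simp
      show ?thesis by (rule trans[OF G]) (simp only: H)
    qed
    also have "\<dots> \<le> 1 * real n powr (- (4 * r))"
    proof (rule mult_right_mono)
      have "(784::real) \<le> 3 ^ 11" by simp
      also have "(3::real) ^ 11 \<le> real n ^ 11" using n3 by (intro power_mono) auto
      finally show "784 / real n ^ 11 \<le> 1" using n0 by simp
    qed simp
    finally have 1: "D.prob (\<Union>\<eta>\<in>bandwidths \<omega> n. Bd \<eta>) + D.prob Bc \<le> real n powr (- (4 * r))" by simp
    have "D.prob Bad \<le> D.prob T + D.prob ((\<Union>\<eta>\<in>bandwidths \<omega> n. Bd \<eta>) \<union> Bc)"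
      unfolding Bad_def by (rule measure_Un_le[OF T(1)]) (use UB Bc in auto)
    also have "D.prob ((\<Union>\<eta>\<in>bandwidths \<omega> n. Bd \<eta>) \<union> Bc) \<le> D.prob (\<Union>\<eta>\<in>bandwidths \<omega> n. Bd \<eta>) + D.prob Bc"
      by (rule measure_Un_le[OF UB Bc(1)])
    finally have "D.prob Bad \<le> 2 * \<Upsilon> * real n powr (- (4 * r)) + real n powr (- (4 * r))" using T(2) 1 by linarith
    then show "D.prob Bad \<le> (1 + 2 * \<Upsilon>) * real n powr (- (4 * r))" by (simp add: algebra_simps)
    have tr: "\<forall>i\<in>{1..n}. \<bar>snd (w i)\<bar> \<le> tau n" if "w \<in> space (Draws n)" "w \<notin> Bad" for w
      using that unfolding Bad_def T_def by force
    fix w assume "w \<in> space (Draws n) - Bad"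
    then have w: "w \<in> space (Draws n)" "w \<notin> Bad" by auto
    show "\<bar>F_hat n (data ?F n w) (E_mat a \<eta>) t - (\<integral>x. weight (E_mat a \<eta>) t x * ?F x \<partial>G)\<bar>
      \<le> (?Fm * C1 n + C2 n) * (\<eta> * real n) powr (-1/2)" if "\<eta> \<in> bandwidths \<omega> n" "a \<in> annulus" for \<eta> a
      using w that by (intro Bd(3) tr) (auto simp: Bad_def)
    fix v assume v: "v \<in> square (5/2)"
    have "\<bar>F_hat n (data ?F n w) (mat (1 / ?h)) v - (\<integral>x. weight (mat (1 / ?h)) v x * ?F x \<partial>G)\<bar>
      \<le> deviation_bound (c3 n) L L (?h\<^sup>2) n + deviation_bound (c4 n) (max sigma 1) (tau n) (?h\<^sup>2) n"
      unfolding F_hat_data using w by (intro Bc(3) tr v) (auto simp: Bad_def)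
    also have "\<dots> \<le> L * ((real n * ?h\<^sup>2) powr (-1/2) * C3 n) + (real n * ?h\<^sup>2) powr (-1/2) * C4 n"
      by (intro add_mono threshold_C3 threshold_C4 n less_imp_le[OF L])
    finally show "\<bar>F_hat n (data ?F n w) (mat (1 / ?h)) v - (\<integral>x. weight (mat (1 / ?h)) v x * ?F x \<partial>G)\<bar>
      \<le> L * ((real n * ?h\<^sup>2) powr (-1/2) * C3 n) + (real n * ?h\<^sup>2) powr (-1/2) * C4 n" .
  qed
qed

end

section \<open>The oracle inequality\<close>

context single_index_model
begin

lemma F_hat_inf_eq:
  "F_hat_inf n d = 2 * (SUP v \<in> square (5/2). \<bar>F_hat n d (mat (1 / h_frak \<omega> n)) v\<bar>) + 2 * C5 n"
proof -
  have "1 / real n * (\<Sum>i=1..n. 1 / g (fst (d i)) * K_frak n (fst (d i) - v) * snd (d i)) = F_hat n d (mat (1 / h_frak \<omega> n)) v" for v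
    unfolding F_hat_eq K_frak_weight by simp
  then show ?thesis by (simp only: F_hat_inf_def)
qed

text \<open>
  The statistic \<open>F_hat_inf\<close> overestimates the supremum of the regression function, which makes the
  random threshold \<open>TH\<close> large enough, and it is bounded, which keeps \<open>TH\<close> of the right order.
\<close>

lemma F_hat_inf_bounds:
  assumes n: "1 \<le> ln (real n)" and h1: "h_frak \<omega> n \<le> 1" and f: "f \<in> holder_class \<beta> L" and \<theta>: "\<theta> \<in> sphere 0 1"
    and mod: "\<And>x y. \<bar>x - y\<bar> \<le> h_frak \<omega> n \<Longrightarrow> \<bar>f x - f y\<bar> \<le> 1"
    and eps: "\<epsilon> \<le> 1/4"
    and dev: "\<And>v. v \<in> square (5/2) \<Longrightarrow>
        \<bar>F_hat n d (mat (1 / h_frak \<omega> n)) v - (\<integral>x. weight (mat (1 / h_frak \<omega> n)) v x * f (x \<bullet> \<theta>) \<partial>G)\<bar>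
        \<le> \<epsilon> + (real n * (h_frak \<omega> n)\<^sup>2) powr (-1/2) * C4 n"
  shows "supF f \<theta> + 1/2 \<le> F_hat_inf n d"
    "F_hat_inf n d \<le> 2 * (K1\<^sup>2 * L + 1/4 + (real n * (h_frak \<omega> n)\<^sup>2) powr (-1/2) * C4 n) + 2 * C5 n"
proof -
  let ?s4 = "(real n * (h_frak \<omega> n)\<^sup>2) powr (-1/2) * C4 n" and ?A = "\<lambda>v. F_hat n d (mat (1 / h_frak \<omega> n)) v"
  let ?S = "SUP v \<in> square (5/2). \<bar>?A v\<bar>"
  note lb = local_average_bias[OF f h_frak_bounds(1)[OF n] h1 _ \<theta> mod]
  have up: "\<bar>?A v\<bar> \<le> K1\<^sup>2 * L + 1/4 + ?s4" if "v \<in> square (5/2)" for v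
    using lb(2)[OF that] dev[OF that] eps by linarith
  have z: "(0::real^2) \<in> square (5/2)" by (simp add: square_def)
  have bdd: "bdd_above ((\<lambda>v. \<bar>?A v\<bar>) ` square (5/2))" by (rule bdd_aboveI2) (rule up)
  have "?S \<le> K1\<^sup>2 * L + 1/4 + ?s4" by (rule cSUP_least) (use z up in auto)
  then show "F_hat_inf n d \<le> 2 * (K1\<^sup>2 * L + 1/4 + ?s4) + 2 * C5 n" unfolding F_hat_inf_eq
    by (intro add_right_mono mult_left_mono) auto
  have "supF f \<theta> \<le> ?S + 1/4 + ?s4 + K1\<^sup>2"
    unfolding supF_def
  proof (rule cSUP_least)
    fix v :: "real^2" assume v: "v \<in> square (5/2)"
    have "\<bar>?A v\<bar> \<le> ?S" by (rule cSUP_upper[OF v bdd])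
    then show "\<bar>f (v \<bullet> \<theta>)\<bar> \<le> ?S + 1/4 + ?s4 + K1\<^sup>2" using lb(1)[OF v] dev[OF v] eps by linarith
  qed (use z in auto)
  then show "supF f \<theta> + 1/2 \<le> F_hat_inf n d"
    unfolding F_hat_inf_eq C5_def using supF(2)[OF f, of \<theta>] by (simp add: distrib_left)
qed

lemma F_hat_abs_le:
  assumes a: "a \<in> annulus" and \<eta>: "0 < \<eta>" "\<eta> \<le> 1" and t: "t \<in> square (1/2)"
  shows "\<bar>F_hat n d (E_mat a \<eta>) t\<bar> \<le> Kinf\<^sup>2 / (gl * \<eta>) * ((\<Sum>i=1..n. \<bar>snd (d i)\<bar>) / real n)"
proof -
  have w: "\<bar>weight (E_mat a \<eta>) t x\<bar> \<le> Kinf\<^sup>2 / (gl * \<eta>)" for x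
  proof -
    have "\<bar>weight (E_mat a \<eta>) t x\<bar> \<le> det (E_mat a \<eta>) * Kinf\<^sup>2 / gl" by (rule weight_le[OF E_mat_localized[OF a \<eta> t]])
    also have "\<dots> \<le> (1 / \<eta>) * Kinf\<^sup>2 / gl"
      using det_E_mat_le[OF a \<eta>(1)] design by (intro divide_right_mono mult_right_mono) auto
    finally show ?thesis by (simp add: mult.commute)
  qed
  have "\<bar>\<Sum>i=1..n. weight (E_mat a \<eta>) t (fst (d i)) * snd (d i)\<bar> \<le> (\<Sum>i=1..n. \<bar>weight (E_mat a \<eta>) t (fst (d i)) * snd (d i)\<bar>)"
    by (rule sum_abs)
  also have "\<dots> \<le> (\<Sum>i=1..n. Kinf\<^sup>2 / (gl * \<eta>) * \<bar>snd (d i)\<bar>)"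
    unfolding abs_mult by (intro sum_mono mult_right_mono w) simp
  also have "\<dots> = Kinf\<^sup>2 / (gl * \<eta>) * (\<Sum>i=1..n. \<bar>snd (d i)\<bar>)" by (simp add: sum_distrib_left)
  finally have "\<bar>\<Sum>i=1..n. weight (E_mat a \<eta>) t (fst (d i)) * snd (d i)\<bar> / real n \<le> Kinf\<^sup>2 / (gl * \<eta>) * (\<Sum>i=1..n. \<bar>snd (d i)\<bar>) / real n"
    by (rule divide_right_mono) simp
  then show ?thesis unfolding F_hat_eq by simp
qed

lemma sphere_nonempty: "sphere (0::real^2) 1 \<noteq> {}"
proof -
  have "axis 1 1 \<in> sphere (0::real^2) 1" by simp
  then show ?thesis by blast
qed

lemma C_nonneg:
  assumes n: "1 \<le> ln (real n)"
  shows "0 \<le> C1 n" "0 \<le> C2 n"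
proof -
  have c: "0 \<le> c1 n" "0 \<le> c2 n" using c_ge_16[OF n] by linarith+
  show "0 \<le> C1 n" "0 \<le> C2 n" unfolding C1_def C2_def using c design by simp_all
qed

context
  fixes n :: nat and d :: sample and t :: "real^2"
  assumes n: "1 \<le> ln (real n)" and t: "t \<in> square (1/2)"
begin

abbreviation (input) "Fh a \<eta> \<equiv> F_hat n d (E_mat a \<eta>) t"

lemma Fh_minus: "Fh (- a) \<eta> = Fh a \<eta>"
  unfolding E_mat_minus F_hat_eq weight_minus ..

text \<open>
  Exchanging the directions changes at most the sign of the vector, which an even kernel ignores.
\<close>

lemma Fh_pair_commute: "Fh (pair_vec \<nu> \<theta>) \<eta> = Fh (pair_vec \<theta> \<nu>) \<eta>"
  by (simp add: pair_vec_commute[of \<nu> \<theta>] Fh_minus)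

lemma Fh_bound:
  assumes \<eta>: "\<eta> \<in> bandwidths \<omega> n" and a: "a \<in> annulus" and b: "b \<in> annulus" and \<eta>': "\<eta>' \<in> bandwidths \<omega> n"
  shows "\<bar>Fh a \<eta> - Fh b \<eta>'\<bar> \<le> (Kinf\<^sup>2 / (gl * \<eta>) + Kinf\<^sup>2 / (gl * \<eta>')) * ((\<Sum>i=1..n. \<bar>snd (d i)\<bar>) / real n)"
  using F_hat_abs_le[OF a bandwidth(1,2)[OF n \<eta>] t, of n d] F_hat_abs_le[OF b bandwidth(1,2)[OF n \<eta>'] t, of n d]
  unfolding distrib_right by linarith

lemma finite_smaller: "finite {\<eta> \<in> bandwidths \<omega> n. \<eta> \<le> h}"
  using finite_bandwidths(1)[OF n] by simp

lemma R1_upper: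
  assumes \<theta>: "\<theta> \<in> sphere 0 1" and \<eta>: "\<eta> \<in> bandwidths \<omega> n" "\<eta> \<le> h" and \<nu>: "\<nu> \<in> sphere 0 1"
  shows "\<bar>Fh (pair_vec \<theta> \<nu>) \<eta> - Fh \<nu> \<eta>\<bar> \<le> R1 n d t \<theta> h + TH n d \<eta>"
proof -
  let ?s = "\<lambda>\<eta>. SUP \<nu> \<in> sphere 0 1. \<bar>F_hat n d (E_pair_mat \<theta> \<nu> \<eta>) t - F_hat n d (E_mat \<nu> \<eta>) t\<bar>"
  have bdd: "bdd_above ((\<lambda>\<nu>. \<bar>F_hat n d (E_pair_mat \<theta> \<nu> \<eta>) t - F_hat n d (E_mat \<nu> \<eta>) t\<bar>) ` sphere 0 1)"
    unfolding E_pair_mat_eq using pair_vec(1)[OF \<theta>] sphere_annulus Fh_bound[OF \<eta>(1) _ _ \<eta>(1)] by (intro bdd_aboveI2) blast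
  have "\<bar>Fh (pair_vec \<theta> \<nu>) \<eta> - Fh \<nu> \<eta>\<bar> \<le> ?s \<eta>"
    using cSUP_upper[OF \<nu> bdd] by (simp add: E_pair_mat_eq)
  moreover have "max 0 (?s \<eta> - TH n d \<eta>) \<le> R1 n d t \<theta> h"
    unfolding R1_def by (rule cSUP_upper[of \<eta>]) (use \<eta> finite_smaller in \<open>auto intro: bdd_above_finite\<close>)
  ultimately show ?thesis by linarith
qed

lemma R2_upper:
  assumes h: "h \<in> bandwidths \<omega> n" and \<eta>: "\<eta> \<in> bandwidths \<omega> n" "\<eta> \<le> h" and \<theta>: "\<theta> \<in> sphere 0 1"
  shows "\<bar>Fh \<theta> h - Fh \<theta> \<eta>\<bar> \<le> R2 n d t h + TH n d \<eta>"
proof -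
  let ?s = "\<lambda>\<eta>. SUP \<theta> \<in> sphere 0 1. \<bar>F_hat n d (E_mat \<theta> h) t - F_hat n d (E_mat \<theta> \<eta>) t\<bar>"
  have bdd: "bdd_above ((\<lambda>\<theta>. \<bar>F_hat n d (E_mat \<theta> h) t - F_hat n d (E_mat \<theta> \<eta>) t\<bar>) ` sphere 0 1)"
    using sphere_annulus Fh_bound[OF h _ _ \<eta>(1)] by (intro bdd_aboveI2) blast
  have "\<bar>Fh \<theta> h - Fh \<theta> \<eta>\<bar> \<le> ?s \<eta>" by (rule cSUP_upper[OF \<theta> bdd])
  moreover have "max 0 (?s \<eta> - TH n d \<eta>) \<le> R2 n d t h"
    unfolding R2_def by (rule cSUP_upper[of \<eta>]) (use \<eta> finite_smaller in \<open>auto intro: bdd_above_finite\<close>)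
  ultimately show ?thesis by linarith
qed

lemma R_nonneg:
  assumes h: "h \<in> bandwidths \<omega> n"
  shows "0 \<le> R1 n d t \<theta> h" "0 \<le> R2 n d t h"
proof -
  have "h \<in> {\<eta> \<in> bandwidths \<omega> n. \<eta> \<le> h}" using h by simp
  then show "0 \<le> R1 n d t \<theta> h" "0 \<le> R2 n d t h"
    unfolding R1_def R2_def using finite_smaller by (auto intro!: cSUP_upper2 bdd_above_finite)
qed

text \<open>
  At an oracle bandwidth \<open>hs\<close>, where the bias does not exceed the stochastic error, both \<open>R1\<close> for the
  true direction and \<open>R2\<close> vanish, so that every term of the criterion at the selected pair is at most
  \<open>TH hs\<close>. The selected estimator is then linked to the oracle one, at the bandwidth \<open>min h1 hs\<close>, by
  comparisons that these terms control; the link between the two directions is the pair matrix, which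
  is up to its sign the same for both orders of the directions.
\<close>

lemma oracle_inequality:
  assumes f: "f \<in> holder_class \<beta> L" and \<theta>: "\<theta> \<in> sphere 0 1"
    and dev: "\<And>\<eta> a. \<eta> \<in> bandwidths \<omega> n \<Longrightarrow> a \<in> annulus \<Longrightarrow>
        \<bar>Fh a \<eta> - (\<integral>x. weight (E_mat a \<eta>) t x * f (x \<bullet> \<theta>) \<partial>G)\<bar> \<le> (Fm * C1 n + C2 n) * (\<eta> * real n) powr (-1/2)"
    and Fm: "0 \<le> Fm" "Fm \<le> F_hat_inf n d"
    and hs: "hs \<in> bandwidths \<omega> n" and bias: "K1\<^sup>2 * L * hs powr \<beta> \<le> Kinf\<^sup>2 * sqrt (ln (real n)) * (hs * real n) powr (-1/2)"
    and \<theta>1: "\<theta>1 \<in> sphere 0 1" and h1: "h1 \<in> bandwidths \<omega> n"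
    and crit: "criterion n d t (\<theta>1, h1) \<le> criterion n d t (\<theta>, hs)"
  shows "\<bar>Fh \<theta>1 h1 - f (t \<bullet> \<theta>)\<bar> \<le> 6 * TH n d hs"
proof -
  define e where "e = (\<lambda>\<eta>. (\<eta> * real n) powr (-1/2))"
  define A where "A = (\<lambda>\<eta>. Kinf\<^sup>2 * sqrt (ln (real n)) * e \<eta>)"
  define N where "N = (\<lambda>\<eta>. (Fm * C1 n + C2 n) * e \<eta>)"
  define b where "b = (\<lambda>\<eta>. K1\<^sup>2 * L * \<eta> powr \<beta>)"
  define J where "J = (\<lambda>q. LINT y|lborel. \<K> y * f (t \<bullet> \<theta> + q * y))"
  note bw = bandwidth[OF n]
  have n0: "0 < real n" using n_ge_3[OF n] by simp
  have l0: "0 \<le> sqrt (ln (real n))" using n by simp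
  have e0: "0 \<le> e \<eta>" for \<eta> by (simp add: e_def)
  have e_mono: "e \<eta>' \<le> e \<eta>" if "0 < \<eta>" "\<eta> \<le> \<eta>'" for \<eta> \<eta>'
    unfolding e_def using that n0 by (intro powr_mono2') auto
  have TH_ge: "2 * A \<eta> + 2 * N \<eta> \<le> TH n d \<eta>" for \<eta>
  proof -
    have "(Kinf\<^sup>2 * sqrt (ln (real n)) + Fm * C1 n + C2 n) * e \<eta> \<le> (Kinf\<^sup>2 * sqrt (ln (real n)) + F_hat_inf n d * C1 n + C2 n) * e \<eta>"
      using Fm(2) C_nonneg(1)[OF n] e0 by (intro mult_right_mono add_right_mono add_left_mono) auto
    then show ?thesis unfolding TH_def A_def N_def by (simp add: e_def algebra_simps)
  qed
  have A0: "0 \<le> A \<eta>" and N0: "0 \<le> N \<eta>" for \<eta>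
    using Fm(1) C_nonneg[OF n] e0 l0 by (auto simp: A_def N_def)
  have TH0: "0 \<le> TH n d \<eta>" for \<eta> using TH_ge[of \<eta>] A0[of \<eta>] N0[of \<eta>] by linarith
  have A_mono: "A \<eta>' \<le> A \<eta>" and N_mono: "N \<eta>' \<le> N \<eta>" if "0 < \<eta>" "\<eta> \<le> \<eta>'" for \<eta> \<eta>'
    using e_mono[OF that] Fm(1) C_nonneg[OF n] l0 by (auto simp: A_def N_def intro!: mult_left_mono)
  have bA: "b \<eta> \<le> A \<eta>" if "\<eta> \<in> bandwidths \<omega> n" "\<eta> \<le> hs" for \<eta>
  proof -
    have "b \<eta> \<le> b hs" unfolding b_def using bw(1)[OF that(1)] that(2) \<beta> L by (intro mult_left_mono powr_mono2) auto
    also have "\<dots> \<le> A hs" using bias by (simp add: b_def A_def e_def)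
    also have "\<dots> \<le> A \<eta>" using that bw(1) by (intro A_mono) auto
    finally show ?thesis .
  qed
  have Z: "\<bar>Fh a \<eta> - J (across a \<theta>)\<bar> \<le> N \<eta> + A \<eta>"
    if \<eta>: "\<eta> \<in> bandwidths \<omega> n" "\<eta> \<le> hs" and a: "a \<in> annulus" "\<bar>along a \<theta>\<bar> \<le> 2" for a \<eta>
    using dev[OF \<eta>(1) a(1)] population_bias[OF f a bw(1,2)[OF \<eta>(1)] t] bA[OF \<eta>]
    unfolding J_def N_def b_def e_def by linarith
  have "J 0 = f (t \<bullet> \<theta>)" using K_integral by (simp add: J_def)
  then have true_dir: "\<bar>Fh \<theta> \<eta> - f (t \<bullet> \<theta>)\<bar> \<le> TH n d \<eta>" if \<eta>: "\<eta> \<in> bandwidths \<omega> n" "\<eta> \<le> hs" for \<eta>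
    using Z[OF \<eta> sphere_annulus[OF \<theta>] along_sphere[OF \<theta> \<theta>]] TH_ge[of \<eta>] A0[of \<eta>] N0[of \<eta>]
    unfolding across_self by linarith
  have pair: "\<bar>Fh (pair_vec \<theta> \<nu>) \<eta> - Fh \<nu> \<eta>\<bar> \<le> TH n d \<eta>" if \<eta>: "\<eta> \<in> bandwidths \<omega> n" "\<eta> \<le> hs" and \<nu>: "\<nu> \<in> sphere 0 1" for \<eta> \<nu>
    using Z[OF \<eta> pair_vec(1,2)[OF \<theta> \<nu>]] Z[OF \<eta> sphere_annulus[OF \<nu>] along_sphere[OF \<nu> \<theta>]] TH_ge[of \<eta>]
    unfolding pair_vec(3)[OF \<theta> \<nu>] by linarith
  have scale: "\<bar>Fh \<nu> hs - Fh \<nu> \<eta>\<bar> \<le> TH n d \<eta>" if \<eta>: "\<eta> \<in> bandwidths \<omega> n" "\<eta> \<le> hs" and \<nu>: "\<nu> \<in> sphere 0 1" for \<eta> \<nu>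
    using Z[OF \<eta> sphere_annulus[OF \<nu>] along_sphere[OF \<nu> \<theta>]] Z[OF hs order_refl sphere_annulus[OF \<nu>] along_sphere[OF \<nu> \<theta>]]
      TH_ge[of \<eta>] A_mono[OF bw(1)[OF \<eta>(1)] \<eta>(2)] N_mono[OF bw(1)[OF \<eta>(1)] \<eta>(2)] by linarith
  have ne: "{\<eta> \<in> bandwidths \<omega> n. \<eta> \<le> hs} \<noteq> {}" using hs by auto
  have R1_0: "R1 n d t \<theta> hs \<le> 0"
    unfolding R1_def
  proof (rule cSUP_least[OF ne])
    fix \<eta> assume "\<eta> \<in> {\<eta> \<in> bandwidths \<omega> n. \<eta> \<le> hs}"
    then have "(SUP \<nu> \<in> sphere 0 1. \<bar>F_hat n d (E_pair_mat \<theta> \<nu> \<eta>) t - F_hat n d (E_mat \<nu> \<eta>) t\<bar>) \<le> TH n d \<eta>"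
      unfolding E_pair_mat_eq by (intro cSUP_least[OF sphere_nonempty] pair) auto
    then show "max 0 ((SUP \<nu> \<in> sphere 0 1. \<bar>F_hat n d (E_pair_mat \<theta> \<nu> \<eta>) t - F_hat n d (E_mat \<nu> \<eta>) t\<bar>) - TH n d \<eta>) \<le> 0"
      by simp
  qed
  have R2_0: "R2 n d t hs \<le> 0"
    unfolding R2_def
  proof (rule cSUP_least[OF ne])
    fix \<eta> assume "\<eta> \<in> {\<eta> \<in> bandwidths \<omega> n. \<eta> \<le> hs}"
    then have "(SUP \<nu> \<in> sphere 0 1. \<bar>F_hat n d (E_mat \<nu> hs) t - F_hat n d (E_mat \<nu> \<eta>) t\<bar>) \<le> TH n d \<eta>"
      by (intro cSUP_least[OF sphere_nonempty] scale) auto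
    then show "max 0 ((SUP \<nu> \<in> sphere 0 1. \<bar>F_hat n d (E_mat \<nu> hs) t - F_hat n d (E_mat \<nu> \<eta>) t\<bar>) - TH n d \<eta>) \<le> 0"
      by simp
  qed
  have "R1 n d t \<theta>1 h1 + R2 n d t h1 + TH n d h1 \<le> TH n d hs"
    using crit R1_0 R2_0 by (simp add: criterion_def)
  then have sel: "R1 n d t \<theta>1 h1 \<le> TH n d hs" "R2 n d t h1 \<le> TH n d hs" "TH n d h1 \<le> TH n d hs"
    using R_nonneg(1)[OF h1, of \<theta>1] R_nonneg(2)[OF h1] TH0[of h1] by - linarith+
  define \<eta> where "\<eta> = min h1 hs"
  have \<eta>: "\<eta> \<in> bandwidths \<omega> n" "\<eta> \<le> h1" "\<eta> \<le> hs" using hs h1 by (auto simp: \<eta>_def min_def)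
  have TH\<eta>: "TH n d \<eta> \<le> TH n d hs" using sel(3) by (auto simp: \<eta>_def min_def)
  have s1: "\<bar>Fh \<theta>1 h1 - Fh \<theta>1 \<eta>\<bar> \<le> 2 * TH n d hs"
    using R2_upper[OF h1 \<eta>(1,2) \<theta>1] sel(2) TH\<eta> by linarith
  have s2: "\<bar>Fh (pair_vec \<theta> \<theta>1) \<eta> - Fh \<theta>1 \<eta>\<bar> \<le> TH n d hs"
    using pair[OF \<eta>(1,3) \<theta>1] TH\<eta> by linarith
  have s3: "\<bar>Fh (pair_vec \<theta> \<theta>1) \<eta> - Fh \<theta> \<eta>\<bar> \<le> 2 * TH n d hs"
    using R1_upper[OF \<theta>1 \<eta>(1,2) \<theta>] sel(1) TH\<eta> unfolding Fh_pair_commute[of \<theta>1 \<theta>] by linarith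
  have s4: "\<bar>Fh \<theta> \<eta> - f (t \<bullet> \<theta>)\<bar> \<le> TH n d hs"
    using true_dir[OF \<eta>(1,3)] TH\<eta> by linarith
  show ?thesis using s1 s2 s3 s4 by linarith
qed

end

end

section \<open>From the oracle inequality to the risk\<close>

lemma ennreal_powr_le:
  assumes "x \<le> ennreal A" "0 \<le> A" "0 \<le> a"
  shows "ennreal_powr x a \<le> ennreal (A powr a)"
proof -
  have "x < \<infinity>" using assms(1) by (rule le_less_trans) simp
  then have "x \<noteq> \<infinity>" by simp
  moreover have "enn2real x \<le> A" using assms by (metis enn2real_ennreal enn2real_mono ennreal_less_top)
  ultimately show ?thesis
    using assms by (auto simp: ennreal_powr_def intro!: ennreal_leI powr_mono2)
qed

lemma powr_pos: "0 < (x::real) \<Longrightarrow> 0 < x powr a"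
  by simp

lemma le_square_plus_inverse:
  fixes x \<delta> :: real
  assumes "0 < \<delta>"
  shows "x \<le> \<delta> * x\<^sup>2 + 1 / \<delta>"
proof -
  have "0 \<le> (\<delta> * x - 1)\<^sup>2" by simp
  then have "2 * (\<delta> * x) \<le> \<delta>\<^sup>2 * x\<^sup>2 + 1" by (simp add: power2_diff power_mult_distrib)
  moreover have "0 \<le> \<delta>\<^sup>2 * x\<^sup>2 + 1" by simp
  ultimately have "\<delta> * x \<le> \<delta>\<^sup>2 * x\<^sup>2 + 1" by linarith
  then have "\<delta> * x \<le> \<delta> * (\<delta> * x\<^sup>2 + 1 / \<delta>)" using assms by (simp add: power2_eq_square distrib_left mult.assoc)
  then show ?thesis using assms by simp
qed

context single_index_model
begin

subsection \<open>A crude bound on the error\<close>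

text \<open>
  A bound for the factor by which the estimator can enlarge the observations at the smallest bandwidth; the
  summand \<open>1\<close> accounts for the target.
\<close>

definition crude :: "nat \<Rightarrow> real" where
  "crude n = Kinf\<^sup>2 / (gl * (h_min \<omega> n / 2)) + 1"

text \<open>
  It dominates both the average size of the observations, whatever function of the class is the truth, and the
  target. The summand \<open>1\<close> keeps it at least \<open>1\<close>, where powers increase with the exponent.
\<close>

definition envelope :: "nat \<Rightarrow> sample \<Rightarrow> real" where
  "envelope n w = (\<Sum>i=1..n. 1 + L + \<bar>snd (w i)\<bar>) / real n"

definition mom_exp :: nat where "mom_exp = nat \<lceil>2 * r\<rceil>"

lemma mom_exp: "2 * r \<le> real mom_exp" "r \<le> real mom_exp"
proof -
  show "2 * r \<le> real mom_exp" unfolding mom_exp_def by linarith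
  then show "r \<le> real mom_exp" using r by linarith
qed

lemma h_min_pos_two: "2 \<le> n \<Longrightarrow> 0 < h_min \<omega> n"
proof -
  assume n: "2 \<le> n"
  then have "0 < ln (real n)" by simp
  then show ?thesis using n by (simp add: h_min_def)
qed

lemma crude_ge_1: "2 \<le> n \<Longrightarrow> 1 \<le> crude n"
  using h_min_pos_two[of n] design by (simp add: crude_def)

lemma crude_error:
  assumes n: "2 \<le> n" and t: "t \<in> square (1/2)" and f: "f \<in> holder_class \<beta> L"
    and \<theta>1: "\<theta>1 \<in> sphere 0 1" and h1: "h1 \<in> bandwidths \<omega> n"
  shows "\<bar>F_hat n (data (\<lambda>x. f (x \<bullet> \<theta>)) n w) (E_mat \<theta>1 h1) t - f (t \<bullet> \<theta>)\<bar> \<le> crude n * envelope n w"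
proof -
  let ?d = "data (\<lambda>x. f (x \<bullet> \<theta>)) n w" and ?M = "envelope n w"
  have hm: "0 < h_min \<omega> n" by (rule h_min_pos_two[OF n])
  have h: "h_min \<omega> n / 2 \<le> h1" "h1 \<le> 1" using h1 by (auto simp: bandwidths_def)
  then have h0: "0 < h1" using hm by linarith
  have "(\<Sum>i=1..n. \<bar>snd (?d i)\<bar>) \<le> (\<Sum>i=1..n. 1 + L + \<bar>snd (w i)\<bar>)"
  proof (rule sum_mono)
    fix i assume "i \<in> {1..n}"
    then have "snd (?d i) = f (fst (w i) \<bullet> \<theta>) + snd (w i)" by (simp add: data_def)
    then show "\<bar>snd (?d i)\<bar> \<le> 1 + L + \<bar>snd (w i)\<bar>"
      using holder_abs_le[OF \<beta> f, of "fst (w i) \<bullet> \<theta>"] by linarith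
  qed
  then have m: "(\<Sum>i=1..n. \<bar>snd (?d i)\<bar>) / real n \<le> ?M" unfolding envelope_def by (rule divide_right_mono) simp
  have "real n * L \<le> (\<Sum>i=1..n. 1 + L + \<bar>snd (w i)\<bar>)"
    using sum_mono[of "{1..n}" "\<lambda>_. L" "\<lambda>i. 1 + L + \<bar>snd (w i)\<bar>"] by simp
  then have LM: "L \<le> ?M" using n by (simp add: envelope_def field_simps)
  have "\<bar>F_hat n ?d (E_mat \<theta>1 h1) t\<bar> \<le> Kinf\<^sup>2 / (gl * h1) * ((\<Sum>i=1..n. \<bar>snd (?d i)\<bar>) / real n)"
    by (rule F_hat_abs_le[OF sphere_annulus[OF \<theta>1] h0 h(2) t])
  also have "\<dots> \<le> Kinf\<^sup>2 / (gl * (h_min \<omega> n / 2)) * ?M"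
    using h hm h0 design m by (intro mult_mono divide_left_mono mult_left_mono) (auto intro!: divide_nonneg_nonneg sum_nonneg mult_pos_pos)
  finally have "\<bar>F_hat n ?d (E_mat \<theta>1 h1) t\<bar> \<le> Kinf\<^sup>2 / (gl * (h_min \<omega> n / 2)) * ?M" .
  moreover have "\<bar>f (t \<bullet> \<theta>)\<bar> \<le> ?M" using holder_abs_le[OF \<beta> f, of "t \<bullet> \<theta>"] LM by linarith
  ultimately show ?thesis unfolding crude_def distrib_right by linarith
qed

lemma envelope_ge_1: "0 < n \<Longrightarrow> 1 \<le> envelope n w"
proof -
  assume n: "0 < n"
  have "real n \<le> (\<Sum>i=1..n. 1 + L + \<bar>snd (w i)\<bar>)"
    using sum_mono[of "{1..n}" "\<lambda>_. 1" "\<lambda>i. 1 + L + \<bar>snd (w i)\<bar>"] L by simp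
  then show ?thesis using n by (simp add: envelope_def)
qed

text \<open>
  An average is at most its largest summand.
\<close>

lemma envelope_power_le:
  assumes n: "0 < n"
  shows "envelope n w ^ m \<le> (\<Sum>i=1..n. (1 + L + \<bar>snd (w i)\<bar>) ^ m)"
proof -
  have "\<exists>j\<in>{1..n}. envelope n w \<le> 1 + L + \<bar>snd (w j)\<bar>"
  proof (rule ccontr)
    assume "\<not> ?thesis"
    then have "(\<Sum>i=1..n. 1 + L + \<bar>snd (w i)\<bar>) < (\<Sum>i=1..n. envelope n w)"
      using n by (intro sum_strict_mono) (auto simp: not_le)
    also have "\<dots> = (\<Sum>i=1..n. 1 + L + \<bar>snd (w i)\<bar>)" using n by (simp add: envelope_def)
    finally show False by simp
  qed
  then obtain j where j: "j \<in> {1..n}" "envelope n w \<le> 1 + L + \<bar>snd (w j)\<bar>" by blast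
  have "envelope n w ^ m \<le> (1 + L + \<bar>snd (w j)\<bar>) ^ m"
    using j(2) envelope_ge_1[OF n, of w] by (intro power_mono) auto
  also have "\<dots> \<le> (\<Sum>i=1..n. (1 + L + \<bar>snd (w i)\<bar>) ^ m)"
    using j(1) L by (intro member_le_sum) auto
  finally show ?thesis .
qed

lemma envelope_powr_le:
  assumes n: "0 < n" and a: "a \<le> real mom_exp"
  shows "envelope n w powr a \<le> (\<Sum>i=1..n. (1 + L + \<bar>snd (w i)\<bar>) ^ mom_exp)"
proof -
  have "envelope n w powr a \<le> envelope n w powr real mom_exp"
    using envelope_ge_1[OF n, of w] a by (intro powr_mono) auto
  also have "\<dots> = envelope n w ^ mom_exp" using envelope_ge_1[OF n, of w] by (intro powr_realpow) linarith
  finally show ?thesis using envelope_power_le[OF n, of w mom_exp] by linarith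
qed

text \<open>
  The bound of \<open>noise_moment\<close> for the moment of order \<open>mom_exp\<close> of a summand of the envelope.
\<close>

definition noise_mom :: real where
  "noise_mom = (\<Sum>k. (1 + L + real k + 1) ^ mom_exp * (2 * \<Upsilon> * exp (- \<Omega> * real k powr \<omega>)))"

lemma noise_mom_nonneg: "0 \<le> noise_mom"
  unfolding noise_mom_def
proof (rule suminf_nonneg)
  show "summable (\<lambda>k. (1 + L + real k + 1) ^ mom_exp * (2 * \<Upsilon> * exp (- \<Omega> * real k powr \<omega>)))"
    using summable_mult[OF summable_moment_tail[OF noise_constants(2,4), of "1 + L" mom_exp], of "2 * \<Upsilon>"] L by (simp add: ac_simps)
qed (use L noise_constants in auto)

lemma component_measurable: "i \<in> {1..n} \<Longrightarrow> (\<lambda>w. w i) \<in> measurable (Draws n) Joint"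
  by (rule measurable_component_singleton)

lemma nn_integral_envelope:
  "(\<integral>\<^sup>+w. ennreal (\<Sum>i=1..n. (1 + L + \<bar>snd (w i)\<bar>) ^ mom_exp) \<partial>Draws n) \<le> ennreal (real n * noise_mom)"
  "(\<lambda>w. ennreal (\<Sum>i=1..n. (1 + L + \<bar>snd (w i)\<bar>) ^ mom_exp)) \<in> borel_measurable (Draws n)"
proof -
  let ?\<phi> = "\<lambda>e. ennreal ((1 + L + \<bar>e\<bar>) ^ mom_exp)"
  have mJ: "(\<lambda>z. ?\<phi> (snd z)) \<in> borel_measurable Joint" by measurable
  have m: "(\<lambda>w. ?\<phi> (snd (w i))) \<in> borel_measurable (Draws n)" if "i \<in> {1..n}" for i
    by (rule measurable_compose[OF component_measurable[OF that] mJ])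
  have eq: "ennreal (\<Sum>i=1..n. (1 + L + \<bar>snd (w i)\<bar>) ^ mom_exp) = (\<Sum>i=1..n. ?\<phi> (snd (w i)))" for w :: sample
    using L by (intro sum_ennreal[symmetric]) auto
  show "(\<lambda>w. ennreal (\<Sum>i=1..n. (1 + L + \<bar>snd (w i)\<bar>) ^ mom_exp)) \<in> borel_measurable (Draws n)"
    unfolding eq by (rule borel_measurable_sum) (rule m)
  have one: "(\<integral>\<^sup>+w. ?\<phi> (snd (w i)) \<partial>Draws n) \<le> ennreal noise_mom" if i: "i \<in> {1..n}" for i
  proof -
    have d: "distr (Draws n) Joint (\<lambda>w. w i) = Joint"
      using distr_PiM_component[where M="\<lambda>_. Joint" and I="{1..n}" and i=i] prob_space_Joint i by blast
    have "(\<integral>\<^sup>+w. ?\<phi> (snd (w i)) \<partial>Draws n) = (\<integral>\<^sup>+z. ?\<phi> (snd z) \<partial>distr (Draws n) Joint (\<lambda>w. w i))"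
      by (rule nn_integral_distr[OF component_measurable[OF i], symmetric]) (use mJ in simp)
    also have "\<dots> = (\<integral>\<^sup>+x. \<integral>\<^sup>+e. ?\<phi> e \<partial>Noise \<partial>G)"
      unfolding d by (subst Noise.nn_integral_fst[OF mJ, symmetric]) simp
    also have "\<dots> = (\<integral>\<^sup>+e. ?\<phi> e \<partial>Noise)" using G.emeasure_space_1 by simp
    also have "\<dots> \<le> ennreal noise_mom"
      unfolding noise_mom_def by (rule noise_moment[OF noise_facts]) (use L in simp)
    finally show ?thesis .
  qed
  have "(\<integral>\<^sup>+w. ennreal (\<Sum>i=1..n. (1 + L + \<bar>snd (w i)\<bar>) ^ mom_exp) \<partial>Draws n) = (\<Sum>i=1..n. \<integral>\<^sup>+w. ?\<phi> (snd (w i)) \<partial>Draws n)"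
    unfolding eq by (rule nn_integral_sum) (rule m)
  also have "\<dots> \<le> (\<Sum>i=1..n. ennreal noise_mom)" by (rule sum_mono[OF one])
  also have "\<dots> = ennreal (real n * noise_mom)"
    using noise_mom_nonneg by (simp add: ennreal_mult ennreal_of_nat_eq_real_of_nat)
  finally show "(\<integral>\<^sup>+w. ennreal (\<Sum>i=1..n. (1 + L + \<bar>snd (w i)\<bar>) ^ mom_exp) \<partial>Draws n) \<le> ennreal (real n * noise_mom)" .
qed

lemma data_measurable:
  assumes [measurable]: "F \<in> borel_measurable borel"
  shows "data F n \<in> measurable (Draws n) (sample_space n)"
  unfolding data_def[abs_def] sample_space_def
proof (rule measurable_restrict)
  fix i assume i: "i \<in> {1..n}"
  have "(\<lambda>z. (fst z, F (fst z) + snd z)) \<in> borel_measurable Joint" by measurable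
  from measurable_compose[OF component_measurable[OF i] this]
  show "(\<lambda>w. (fst (w i), F (fst (w i)) + snd (w i))) \<in> borel_measurable (Draws n)" .
qed

lemma pointwise_risk_le:
  assumes [measurable]: "F \<in> borel_measurable borel"
    and le: "(\<integral>\<^sup>+w. ennreal (\<bar>Fest (data F n w) t - F t\<bar> powr r) \<partial>Draws n) \<le> ennreal A" and A: "0 \<le> A"
  shows "pointwise_risk r t (sample_law g p n F) Fest F \<le> ennreal (A powr (1 / r))"
  unfolding pointwise_risk_def
proof (rule ennreal_powr_le[OF _ A])
  have law: "sample_law g p n F = distr (Draws n) (sample_space n) (data F n)"
    by (simp add: sample_law_def data_def[abs_def])
  have "(\<integral>\<^sup>+d. ennreal (\<bar>Fest d t - F t\<bar> powr r) \<partial>sample_law g p n F) \<le> (\<integral>\<^sup>+w. ennreal (\<bar>Fest (data F n w) t - F t\<bar> powr r) \<partial>Draws n)"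
    unfolding law by (rule nn_integral_distr_le[OF data_measurable]) simp
  then show "(\<integral>\<^sup>+d. ennreal (\<bar>Fest d t - F t\<bar> powr r) \<partial>sample_law g p n F) \<le> ennreal A"
    using le by (rule order_trans)
  show "0 \<le> 1 / r" using r by simp
qed

lemma minimizer:
  assumes sel: "measurable_minimizer n t s" and w: "w \<in> space (Draws n)" and F: "F \<in> borel_measurable borel"
  shows "fst (s (data F n w)) \<in> sphere 0 1" "snd (s (data F n w)) \<in> bandwidths \<omega> n"
    "\<theta> \<in> sphere 0 1 \<Longrightarrow> h \<in> bandwidths \<omega> n \<Longrightarrow>
      criterion n (data F n w) t (fst (s (data F n w)), snd (s (data F n w))) \<le> criterion n (data F n w) t (\<theta>, h)"
proof -
  have "data F n w \<in> space (sample_space n)" by (rule measurable_space[OF data_measurable[OF F] w])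
  then have *: "s (data F n w) \<in> sphere 0 1 \<times> bandwidths \<omega> n"
    "\<forall>a \<in> sphere 0 1 \<times> bandwidths \<omega> n. criterion n (data F n w) t (s (data F n w)) \<le> criterion n (data F n w) t a"
    using sel by (auto simp: measurable_minimizer_def)
  show "fst (s (data F n w)) \<in> sphere 0 1" "snd (s (data F n w)) \<in> bandwidths \<omega> n"
    using *(1) by (simp_all add: mem_Times_iff)
  show "criterion n (data F n w) t (fst (s (data F n w)), snd (s (data F n w))) \<le> criterion n (data F n w) t (\<theta>, h)"
    if "\<theta> \<in> sphere 0 1" "h \<in> bandwidths \<omega> n"
    using *(2) that by simp
qed

lemma risk_crude:
  assumes n: "2 \<le> n" and t: "t \<in> square (1/2)" and f: "f \<in> holder_class \<beta> L"
    and sel: "measurable_minimizer n t (sel t)"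
  shows "pointwise_risk r t (sample_law g p n (\<lambda>x. f (x \<bullet> \<theta>))) (selected_estimator n sel) (\<lambda>x. f (x \<bullet> \<theta>))
    \<le> ennreal ((crude n powr r * (real n * noise_mom)) powr (1 / r))"
proof -
  note [measurable] = holder_measurable[OF \<beta> f]
  let ?F = "\<lambda>x::real^2. f (x \<bullet> \<theta>)"
  have F: "?F \<in> borel_measurable borel" by measurable
  have n0: "0 < n" using n by simp
  show ?thesis
  proof (rule pointwise_risk_le[OF F])
    have "(\<integral>\<^sup>+w. ennreal (\<bar>selected_estimator n sel (data ?F n w) t - ?F t\<bar> powr r) \<partial>Draws n)
        \<le> (\<integral>\<^sup>+w. ennreal (crude n powr r) * ennreal (\<Sum>i=1..n. (1 + L + \<bar>snd (w i)\<bar>) ^ mom_exp) \<partial>Draws n)"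
    proof (rule nn_integral_mono)
      fix w assume w: "w \<in> space (Draws n)"
      have "\<bar>selected_estimator n sel (data ?F n w) t - ?F t\<bar> \<le> crude n * envelope n w"
        unfolding selected_estimator_def by (rule crude_error[OF n t f minimizer(1,2)[OF sel w F]])
      then have "\<bar>selected_estimator n sel (data ?F n w) t - ?F t\<bar> powr r \<le> (crude n * envelope n w) powr r"
        using r by (intro powr_mono2) auto
      also have "\<dots> = crude n powr r * envelope n w powr r"
        using crude_ge_1[OF n] envelope_ge_1[OF n0, of w] by (simp add: powr_mult)
      also have "\<dots> \<le> crude n powr r * (\<Sum>i=1..n. (1 + L + \<bar>snd (w i)\<bar>) ^ mom_exp)"
        by (intro mult_left_mono envelope_powr_le[OF n0 mom_exp(2)]) simp
      finally show "ennreal (\<bar>selected_estimator n sel (data ?F n w) t - ?F t\<bar> powr r) \<le> ennreal (crude n powr r) * ennreal (\<Sum>i=1..n. (1 + L + \<bar>snd (w i)\<bar>) ^ mom_exp)"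
        using L by (subst ennreal_mult[symmetric]) (auto intro!: ennreal_leI sum_nonneg)
    qed
    also have "\<dots> = ennreal (crude n powr r) * (\<integral>\<^sup>+w. ennreal (\<Sum>i=1..n. (1 + L + \<bar>snd (w i)\<bar>) ^ mom_exp) \<partial>Draws n)"
      by (rule nn_integral_cmult[OF nn_integral_envelope(2)])
    also have "\<dots> \<le> ennreal (crude n powr r) * ennreal (real n * noise_mom)"
      by (intro mult_left_mono nn_integral_envelope(1)) simp
    also have "\<dots> = ennreal (crude n powr r * (real n * noise_mom))"
      using noise_mom_nonneg by (simp add: ennreal_mult)
    finally show "(\<integral>\<^sup>+w. ennreal (\<bar>selected_estimator n sel (data ?F n w) t - ?F t\<bar> powr r) \<partial>Draws n) \<le> ennreal (crude n powr r * (real n * noise_mom))" .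
    show "0 \<le> crude n powr r * (real n * noise_mom)" using noise_mom_nonneg by simp
  qed
qed

subsection \<open>Large samples\<close>

definition rate_exp :: real where "rate_exp = \<beta> / (2 * \<beta> + 1)"

text \<open>
  Chosen such that bias and stochastic error agree exactly at the bandwidth \<open>balance n\<close>.
\<close>

definition bal_const :: real where
  "bal_const = (Kinf\<^sup>2 / (K1\<^sup>2 * L)) powr (2 / (2 * \<beta> + 1))"

definition balance :: "nat \<Rightarrow> real" where
  "balance n = bal_const * (ln (real n) / real n) powr (1 / (2 * \<beta> + 1))"

lemma bal_base_pos: "0 < Kinf\<^sup>2 / (K1\<^sup>2 * L)"
  using Kinf_ge_1 K1_ge_1 L by simp

lemma bal_const_pos: "0 < bal_const"
  unfolding bal_const_def by (rule powr_pos[OF bal_base_pos])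

lemma log_ratio_pos:
  assumes n: "1 \<le> ln (real n)"
  shows "0 < ln (real n) / real n"
proof (rule divide_pos_pos)
  show "0 < ln (real n)" using n by linarith
  show "0 < real n" using n_ge_3[OF n] by simp
qed

lemma balance_pos: "1 \<le> ln (real n) \<Longrightarrow> 0 < balance n"
proof -
  assume n: "1 \<le> ln (real n)"
  show ?thesis unfolding balance_def
    by (intro mult_pos_pos bal_const_pos powr_pos log_ratio_pos n)
qed

lemma balance_bias:
  assumes n: "1 \<le> ln (real n)" and h: "0 < h" "h \<le> balance n"
  shows "K1\<^sup>2 * L * h powr \<beta> \<le> Kinf\<^sup>2 * sqrt (ln (real n)) * (h * real n) powr (-1/2)"
proof -
  have n0: "0 < real n" using n_ge_3[OF n] by simp
  let ?q = "ln (real n) / real n"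
  have q: "0 < ?q" by (rule log_ratio_pos[OF n])
  have e: "(2 / (2 * \<beta> + 1)) * (\<beta> + 1/2) = 1" "(1 / (2 * \<beta> + 1)) * (\<beta> + 1/2) = 1/2"
    using \<beta> by (simp_all add: field_simps)
  have "h powr (\<beta> + 1/2) \<le> balance n powr (\<beta> + 1/2)" using h \<beta> by (intro powr_mono2) auto
  also have "\<dots> = (Kinf\<^sup>2 / (K1\<^sup>2 * L)) powr ((2 / (2 * \<beta> + 1)) * (\<beta> + 1/2)) * ?q powr ((1 / (2 * \<beta> + 1)) * (\<beta> + 1/2))"
    unfolding balance_def bal_const_def by (simp only: powr_mult powr_ge_zero powr_powr)
  also have "\<dots> = Kinf\<^sup>2 / (K1\<^sup>2 * L) * sqrt ?q"
    unfolding e by (simp only: powr_one[OF less_imp_le[OF bal_base_pos]] powr_half_sqrt[OF less_imp_le[OF q]])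
  finally have "K1\<^sup>2 * L * h powr (\<beta> + 1/2) \<le> K1\<^sup>2 * L * (Kinf\<^sup>2 / (K1\<^sup>2 * L) * sqrt ?q)"
    using L by (intro mult_left_mono) auto
  also have "\<dots> = Kinf\<^sup>2 * (sqrt (ln (real n)) / sqrt (real n))"
    using K1_ge_1 L by (simp add: real_sqrt_divide)
  finally have 1: "K1\<^sup>2 * L * (h powr \<beta> * sqrt h) \<le> Kinf\<^sup>2 * (sqrt (ln (real n)) / sqrt (real n))"
    using h by (simp add: powr_add powr_half_sqrt)
  have "K1\<^sup>2 * L * h powr \<beta> = K1\<^sup>2 * L * (h powr \<beta> * sqrt h) / sqrt h" using h by simp
  also have "\<dots> \<le> Kinf\<^sup>2 * (sqrt (ln (real n)) / sqrt (real n)) / sqrt h" using 1 h by (intro divide_right_mono) auto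
  also have "\<dots> = Kinf\<^sup>2 * sqrt (ln (real n)) * (h * real n) powr (-1/2)"
    using h n0 by (simp add: powr_minus_half real_sqrt_mult)
  finally show ?thesis .
qed

lemma balance_error:
  assumes n: "1 \<le> ln (real n)" and h: "balance n / 2 \<le> h"
  shows "sqrt (ln (real n)) * (h * real n) powr (-1/2) \<le> sqrt (2 / bal_const) * (ln (real n) / real n) powr rate_exp"
proof -
  have n0: "0 < real n" using n_ge_3[OF n] by simp
  let ?q = "ln (real n) / real n"
  have q: "0 < ?q" by (rule log_ratio_pos[OF n])
  have b: "0 < balance n" by (rule balance_pos[OF n])
  have h0: "0 < h" using b h by linarith
  have "(h * real n) powr (-1/2) \<le> (balance n / 2 * real n) powr (-1/2)"
    using b n0 h by (intro powr_mono2') auto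
  then have "sqrt (ln (real n)) * (h * real n) powr (-1/2) \<le> sqrt (ln (real n)) * (balance n / 2 * real n) powr (-1/2)"
    using n by (intro mult_left_mono) auto
  also have "\<dots> = sqrt ?q * (sqrt 2 / sqrt (balance n))"
    using b n0 by (simp add: powr_minus_half real_sqrt_mult real_sqrt_divide)
  also have "sqrt (balance n) = sqrt bal_const * ?q powr (1 / (2 * \<beta> + 1) * (1/2))"
    unfolding balance_def real_sqrt_mult using q by (simp only: powr_half_sqrt[symmetric] powr_ge_zero powr_powr)
  also have "sqrt ?q * (sqrt 2 / (sqrt bal_const * ?q powr (1 / (2 * \<beta> + 1) * (1/2))))
      = sqrt (2 / bal_const) * (?q powr (1/2) / ?q powr (1 / (2 * \<beta> + 1) * (1/2)))"
    using q by (simp add: real_sqrt_divide powr_half_sqrt ac_simps)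
  also have "?q powr (1/2) / ?q powr (1 / (2 * \<beta> + 1) * (1/2)) = ?q powr rate_exp"
  proof -
    have "1/2 - 1 / (2 * \<beta> + 1) * (1/2) = rate_exp" using \<beta> by (simp add: rate_exp_def field_simps)
    then show ?thesis by (simp only: powr_diff[symmetric])
  qed
  finally show ?thesis .
qed

text \<open>
  The largest power of \<open>1/2\<close> that does not exceed \<open>balance n\<close>.
\<close>

lemma oracle_bandwidth:
  assumes n: "1 \<le> ln (real n)" and b: "h_min \<omega> n \<le> balance n" "balance n \<le> 1"
  obtains hs where "hs \<in> bandwidths \<omega> n" "hs \<le> balance n" "balance n / 2 \<le> hs"
proof -
  let ?P = "\<lambda>k. (1/2::real) ^ k \<le> balance n"
  have ex: "\<exists>k. ?P k"
    using real_arch_pow_inv[OF balance_pos[OF n], of "1/2"] by (auto intro: less_imp_le)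
  define k where "k = (LEAST k. ?P k)"
  have k: "?P k" unfolding k_def using ex by (rule LeastI_ex)
  have lo: "balance n / 2 \<le> (1/2) ^ k"
  proof (cases k)
    case 0
    then show ?thesis using b balance_pos[OF n] by simp
  next
    case (Suc j)
    then have "\<not> ?P j" using not_less_Least[of j ?P] by (simp add: k_def)
    then show ?thesis by (simp add: Suc)
  qed
  have "(1/2) ^ k \<in> bandwidths \<omega> n"
    unfolding bandwidths_def using k lo b by auto
  then show ?thesis using that k lo by blast
qed

lemma rate_eq: "rate n \<beta> L = L powr (1 / (2 * \<beta> + 1)) * (ln (real n) / real n) powr rate_exp"
  by (simp add: rate_def rate_exp_def)

text \<open>
  The rate is slower than \<open>n powr (-1/2)\<close>, since \<open>rate_exp\<close> is below \<open>1/2\<close> and \<open>ln n\<close> is at least \<open>1\<close>.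
\<close>

lemma n_powr_le_rate:
  assumes n: "1 \<le> ln (real n)"
  shows "real n powr (- (r/2)) \<le> ((ln (real n) / real n) powr rate_exp) powr r"
proof -
  have n1: "1 \<le> real n" using n_ge_3[OF n] by simp
  have e: "0 \<le> rate_exp" "rate_exp \<le> 1/2" using \<beta> by (auto simp: rate_exp_def field_simps)
  have "real n powr (- (1/2)) \<le> real n powr (- rate_exp)" using n1 e by (intro powr_mono) auto
  also have "\<dots> = (1 / real n) powr rate_exp" using n1 by (simp add: powr_minus_divide powr_divide)
  also have "\<dots> \<le> (ln (real n) / real n) powr rate_exp"
    using n n1 e by (intro powr_mono2 divide_right_mono) auto
  finally have "(real n powr (- (1/2))) powr r \<le> ((ln (real n) / real n) powr rate_exp) powr r"
    using r by (intro powr_mono2) auto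
  then show ?thesis by (simp add: powr_powr)
qed

text \<open>
  The sample sizes for which the oracle inequality is used: the condition on \<open>osc_const\<close> makes the nets
  fine enough, those on \<open>h_frak\<close> and \<open>C3\<close> are for \<open>F_hat_inf_bounds\<close>, and the last two place the balancing
  bandwidth inside the range of \<open>bandwidths\<close>.
\<close>

definition regular :: "nat \<Rightarrow> bool" where
  "regular n \<longleftrightarrow> 1 \<le> ln (real n) \<and> h_frak \<omega> n \<le> 1 \<and> L * h_frak \<omega> n powr min \<beta> 1 \<le> 1 \<and> 4 * osc_const \<le> real n \<and>
     L * ((real n * (h_frak \<omega> n)\<^sup>2) powr (-1/2) * C3 n) \<le> 1/4 \<and> h_min \<omega> n \<le> balance n \<and> balance n \<le> 1"

lemma eventually_regular: "\<forall>\<^sub>F n in sequentially. regular n"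
proof -
  have w: "0 < \<omega>" by (rule noise_constants)
  have hf: "((\<lambda>n. h_frak \<omega> n) \<longlongrightarrow> 0) sequentially"
    unfolding h_frak_def using w by real_asymp
  have mb: "0 < min \<beta> 1" using \<beta> by simp
  have "((\<lambda>n. L * h_frak \<omega> n powr min \<beta> 1) \<longlongrightarrow> 0) sequentially"
  proof -
    have "((\<lambda>n. h_frak \<omega> n powr min \<beta> 1) \<longlongrightarrow> 0) sequentially"
      by (rule tendsto_zero_powrI[OF hf tendsto_const _ mb]) (simp add: h_frak_def)
    from tendsto_mult_left[OF this, of L] show ?thesis by simp
  qed
  then have e1: "\<forall>\<^sub>F n in sequentially. L * h_frak \<omega> n powr min \<beta> 1 < 1" by (rule order_tendstoD) simp
  have e2: "\<forall>\<^sub>F n in sequentially. h_frak \<omega> n < 1" using hf by (rule order_tendstoD) simp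
  have e3: "\<forall>\<^sub>F n in sequentially. 1 \<le> ln (real n)" by real_asymp
  have e4: "\<forall>\<^sub>F n in sequentially. 4 * osc_const \<le> real n"
    by (rule eventually_sequentiallyI[of "nat \<lceil>4 * osc_const\<rceil>"]) linarith
  have e5: "\<forall>\<^sub>F n in sequentially. (real n * (h_frak \<omega> n)\<^sup>2) powr (-1/2) * C3 n \<le> 1 / (4 * L)"
    using L by (intro C3_small) simp
  define a where "a = 1 / (2 * \<beta> + 1)"
  have a: "0 < a" "a < 1" using \<beta> by (auto simp: a_def)
  have "((\<lambda>n. (ln (real n) / real n) powr a) \<longlongrightarrow> 0) sequentially" using a by real_asymp
  from tendsto_mult_left[OF this, of bal_const]
  have "((\<lambda>n. bal_const * (ln (real n) / real n) powr a) \<longlongrightarrow> 0) sequentially" by simp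
  then have e6: "\<forall>\<^sub>F n in sequentially. balance n < 1"
    unfolding balance_def a_def by (rule order_tendstoD) simp
  have "((\<lambda>n. ln (real n) powr (1 + 2/\<omega>) / real n / (ln (real n) / real n) powr a) \<longlongrightarrow> 0) sequentially"
    using a w by real_asymp
  then have e7: "\<forall>\<^sub>F n in sequentially. ln (real n) powr (1 + 2/\<omega>) / real n / (ln (real n) / real n) powr a < bal_const"
    using bal_const_pos by (rule order_tendstoD)
  show ?thesis
    using e1 e2 e3 e4 e5 e6 e7
  proof eventually_elim
    case (elim n)
    have q: "0 < (ln (real n) / real n) powr a" by (rule powr_pos[OF log_ratio_pos[OF elim(3)]])
    have "h_min \<omega> n \<le> balance n"
      using elim(7)[unfolded pos_divide_less_eq[OF q]] unfolding h_min_def balance_def a_def[symmetric]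
      by (rule less_imp_le)
    moreover have "L * ((real n * (h_frak \<omega> n)\<^sup>2) powr (-1/2) * C3 n) \<le> 1/4"
      using mult_left_mono[OF elim(5), of L] L by simp
    ultimately show ?case using elim by (simp add: regular_def)
  qed
qed

text \<open>
  With the oracle bandwidth \<open>hs\<close> between \<open>balance n / 2\<close> and \<open>balance n\<close>, the threshold \<open>TH hs\<close> is of the
  order of the rate, because \<open>F_hat_inf\<close> is bounded and \<open>C1\<close> and \<open>C2\<close> are of order \<open>sqrt (ln n)\<close>.
\<close>

lemma good_event_error:
  obtains \<kappa> where "0 \<le> \<kappa>"
    "\<And>n t f \<theta> d s. regular n \<Longrightarrow> t \<in> square (1/2) \<Longrightarrow> f \<in> holder_class \<beta> L \<Longrightarrow> \<theta> \<in> sphere 0 1 \<Longrightarrow>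
      estimators_concentrate n t f \<theta> d \<Longrightarrow>
      averages_concentrate n f \<theta> d \<Longrightarrow>
      fst s \<in> sphere 0 1 \<Longrightarrow> snd s \<in> bandwidths \<omega> n \<Longrightarrow>
      \<forall>\<theta>\<in>sphere 0 1. \<forall>h\<in>bandwidths \<omega> n. criterion n d t (fst s, snd s) \<le> criterion n d t (\<theta>, h) \<Longrightarrow>
      \<bar>F_hat n d (E_mat (fst s) (snd s)) t - f (t \<bullet> \<theta>)\<bar> \<le> \<kappa> * (ln (real n) / real n) powr rate_exp"
proof -
  obtain C where C: "0 < C"
    "\<And>n. 1 \<le> ln (real n) \<Longrightarrow> C1 n \<le> C * sqrt (ln (real n))"
    "\<And>n. 1 \<le> ln (real n) \<Longrightarrow> C2 n \<le> C * sqrt (ln (real n))"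
    "\<And>n. 1 \<le> ln (real n) \<Longrightarrow> (real n * (h_frak \<omega> n)\<^sup>2) powr (-1/2) * C4 n \<le> C"
    using C_le by metis
  define FB where "FB = 2 * (K1\<^sup>2 * L + 1/4 + C) + 2 * (K1\<^sup>2 + C + 1/2)"
  have FB: "0 \<le> FB" using C(1) L by (simp add: FB_def)
  define \<kappa> where "\<kappa> = 12 * (Kinf\<^sup>2 + FB * C + C) * sqrt (2 / bal_const)"
  have \<kappa>: "0 \<le> \<kappa>" using FB C(1) bal_const_pos by (simp add: \<kappa>_def)
  show ?thesis
  proof (rule that[OF \<kappa>])
    fix n :: nat and t \<theta> :: "real^2" and f d and s :: "(real^2) \<times> real"
    assume reg: "regular n" and t: "t \<in> square (1/2)" and f: "f \<in> holder_class \<beta> L" and \<theta>: "\<theta> \<in> sphere 0 1"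
      and dev: "estimators_concentrate n t f \<theta> d"
      and devc: "averages_concentrate n f \<theta> d"
      and s: "fst s \<in> sphere 0 1" "snd s \<in> bandwidths \<omega> n"
      and crit: "\<forall>\<theta>\<in>sphere 0 1. \<forall>h\<in>bandwidths \<omega> n. criterion n d t (fst s, snd s) \<le> criterion n d t (\<theta>, h)"
    have n: "1 \<le> ln (real n)" and h1: "h_frak \<omega> n \<le> 1" and Lh: "L * h_frak \<omega> n powr min \<beta> 1 \<le> 1"
      and eps: "L * ((real n * (h_frak \<omega> n)\<^sup>2) powr (-1/2) * C3 n) \<le> 1/4" and bal: "h_min \<omega> n \<le> balance n" "balance n \<le> 1"
      using reg by (auto simp: regular_def)
    have mod: "\<bar>f x - f y\<bar> \<le> 1" if "\<bar>x - y\<bar> \<le> h_frak \<omega> n" for x y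
    proof -
      have "\<bar>f x - f y\<bar> \<le> L * \<bar>x - y\<bar> powr min \<beta> 1"
        using that h1 by (intro holder_modulus[OF \<beta> f]) linarith
      also have "\<dots> \<le> L * h_frak \<omega> n powr min \<beta> 1"
        using that L \<beta> by (intro mult_left_mono powr_mono2) auto
      finally show ?thesis using Lh by linarith
    qed
    note Fi = F_hat_inf_bounds[OF n h1 f \<theta> mod eps devc[rule_format]]
    have s4: "(real n * (h_frak \<omega> n)\<^sup>2) powr (-1/2) * C4 n \<le> C" by (rule C(4)[OF n])
    have "x \<le> 2 * (a + 1/4 + z) + 2 * (b + z + 1/2) \<Longrightarrow> z \<le> c \<Longrightarrow> x \<le> 2 * (a + 1/4 + c) + 2 * (b + c + 1/2)"
      for x a b c z :: real by (simp add: distrib_left)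
    from this[OF Fi(2)[unfolded C5_def] s4] have Fi_le: "F_hat_inf n d \<le> FB" unfolding FB_def .
    have Fm0: "0 \<le> supF f \<theta> + 1/2" using supF(2)[OF f, of \<theta>] by linarith
    then have Fi0: "0 \<le> F_hat_inf n d" using Fi(1) by linarith
    obtain hs where hs: "hs \<in> bandwidths \<omega> n" "hs \<le> balance n" "balance n / 2 \<le> hs"
      using oracle_bandwidth[OF n bal] .
    have err: "\<bar>F_hat n d (E_mat (fst s) (snd s)) t - f (t \<bullet> \<theta>)\<bar> \<le> 6 * TH n d hs"
      by (rule oracle_inequality[OF n t f \<theta> dev[rule_format] Fm0 Fi(1) hs(1)
            balance_bias[OF n bandwidth(1)[OF n hs(1)] hs(2)] s crit[rule_format, OF \<theta> hs(1)]])
    let ?l = "sqrt (ln (real n))"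
    have l0: "0 \<le> ?l" using n by simp
    have "Kinf\<^sup>2 * ?l + F_hat_inf n d * C1 n + C2 n \<le> Kinf\<^sup>2 * ?l + FB * (C * ?l) + C * ?l"
      using C_nonneg[OF n] l0 by (intro add_mono mult_mono C n Fi_le FB) auto
    also have "\<dots> = (Kinf\<^sup>2 + FB * C + C) * ?l" by (simp add: algebra_simps)
    finally have "TH n d hs \<le> 2 * ((Kinf\<^sup>2 + FB * C + C) * ?l) * (hs * real n) powr (-1/2)"
      unfolding TH_def by (intro mult_right_mono mult_left_mono) auto
    also have "\<dots> = 2 * (Kinf\<^sup>2 + FB * C + C) * (?l * (hs * real n) powr (-1/2))" by simp
    also have "\<dots> \<le> 2 * (Kinf\<^sup>2 + FB * C + C) * (sqrt (2 / bal_const) * (ln (real n) / real n) powr rate_exp)"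
      using FB C(1) by (intro mult_left_mono balance_error[OF n hs(3)]) auto
    finally have "6 * TH n d hs \<le> 6 * (2 * (Kinf\<^sup>2 + FB * C + C) * (sqrt (2 / bal_const) * (ln (real n) / real n) powr rate_exp))"
      by (rule mult_left_mono) simp
    also have "\<dots> = \<kappa> * (ln (real n) / real n) powr rate_exp" by (simp add: \<kappa>_def algebra_simps)
    finally have "6 * TH n d hs \<le> \<kappa> * (ln (real n) / real n) powr rate_exp" .
    then show "\<bar>F_hat n d (E_mat (fst s) (snd s)) t - f (t \<bullet> \<theta>)\<bar> \<le> \<kappa> * (ln (real n) / real n) powr rate_exp"
      using err by linarith
  qed
qed

lemma crude_le:
  assumes n: "1 \<le> ln (real n)"
  shows "crude n \<le> (2 * Kinf\<^sup>2 / gl + 1) * real n"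
proof -
  have n1: "1 \<le> real n" using n_ge_3[OF n] by simp
  have "1 \<le> ln (real n) powr (1 + 2/\<omega>)" using n noise_constants by (intro ge_one_powr_ge_zero) auto
  then have "1 / real n \<le> h_min \<omega> n" using n1 by (simp add: h_min_def divide_right_mono)
  then have "Kinf\<^sup>2 / (gl * (h_min \<omega> n / 2)) \<le> Kinf\<^sup>2 / (gl * (1 / real n / 2))"
    using design n1 h_min_pos[OF n] by (intro divide_left_mono mult_left_mono divide_right_mono mult_pos_pos) auto
  also have "\<dots> = 2 * Kinf\<^sup>2 / gl * real n" using n1 by simp
  finally show ?thesis unfolding crude_def distrib_right using n1 by linarith
qed

text \<open>
  On the exceptional event the crude bound is played off against the small probability by
  \<open>x \<le> \<delta> * x\<^sup>2 + 1 / \<delta>\<close>; with \<open>\<delta>\<close> the power \<open>- 5/2 * r\<close> of \<open>n\<close> both contributions are at most the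
  power \<open>- r/2\<close> of \<open>n\<close>, which is below the rate.
\<close>

lemma risk_regular:
  obtains \<kappa> where "0 \<le> \<kappa>"
    "\<And>n t f \<theta> sel. regular n \<Longrightarrow> t \<in> square (1/2) \<Longrightarrow> f \<in> holder_class \<beta> L \<Longrightarrow> \<theta> \<in> sphere 0 1 \<Longrightarrow>
      measurable_minimizer n t (sel t) \<Longrightarrow>
      pointwise_risk r t (sample_law g p n (\<lambda>x. f (x \<bullet> \<theta>))) (selected_estimator n sel) (\<lambda>x. f (x \<bullet> \<theta>)) \<le> ennreal (\<kappa> * rate n \<beta> L)"
proof -
  obtain \<kappa>1 where \<kappa>1: "0 \<le> \<kappa>1"
    "\<And>n t f \<theta> d s. regular n \<Longrightarrow> t \<in> square (1/2) \<Longrightarrow> f \<in> holder_class \<beta> L \<Longrightarrow> \<theta> \<in> sphere 0 1 \<Longrightarrow>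
      estimators_concentrate n t f \<theta> d \<Longrightarrow>
      averages_concentrate n f \<theta> d \<Longrightarrow>
      fst s \<in> sphere 0 1 \<Longrightarrow> snd s \<in> bandwidths \<omega> n \<Longrightarrow>
      \<forall>\<theta>\<in>sphere 0 1. \<forall>h\<in>bandwidths \<omega> n. criterion n d t (fst s, snd s) \<le> criterion n d t (\<theta>, h) \<Longrightarrow>
      \<bar>F_hat n d (E_mat (fst s) (snd s)) t - f (t \<bullet> \<theta>)\<bar> \<le> \<kappa>1 * (ln (real n) / real n) powr rate_exp"
    using good_event_error by blast
  define D where "D = 2 * Kinf\<^sup>2 / gl + 1"
  define B where "B = D powr r * (noise_mom + (1 + 2 * \<Upsilon>))"
  define A where "A = \<kappa>1 powr r + B"
  have D0: "0 \<le> D" using design by (simp add: D_def)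
  have B0: "0 \<le> B" using noise_mom_nonneg noise_constants by (simp add: B_def)
  have A0: "0 \<le> A" using B0 by (simp add: A_def)
  define \<kappa> where "\<kappa> = A powr (1 / r) / L powr (1 / (2 * \<beta> + 1))"
  show ?thesis
  proof (rule that[of \<kappa>])
    show "0 \<le> \<kappa>" by (simp add: \<kappa>_def)
    fix n :: nat and t \<theta> :: "real^2" and f and sel :: "real^2 \<Rightarrow> sample \<Rightarrow> (real^2) \<times> real"
    assume reg: "regular n" and t: "t \<in> square (1/2)" and f: "f \<in> holder_class \<beta> L" and \<theta>: "\<theta> \<in> sphere 0 1"
      and sel: "measurable_minimizer n t (sel t)"
    interpret Dr: prob_space "Draws n" by (rule prob_space_Draws)
    note [measurable] = holder_measurable[OF \<beta> f]
    let ?F = "\<lambda>x::real^2. f (x \<bullet> \<theta>)"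
    have F: "?F \<in> borel_measurable borel" by measurable
    have n: "1 \<le> ln (real n)" and h1: "h_frak \<omega> n \<le> 1" and osc: "4 * osc_const \<le> real n"
      using reg by (auto simp: regular_def)
    have n2: "2 \<le> n" and np: "0 < n" and n1: "1 \<le> real n" using n_ge_3[OF n] by auto
    define q where "q = (ln (real n) / real n) powr rate_exp"
    have q0: "0 \<le> q" by (simp add: q_def)
    define U where "U = (\<lambda>w::sample. \<Sum>i=1..n. (1 + L + \<bar>snd (w i)\<bar>) ^ mom_exp)"
    have U0: "0 \<le> U w" for w unfolding U_def using L by (intro sum_nonneg) auto
    have Uint: "(\<integral>\<^sup>+w. ennreal (U w) \<partial>Draws n) \<le> ennreal (real n * noise_mom)"
      "(\<lambda>w. ennreal (U w)) \<in> borel_measurable (Draws n)"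
      unfolding U_def by (rule nn_integral_envelope)+
    obtain Bad where Bad: "Bad \<in> sets (Draws n)" "Dr.prob Bad \<le> (1 + 2 * \<Upsilon>) * real n powr (- (4 * r))"
      "\<forall>w\<in>space (Draws n) - Bad.
      estimators_concentrate n t f \<theta> (data ?F n w) \<and> averages_concentrate n f \<theta> (data ?F n w)"
      using exceptional_event[OF n h1 osc t f, of \<theta>] by blast
    let ?err = "\<lambda>w. \<bar>selected_estimator n sel (data ?F n w) t - ?F t\<bar>"
    define \<delta> where "\<delta> = real n powr (- (5/2 * r))"
    have \<delta>: "0 < \<delta>" using n1 by (simp add: \<delta>_def)
    let ?c = "crude n powr r"
    have good: "?err w powr r \<le> (\<kappa>1 * q) powr r" if w: "w \<in> space (Draws n)" "w \<notin> Bad" for w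
    proof -
      note m = minimizer[OF sel w(1) F]
      have "?err w \<le> \<kappa>1 * q"
        unfolding selected_estimator_def q_def
        by (rule \<kappa>1(2)[OF reg t f \<theta> _ _ m(1,2)]) (use Bad(3) w m(3) in auto)
      then show ?thesis using r by (intro powr_mono2) auto
    qed
    have bad: "?err w powr r \<le> ?c * \<delta> * U w + ?c / \<delta>" if w: "w \<in> space (Draws n)" for w
    proof -
      have "?err w \<le> crude n * envelope n w"
        unfolding selected_estimator_def by (rule crude_error[OF n2 t f minimizer(1,2)[OF sel w F]])
      then have "?err w powr r \<le> (crude n * envelope n w) powr r" using r by (intro powr_mono2) auto
      also have "\<dots> = ?c * envelope n w powr r"
        using crude_ge_1[OF n2] envelope_ge_1[OF np, of w] by (simp add: powr_mult)
      also have "\<dots> \<le> ?c * (\<delta> * (envelope n w powr r)\<^sup>2 + 1 / \<delta>)"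
        by (intro mult_left_mono le_square_plus_inverse \<delta>) simp
      also have "(envelope n w powr r)\<^sup>2 = envelope n w powr (2 * r)"
        by (simp add: power2_eq_square flip: powr_add)
      also have "?c * (\<delta> * envelope n w powr (2 * r) + 1 / \<delta>) \<le> ?c * (\<delta> * U w + 1 / \<delta>)"
        unfolding U_def using \<delta> by (intro mult_left_mono add_right_mono envelope_powr_le[OF np mom_exp(1)]) auto
      finally show ?thesis by (simp add: distrib_left mult.assoc)
    qed
    have c0: "0 \<le> ?c" by simp
    have "(\<integral>\<^sup>+w. ennreal (?err w powr r) \<partial>Draws n)
      \<le> (\<integral>\<^sup>+w. ennreal ((\<kappa>1 * q) powr r) + ennreal (?c * \<delta>) * ennreal (U w) + ennreal (?c / \<delta>) * indicator Bad w \<partial>Draws n)"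
    proof (rule nn_integral_mono)
      fix w assume w: "w \<in> space (Draws n)"
      show "ennreal (?err w powr r) \<le> ennreal ((\<kappa>1 * q) powr r) + ennreal (?c * \<delta>) * ennreal (U w) + ennreal (?c / \<delta>) * indicator Bad w"
      proof (cases "w \<in> Bad")
        case True
        have "ennreal (?err w powr r) \<le> ennreal (?c * \<delta> * U w + ?c / \<delta>)" by (intro ennreal_leI bad w)
        also have "\<dots> = ennreal (?c * \<delta>) * ennreal (U w) + ennreal (?c / \<delta>)"
          using U0 \<delta> by (simp add: ennreal_plus ennreal_mult)
        also have "\<dots> \<le> ennreal ((\<kappa>1 * q) powr r) + (ennreal (?c * \<delta>) * ennreal (U w) + ennreal (?c / \<delta>))"
          by (rule add_increasing) auto
        finally show ?thesis using True by (simp add: add.assoc)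
      next
        case False
        have "ennreal (?err w powr r) \<le> ennreal ((\<kappa>1 * q) powr r)" by (intro ennreal_leI good w False)
        then show ?thesis by (meson add_increasing2 order_refl zero_le order_trans)
      qed
    qed
    also have "\<dots> = ennreal ((\<kappa>1 * q) powr r) + ennreal (?c * \<delta>) * (\<integral>\<^sup>+w. ennreal (U w) \<partial>Draws n) + ennreal (?c / \<delta>) * emeasure (Draws n) Bad"
    proof -
      have [measurable]: "(\<lambda>w. ennreal (U w)) \<in> borel_measurable (Draws n)" using Uint(2) .
      have [measurable]: "Bad \<in> sets (Draws n)" by (rule Bad(1))
      have "(\<integral>\<^sup>+w. ennreal ((\<kappa>1 * q) powr r) + ennreal (?c * \<delta>) * ennreal (U w) + ennreal (?c / \<delta>) * indicator Bad w \<partial>Draws n)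
        = (\<integral>\<^sup>+w. ennreal ((\<kappa>1 * q) powr r) + ennreal (?c * \<delta>) * ennreal (U w) \<partial>Draws n) + (\<integral>\<^sup>+w. ennreal (?c / \<delta>) * indicator Bad w \<partial>Draws n)"
        by (rule nn_integral_add) measurable
      also have "(\<integral>\<^sup>+w. ennreal ((\<kappa>1 * q) powr r) + ennreal (?c * \<delta>) * ennreal (U w) \<partial>Draws n)
        = (\<integral>\<^sup>+w. ennreal ((\<kappa>1 * q) powr r) \<partial>Draws n) + (\<integral>\<^sup>+w. ennreal (?c * \<delta>) * ennreal (U w) \<partial>Draws n)"
        by (rule nn_integral_add) measurable
      also have "(\<integral>\<^sup>+w. ennreal ((\<kappa>1 * q) powr r) \<partial>Draws n) = ennreal ((\<kappa>1 * q) powr r)"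
        unfolding nn_integral_const Dr.emeasure_space_1 by simp
      also have "(\<integral>\<^sup>+w. ennreal (?c * \<delta>) * ennreal (U w) \<partial>Draws n) = ennreal (?c * \<delta>) * (\<integral>\<^sup>+w. ennreal (U w) \<partial>Draws n)"
        by (rule nn_integral_cmult) (rule Uint(2))
      also have "(\<integral>\<^sup>+w. ennreal (?c / \<delta>) * indicator Bad w \<partial>Draws n) = ennreal (?c / \<delta>) * emeasure (Draws n) Bad"
        by (rule nn_integral_cmult_indicator[OF Bad(1)])
      finally show ?thesis .
    qed
    also have "\<dots> \<le> ennreal ((\<kappa>1 * q) powr r) + ennreal (?c * \<delta>) * ennreal (real n * noise_mom)
        + ennreal (?c / \<delta>) * ennreal ((1 + 2 * \<Upsilon>) * real n powr (- (4 * r)))"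
    proof -
      have "emeasure (Draws n) Bad \<le> ennreal ((1 + 2 * \<Upsilon>) * real n powr (- (4 * r)))"
        unfolding Dr.emeasure_eq_measure by (rule ennreal_leI[OF Bad(2)])
      then show ?thesis by (intro add_mono mult_left_mono order_refl Uint(1)) auto
    qed
    also have "\<dots> = ennreal ((\<kappa>1 * q) powr r + ?c * \<delta> * (real n * noise_mom) + ?c / \<delta> * ((1 + 2 * \<Upsilon>) * real n powr (- (4 * r))))"
    proof -
      have "ennreal x + ennreal a * ennreal b + ennreal c * ennreal d = ennreal (x + a * b + c * d)"
        if "0 \<le> x" "0 \<le> a" "0 \<le> b" "0 \<le> c" "0 \<le> d" for a b c d x
        using that by (simp add: ennreal_mult)
      then show ?thesis using noise_mom_nonneg \<delta> noise_constants by simp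
    qed
    also have "\<dots> \<le> ennreal (A * q powr r)"
    proof (rule ennreal_leI)
      have pw: "real n powr x * real n powr y = real n powr (x + y)" for x y by (simp only: powr_add)
      have "?c \<le> (D * real n) powr r"
        using crude_le[OF n] crude_ge_1[OF n2] r by (intro powr_mono2) (auto simp: D_def)
      also have "\<dots> = D powr r * real n powr r" using D0 n1 by (simp add: powr_mult)
      finally have cD: "?c \<le> D powr r * real n powr r" .
      have qn: "real n powr (- (r/2)) \<le> q powr r" unfolding q_def by (rule n_powr_le_rate[OF n])
      have "?c * \<delta> * (real n * noise_mom) \<le> D powr r * real n powr r * \<delta> * (real n * noise_mom)"
        using cD \<delta> noise_mom_nonneg by (intro mult_right_mono) auto
      also have "\<dots> = D powr r * noise_mom * (real n powr r * real n powr (- (5/2 * r)) * real n powr 1)"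
        using n1 by (simp add: \<delta>_def)
      also have "\<dots> = D powr r * noise_mom * real n powr (1 - 3/2 * r)" unfolding pw by (simp add: algebra_simps)
      also have "\<dots> \<le> D powr r * noise_mom * real n powr (- (r/2))"
        using n1 r noise_mom_nonneg by (intro mult_left_mono powr_mono) auto
      also have "\<dots> \<le> D powr r * noise_mom * q powr r" using noise_mom_nonneg by (intro mult_left_mono qn) auto
      finally have 1: "?c * \<delta> * (real n * noise_mom) \<le> D powr r * noise_mom * q powr r" .
      have inv: "1 / \<delta> = real n powr (5/2 * r)" unfolding \<delta>_def by (simp only: powr_minus_divide divide_divide_eq_right mult_1_left div_by_1)
      have tail: "c / d * (s * z) \<le> e * s * (x * y * z)"
        if "c \<le> e * x" "1 / d = y" "0 \<le> s" "0 \<le> z" "0 \<le> y" for c d e s x y z :: real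
      proof -
        have "c / d * (s * z) = c * (y * (s * z))" using that(2) by (simp add: divide_inverse mult.assoc)
        also have "\<dots> \<le> e * x * (y * (s * z))" by (intro mult_right_mono mult_nonneg_nonneg that)
        also have "\<dots> = e * s * (x * y * z)" by (simp only: mult_ac)
        finally show ?thesis .
      qed
      have "?c / \<delta> * ((1 + 2 * \<Upsilon>) * real n powr (- (4 * r)))
        \<le> D powr r * (1 + 2 * \<Upsilon>) * (real n powr r * real n powr (5/2 * r) * real n powr (- (4 * r)))"
        by (rule tail[OF cD inv]) (use noise_constants in auto)
      also have "real n powr r * real n powr (5/2 * r) * real n powr (- (4 * r)) = real n powr (- (r/2))"
        unfolding pw by (rule arg_cong[where f = "(powr) (real n)"]) simp
      also have "D powr r * (1 + 2 * \<Upsilon>) * real n powr (- (r/2)) \<le> D powr r * (1 + 2 * \<Upsilon>) * q powr r" using noise_constants by (intro mult_left_mono qn) auto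
      finally have 2: "?c / \<delta> * ((1 + 2 * \<Upsilon>) * real n powr (- (4 * r))) \<le> D powr r * (1 + 2 * \<Upsilon>) * q powr r" .
      have 3: "(\<kappa>1 * q) powr r = \<kappa>1 powr r * q powr r" using \<kappa>1(1) q0 by (simp add: powr_mult)
      have "A * q powr r = \<kappa>1 powr r * q powr r + D powr r * noise_mom * q powr r + D powr r * (1 + 2 * \<Upsilon>) * q powr r"
        by (simp add: A_def B_def algebra_simps)
      then show "(\<kappa>1 * q) powr r + ?c * \<delta> * (real n * noise_mom) + ?c / \<delta> * ((1 + 2 * \<Upsilon>) * real n powr (- (4 * r))) \<le> A * q powr r"
        using 1 2 3 by linarith
    qed
    finally have "pointwise_risk r t (sample_law g p n ?F) (selected_estimator n sel) ?F \<le> ennreal ((A * q powr r) powr (1 / r))"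
      by (rule pointwise_risk_le[OF F]) (use A0 in simp)
    also have "(A * q powr r) powr (1 / r) = A powr (1 / r) * q"
      using A0 q0 r by (simp add: powr_mult powr_powr)
    also have "\<dots> = \<kappa> * rate n \<beta> L"
      using L by (simp add: \<kappa>_def rate_eq q_def)
    finally show "pointwise_risk r t (sample_law g p n ?F) (selected_estimator n sel) ?F \<le> ennreal (\<kappa> * rate n \<beta> L)" .
  qed
qed

text \<open>
  For the finitely many sample sizes that are not \<open>regular\<close> the constant is raised to the largest quotient of
  the finite risk bound and the rate.
\<close>

lemma risk_bound:
  assumes t: "t \<in> square (1/2)"
  obtains \<kappa> where "0 < \<kappa>"
    "\<And>n sel. n1 \<le> n \<Longrightarrow> measurable_minimizer n t (sel t) \<Longrightarrow>
      (SUP F \<in> single_index_class \<beta> L. pointwise_risk r t (sample_law g p n F) (selected_estimator n sel) F) \<le> ennreal (\<kappa> * rate n \<beta> L)"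
proof -
  obtain \<kappa>0 where \<kappa>0: "0 \<le> \<kappa>0"
    "\<And>n t f \<theta> sel. regular n \<Longrightarrow> t \<in> square (1/2) \<Longrightarrow> f \<in> holder_class \<beta> L \<Longrightarrow> \<theta> \<in> sphere 0 1 \<Longrightarrow>
      measurable_minimizer n t (sel t) \<Longrightarrow>
      pointwise_risk r t (sample_law g p n (\<lambda>x. f (x \<bullet> \<theta>))) (selected_estimator n sel) (\<lambda>x. f (x \<bullet> \<theta>)) \<le> ennreal (\<kappa>0 * rate n \<beta> L)"
    using risk_regular by blast
  obtain N where N: "\<And>n. N \<le> n \<Longrightarrow> regular n"
    using eventually_regular by (auto simp: eventually_sequentially)
  define cr where "cr = (\<lambda>n. (crude n powr r * (real n * noise_mom)) powr (1 / r))"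
  have cr0: "0 \<le> cr n" for n by (simp add: cr_def)
  have rate0: "0 \<le> rate n \<beta> L" for n by (simp add: rate_def)
  have rate_pos: "0 < rate n \<beta> L" if "2 \<le> n" for n
  proof -
    have "0 < ln (real n) / real n" using that by simp
    then show ?thesis unfolding rate_def by (intro mult_pos_pos powr_pos L)
  qed
  define S where "S = (\<Sum>n<N. cr n / rate n \<beta> L)"
  have S0: "0 \<le> S" unfolding S_def using cr0 rate0 by (intro sum_nonneg) auto
  show ?thesis
  proof (rule that[of "\<kappa>0 + S + 1"])
    show "0 < \<kappa>0 + S + 1" using \<kappa>0(1) S0 by linarith
    fix n sel assume n: "n1 \<le> n" and sel: "measurable_minimizer n t (sel t)"
    have n2: "2 \<le> n" using n1_ge_2 n by (rule order_trans)
    show "(SUP F \<in> single_index_class \<beta> L. pointwise_risk r t (sample_law g p n F) (selected_estimator n sel) F) \<le> ennreal ((\<kappa>0 + S + 1) * rate n \<beta> L)"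
    proof (rule SUP_least)
      fix F assume "F \<in> single_index_class \<beta> L"
      then obtain f \<theta> where F: "F = (\<lambda>z. f (z \<bullet> \<theta>))" and f: "f \<in> holder_class \<beta> L" and \<theta>: "\<theta> \<in> sphere 0 1"
        by (auto simp: single_index_class_def)
      show "pointwise_risk r t (sample_law g p n F) (selected_estimator n sel) F \<le> ennreal ((\<kappa>0 + S + 1) * rate n \<beta> L)"
      proof (cases "N \<le> n")
        case True
        have "pointwise_risk r t (sample_law g p n F) (selected_estimator n sel) F \<le> ennreal (\<kappa>0 * rate n \<beta> L)"
          unfolding F by (rule \<kappa>0(2)[of n t f \<theta> sel, OF N[OF True] t f \<theta> sel])
        also have "\<dots> \<le> ennreal ((\<kappa>0 + S + 1) * rate n \<beta> L)"
          using S0 rate0 by (intro ennreal_leI mult_right_mono) auto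
        finally show ?thesis .
      next
        case False
        have "pointwise_risk r t (sample_law g p n F) (selected_estimator n sel) F \<le> ennreal (cr n)"
          unfolding F cr_def by (rule risk_crude[where sel=sel, OF n2 t f sel])
        also have "\<dots> \<le> ennreal ((\<kappa>0 + S + 1) * rate n \<beta> L)"
        proof (rule ennreal_leI)
          have "cr n / rate n \<beta> L \<le> S"
            unfolding S_def by (rule member_le_sum[where f="\<lambda>n. cr n / rate n \<beta> L"]) (use False cr0 rate0 in auto)
          then have "cr n / rate n \<beta> L \<le> \<kappa>0 + S + 1" using \<kappa>0(1) by linarith
          then show "cr n \<le> (\<kappa>0 + S + 1) * rate n \<beta> L" using rate_pos[OF n2] by (simp add: divide_le_eq)
        qed
        finally show ?thesis .
      qed
    qed
  qed
qed

end

theorem theorem3: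
  fixes \<K> :: "real \<Rightarrow> real" and g :: "real^2 \<Rightarrow> real" and p :: "real \<Rightarrow> real"
    and gl Q \<Upsilon> \<Omega> \<omega> b \<beta> L r :: real and t :: "real^2"
  assumes noise_constants: "0 < \<Upsilon>" "0 < \<Omega>" "\<Omega> \<le> 1" "0 < \<omega>"
    and noise: "p \<in> noise_densities \<Upsilon> \<Omega> \<omega>" "(LINT x|lborel. x * p x) = 0"
    and design: "prob_density g" "0 < gl" "gl < 1" "\<forall>x \<in> square 3. gl \<le> g x"
    and kernel: "kernel_assumption \<K> Q"
    and b: "0 < b"
    and moments: "\<forall>j \<in> {1..strict_floor b}. (LINT z|lborel. z ^ j * \<K> z) = 0"
    and \<beta>: "0 < \<beta>" "\<beta> \<le> b"
    and L: "0 < L"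
    and r: "1 \<le> r"
    and t: "t \<in> square (1/2)"
  shows "\<exists>\<kappa>>0. \<forall>\<beta>0 M n sel.
    0 < \<beta>0 \<and> \<beta>0 < 1 \<and> 0 < M \<and> holder_class \<beta> L \<subseteq> holder_ball \<beta>0 M \<and>
    max (n0 \<omega> \<beta>0 M) (single_index_procedure.n1 \<K> gl Q \<omega> r) \<le> n \<and>
    single_index_procedure.measurable_minimizer \<K> g gl Q \<Upsilon> \<Omega> \<omega> r n t (sel t) \<longrightarrow>
    (SUP F \<in> single_index_class \<beta> L.
       pointwise_risk r t (sample_law g p n F)
         (single_index_procedure.selected_estimator \<K> g n sel) F)
    \<le> ennreal (\<kappa> * rate n \<beta> L)"
proof -
  interpret single_index_model \<K> g gl Q \<Upsilon> \<Omega> \<omega> r p \<beta> L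
  proof
    fix j assume "j \<in> {1..strict_floor \<beta>}"
    then have "j \<in> {1..strict_floor b}" using strict_floor_mono[OF \<beta>] by auto
    then show "(LINT z|lborel. z ^ j * \<K> z) = 0" using moments by blast
  qed (use assms in auto)
  obtain \<kappa> where \<kappa>: "0 < \<kappa>"
    "\<And>n sel. n1 \<le> n \<Longrightarrow> measurable_minimizer n t (sel t) \<Longrightarrow>
      (SUP F \<in> single_index_class \<beta> L. pointwise_risk r t (sample_law g p n F) (selected_estimator n sel) F)
      \<le> ennreal (\<kappa> * rate n \<beta> L)"
    using risk_bound[OF t] by blast
  show ?thesis
  proof (intro exI[of _ \<kappa>] conjI allI impI)
    show "0 < \<kappa>" by (rule \<kappa>(1))
    fix \<beta>0 M n sel
    assume "0 < \<beta>0 \<and> \<beta>0 < 1 \<and> 0 < M \<and> holder_class \<beta> L \<subseteq> holder_ball \<beta>0 M \<and>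
      max (n0 \<omega> \<beta>0 M) n1 \<le> n \<and> measurable_minimizer n t (sel t)"
    then have "n1 \<le> n" "measurable_minimizer n t (sel t)" by auto
    then show "(SUP F \<in> single_index_class \<beta> L. pointwise_risk r t (sample_law g p n F) (selected_estimator n sel) F)
      \<le> ennreal (\<kappa> * rate n \<beta> L)" by (rule \<kappa>(2))
  qed
qed

end
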